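(* Let $p$ be a prime, let $\alpha\ge 1$ be an integer, let $a,b$ be positive integers with $\gcd(a,b)=1$, and let $M=M_{ap^{\alpha},bp^{\alpha}}$ be a local singular arithmetical congruence monoid with $\gcd(ap^\alpha,bp^\alpha)=p^\alpha$. Let $\beta$ be the smallest positive integer such that $p^{\beta}\in M$. Then the catenary degree of $M$ is $$\mathsf{c}(M)=\begin{cases}2 & \text{if }\alpha=\beta=1,\\ 3 & \text{if }\alpha=\beta>1,\\ 1+\left\lceil\frac{\beta}{\alpha}\right\rceil & \text{if }\alpha<\beta.\end{cases}$$
   Context: For integers $0<A\le B$ with $A^2\equiv A \pmod B$, the arithmetical congruence monoid (ACM) is $M_{A,B}=\{A+Bk : k\in\mathbb{N}_0\}\cup\{1\}$ under multiplication; its only unit is $1$. It is called singular if $\gcd(A,B)\neq1$, and local singular if $\gcd(A,B)$ is a positive power of a single prime. Let $M$ be an ACM. An atom is an element $\neq1$ that is not a product of two elements of $M\setminus\{1\}$. A factorization of $x\in M$ is a finite multiset (formal commutative product) of atoms whose product is $x$; $\mathsf{Z}(x)$ is the set of factorizations of $x$. For $z_1,z_2\in\mathsf{Z}(x)$, write $z_1=\alpha_1\cdots\alpha_j\gamma_1\cdots\gamma_\ell$ and $z_2=\beta_1\cdots\beta_k\gamma_1\cdots\gamma_\ell$ as formal products of atoms with $\{\alpha_1,\dots,\alpha_j\}\cap\{\beta_1,\dots,\beta_k\}=\emptyset$; the distance is $\mathsf{d}(z_1,z_2)=\max\{j,k\}$. An $N$-chain between $z,z'\in\mathsf{Z}(x)$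 is a sequence $z=z_0,z_1,\dots,z_t=z'$ in $\mathsf{Z}(x)$ with $\mathsf{d}(z_{i-1},z_i)\le N$ for $1\le i\le t$. The catenary degree of $x$ is $\mathsf{c}(x)=\min\{N:\text{there is an } N\text{-chain between any } z_1,z_2\in\mathsf{Z}(x)\}$, and $\mathsf{c}(M)=\sup\{\mathsf{c}(x):x\in M\}$. *)

theory Defs
  imports Complex_Main "HOL-Library.Multiset" "HOL-Library.Extended_Nat"
    "HOL-Computational_Algebra.Primes" "HOL-Number_Theory.Cong"
begin

definition acm_set :: "nat \<Rightarrow> nat \<Rightarrow> nat set"
  where "acm_set A B = {A + B * k | k. True} \<union> {1}"

definition is_acm :: "nat \<Rightarrow> nat \<Rightarrow> bool"
  where "is_acm A B \<longleftrightarrow> 0 < A \<and> A \<le> B \<and> [A ^ 2 = A] (mod B)"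

definition local_singular_acm :: "nat \<Rightarrow> nat \<Rightarrow> bool"
  where "local_singular_acm A B \<longleftrightarrow>
    is_acm A B \<and> (\<exists>q k. prime q \<and> 0 < k \<and> gcd A B = q ^ k)"

text \<open>The notions below are stated for a set \<open>M\<close> of natural numbers, meant to be a
  multiplicative monoid whose only unit is \<open>1\<close>.\<close>

definition atoms_of :: "nat set \<Rightarrow> nat set"
  where "atoms_of M = {x \<in> M. x \<noteq> 1 \<and> \<not> (\<exists>y \<in> M - {1}. \<exists>z \<in> M - {1}. x = y * z)}"

definition factorizations :: "nat set \<Rightarrow> nat \<Rightarrow> nat multiset set"
  where "factorizations M x = {z. set_mset z \<subseteq> atoms_of M \<and> prod_mset z = x}"

text \<open>The common part of two factorizations is their multiset intersection, so the
  two remainders are the multiset differences; see \<open>fact_dist_eqI\<close>.\<close>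

definition fact_dist :: "nat multiset \<Rightarrow> nat multiset \<Rightarrow> nat"
  where "fact_dist z1 z2 = max (size (z1 - z2)) (size (z2 - z1))"

lemma fact_dist_eqI:
  assumes "z1 = u + w" and "z2 = v + w" and "set_mset u \<inter> set_mset v = {}"
  shows "fact_dist z1 z2 = max (size u) (size v)"
proof -
  have "u \<inter># v = {#}"
    using assms(3) by (simp flip: set_mset_eq_empty_iff)
  then have "u - v = u" and "v - u = v"
    by (metis diff_intersect_left_idem diff_zero)
       (metis \<open>u \<inter># v = {#}\<close> diff_intersect_right_idem diff_zero)
  then show ?thesis
    by (simp add: fact_dist_def assms(1,2))
qed

definition is_chain :: "nat set \<Rightarrow> nat \<Rightarrow> nat \<Rightarrow> nat multiset \<Rightarrow> nat multiset \<Rightarrow> nat multiset list \<Rightarrow> bool"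
  where "is_chain M x N z z' zs \<longleftrightarrow>
    zs \<noteq> [] \<and> hd zs = z \<and> last zs = z' \<and> set zs \<subseteq> factorizations M x \<and>
    (\<forall>i. Suc i < length zs \<longrightarrow> fact_dist (zs ! i) (zs ! Suc i) \<le> N)"

text \<open>The infimum is a minimum whenever some \<open>N\<close> is admissible, and \<open>\<infinity>\<close> otherwise.\<close>

definition catenary_degree_elem :: "nat set \<Rightarrow> nat \<Rightarrow> enat"
  where "catenary_degree_elem M x =
    Inf {enat N | N. \<forall>z1 \<in> factorizations M x. \<forall>z2 \<in> factorizations M x.
                       \<exists>zs. is_chain M x N z1 z2 zs}"

definition catenary_degree :: "nat set \<Rightarrow> enat"
  where "catenary_degree M = (SUP x \<in> M. catenary_degree_elem M x)"

end

theory Submission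
  imports Defs "HOL-Number_Theory.Number_Theory" "HOL-Analysis.Analysis" "HOL-Real_Asymp.Real_Asymp"
begin

text \<open>Apart from 1, the monoid consists of the positive \<open>x \<equiv> 1 (mod b)\<close> divisible by \<open>p\<^sup>\<alpha>\<close>; its atoms
  contain at least \<open>\<alpha>\<close> and fewer than \<open>\<alpha> + \<beta>\<close> factors \<open>p\<close>. For the upper bound, any factorization
  of an element with at least \<open>\<alpha> + \<beta>\<close> factors \<open>p\<close> is joined by one short step to a factorization
  containing the atom \<open>p\<^sup>\<beta>\<close>, which is then cancelled. The lower bound 3 comes from elements with
  factorizations of different lengths, as two distinct factorizations never differ in fewer than two
  atoms on either side. If \<open>\<beta> > 2 \<alpha>\<close>, then \<open>\<beta>\<close> is the order of \<open>p\<close> modulo \<open>b\<close>, and a prime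
  \<open>q \<equiv> p\<^sup>-\<^sup>\<alpha> (mod b)\<close>, supplied by Dirichlet's theorem, gives an element with exactly two
  factorizations, of lengths 2 and \<open>1 + \<lceil>\<beta>/\<alpha>\<rceil>\<close>.

  Dirichlet's theorem is proved with L-series at real \<open>s > 1\<close>. Their product is bounded away from 0
  as \<open>s \<longrightarrow> 1\<close>, while the principal factor is \<open>O(1/(s - 1))\<close>; so at most one of them vanishes at 1,
  and a complex character would come with its conjugate. Real characters are handled by Monsky's
  Lambert series argument.\<close>

section \<open>Dirichlet characters\<close>

text \<open>The obstacle is the lower bound for \<beta> > 2 \<alpha>. There the value exceeds 3, so
  a mere difference of lengths no longer suffices: all factorizations of the chosen element must be
  known, since an intermediate one could shorten the jumps. A composite cofactor in place of q could
  be distributed over atoms in many ways; a prime one leaves only exponents of p and q to compare.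
  This is where Dirichlet's theorem enters. The constant 1 + \<lceil>\<beta>/\<alpha>\<rceil> counts
  atoms: each carries at least \<alpha> factors p, so a minimal collection with at least \<alpha> +
  \<beta> of them has, apart from one atom, at most \<lceil>\<beta>/\<alpha>\<rceil> atoms. The
  threshold \<alpha> + \<beta> is what lets p^\<beta> be split off inside the monoid: the cofactor
  keeps \<alpha> factors p and its residue 1. In the analytic part, two zeros at 1 against one
  simple pole would force the product of the L-series to tend to 0. A single zero only cancels the
  pole, so real characters escape this count and need an argument of their own.\<close>

definition dchars :: "nat \<Rightarrow> (nat \<Rightarrow> complex) set"
  where "dchars b = {\<phi>. (\<forall>m n. \<phi> (m * n) = \<phi> m * \<phi> n) \<and>
     (\<forall>m n. [m = n] (mod b) \<longrightarrow> \<phi> m = \<phi> n) \<and> (\<forall>n. \<phi> n = 0 \<longleftrightarrow> \<not> coprime n b)}"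

lemma
  assumes "\<phi> \<in> dchars b"
  shows dchar_mult: "\<phi> (m * n) = \<phi> m * \<phi> n"
    and dchar_cong: "[m = n] (mod b) \<Longrightarrow> \<phi> m = \<phi> n"
    and dchar_eq_0_iff: "\<phi> n = 0 \<longleftrightarrow> \<not> coprime n b"
  using assms by (auto simp: dchars_def)

lemma dchar_1: "\<phi> \<in> dchars b \<Longrightarrow> \<phi> (Suc 0) = 1"
  using dchar_mult[of \<phi> b 1 1] dchar_eq_0_iff[of \<phi> b 1] by simp

lemma dchar_power: "\<phi> \<in> dchars b \<Longrightarrow> \<phi> (n ^ k) = \<phi> n ^ k"
  by (induction k) (auto simp: dchar_1 dchar_mult)

lemma dchar_root:
  assumes "\<phi> \<in> dchars b" "coprime n b"
  shows "\<phi> n ^ totient b = 1"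
  using dchar_cong[OF assms(1) euler_theorem[OF assms(2)]] assms(1)
  by (simp add: dchar_1 dchar_power)

lemma norm_dchar:
  assumes "\<phi> \<in> dchars b" "b > 0"
  shows "norm (\<phi> n) = (if coprime n b then 1 else 0)"
proof (cases "coprime n b")
  case True
  have "norm (\<phi> n) ^ totient b = 1"
    using dchar_root[OF assms(1) True] by (metis norm_one norm_power)
  then have "norm (\<phi> n) = 1"
    using assms(2) power_eq_1_iff[of "norm (\<phi> n)" "totient b"] by simp
  with True show ?thesis by simp
qed (use dchar_eq_0_iff[OF assms(1)] in auto)

lemma norm_dchar_le: "\<phi> \<in> dchars b \<Longrightarrow> b > 0 \<Longrightarrow> norm (\<phi> n) \<le> 1"
  by (simp add: norm_dchar)

lemma dchar_times_in: "\<phi> \<in> dchars b \<Longrightarrow> \<psi> \<in> dchars b \<Longrightarrow> (\<lambda>n. \<phi> n * \<psi> n) \<in> dchars b"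
  by (auto simp: dchars_def)

lemma dchar_cnj_in: "\<phi> \<in> dchars b \<Longrightarrow> (\<lambda>n. cnj (\<phi> n)) \<in> dchars b"
  by (auto simp: dchars_def)

lemma dchar_times_cnj: "\<phi> \<in> dchars b \<Longrightarrow> b > 0 \<Longrightarrow> coprime n b \<Longrightarrow> \<phi> n * cnj (\<phi> n) = 1"
  by (simp add: complex_norm_square[symmetric] norm_dchar)

lemma cong_coprime_left: "[m = n] (mod b) \<Longrightarrow> coprime m (b::nat) \<longleftrightarrow> coprime n b"
  using cong_imp_coprime[of m n b] cong_imp_coprime[of n m b] by (auto simp: cong_sym)

definition principal_dchar :: "nat \<Rightarrow> nat \<Rightarrow> complex"
  where "principal_dchar b n = (if coprime n b then 1 else 0)"

lemma principal_dchar_in: "principal_dchar b \<in> dchars b"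
  by (auto simp: dchars_def principal_dchar_def cong_coprime_left)

text \<open>A character is determined by its values on one period, and each of these is 0 or a root
  of unity of order dividing \<open>totient b\<close>.\<close>

lemma finite_dchars:
  assumes "b > 0"
  shows "finite (dchars b)"
proof -
  define Z where "Z = insert 0 {z::complex. z ^ totient b = 1}"
  have "finite Z"
    unfolding Z_def using assms by (auto intro!: finite_roots_unity simp: Suc_le_eq)
  moreover have "(\<lambda>\<phi>. restrict \<phi> {..<b}) ` dchars b \<subseteq> PiE {..<b} (\<lambda>_. Z)"
    unfolding image_subset_iff restrict_PiE_iff
    by (auto simp: Z_def dchar_eq_0_iff dchar_root)
  ultimately have "finite ((\<lambda>\<phi>. restrict \<phi> {..<b}) ` dchars b)"
    by (meson finite_PiE finite_lessThan finite_subset)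
  moreover have "inj_on (\<lambda>\<phi>. restrict \<phi> {..<b}) (dchars b)"
  proof (intro inj_onI ext)
    fix \<phi> \<psi> n assume *: "\<phi> \<in> dchars b" "\<psi> \<in> dchars b" "restrict \<phi> {..<b} = restrict \<psi> {..<b}"
    have "\<phi> (n mod b) = \<psi> (n mod b)"
      using fun_cong[OF *(3), of "n mod b"] assms by simp
    then show "\<phi> n = \<psi> n"
      using dchar_cong[OF *(1), of "n mod b" n] dchar_cong[OF *(2), of "n mod b" n]
      by (simp add: Cong.cong_def)
  qed
  ultimately show ?thesis
    using finite_imageD by blast
qed

section \<open>Extension of characters from subgroups of residue classes\<close>

definition partial_dchar :: "nat \<Rightarrow> nat set \<Rightarrow> (nat \<Rightarrow> complex) \<Rightarrow> bool"
  where "partial_dchar b K \<phi> \<longleftrightarrow> 1 \<in> K \<and> \<phi> 1 = 1 \<and> (\<forall>m\<in>K. coprime m b) \<and>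
    (\<forall>m\<in>K. \<forall>n\<in>K. m * n \<in> K \<and> \<phi> (m * n) = \<phi> m * \<phi> n) \<and>
    (\<forall>m\<in>K. \<forall>n. [m = n] (mod b) \<longrightarrow> n \<in> K \<and> \<phi> n = \<phi> m)"

lemma
  assumes "partial_dchar b K \<phi>"
  shows partial_dchar_1: "1 \<in> K" "\<phi> 1 = 1"
    and partial_dchar_coprime: "m \<in> K \<Longrightarrow> coprime m b"
    and partial_dchar_mult: "m \<in> K \<Longrightarrow> n \<in> K \<Longrightarrow> m * n \<in> K"
      "m \<in> K \<Longrightarrow> n \<in> K \<Longrightarrow> \<phi> (m * n) = \<phi> m * \<phi> n"
    and partial_dchar_cong: "m \<in> K \<Longrightarrow> [m = n] (mod b) \<Longrightarrow> n \<in> K"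
      "m \<in> K \<Longrightarrow> [m = n] (mod b) \<Longrightarrow> \<phi> n = \<phi> m"
  using assms unfolding partial_dchar_def by meson+

lemma partial_dchar_power:
  assumes "partial_dchar b K \<phi>" "m \<in> K"
  shows "m ^ k \<in> K \<and> \<phi> (m ^ k) = \<phi> m ^ k"
proof (induction k)
  case (Suc k)
  then show ?case using partial_dchar_mult[OF assms(1,2), of "m ^ k"] by simp
qed (use partial_dchar_1[OF assms(1)] in simp)

lemma partial_dchar_nonzero:
  assumes "partial_dchar b K \<phi>" "m \<in> K" "b > 0"
  shows "\<phi> m \<noteq> 0"
proof
  assume "\<phi> m = 0"
  then have "\<phi> (m ^ totient b) = 0" "m ^ totient b \<in> K"
    using partial_dchar_power[OF assms(1,2), of "totient b"] assms(3) by auto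
  moreover have "[m ^ totient b = 1] (mod b)"
    using assms euler_theorem unfolding partial_dchar_def by blast
  ultimately have "\<phi> 1 = 0"
    using assms(1) unfolding partial_dchar_def by metis
  then show False
    using assms(1) by (simp add: partial_dchar_def)
qed

text \<open>Closure under inverses is not part of \<open>partial_dchar\<close>; by Euler's theorem
  the power \<open>g ^ (totient b - 1)\<close> acts as the inverse of \<open>g\<close>.\<close>

lemma partial_dchar_cancel:
  assumes K: "partial_dchar b K \<phi>" and "g \<in> K" "u * g \<in> K" "b > 0"
  shows "u \<in> K"
proof -
  have "u * g * g ^ (totient b - 1) \<in> K"
    using assms partial_dchar_power[OF K assms(2)] unfolding partial_dchar_def by blast
  also have "u * g * g ^ (totient b - 1) = u * g ^ totient b"
    using \<open>b > 0\<close> power_minus_mult[of "totient b" g] by (simp add: mult_ac)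
  finally have "u * g ^ totient b \<in> K" .
  moreover have "[u * g ^ totient b = u * 1] (mod b)"
    using assms euler_theorem[of g b] unfolding partial_dchar_def by (intro cong_mult cong_refl) blast
  ultimately show ?thesis
    using K unfolding partial_dchar_def by (metis mult.right_neutral)
qed

text \<open>Adjoining \<open>y\<close> to the subgroup \<open>K\<close>: minimality makes
  \<open>k\<close> the order of \<open>y\<close> modulo \<open>K\<close>, so
  \<open>\<zeta> ^ k = \<phi> (y ^ k)\<close> is the only constraint on the new value.\<close>

lemma partial_dchar_extend:
  assumes K: "partial_dchar b K \<phi>" and y: "coprime y b" and "b > 0" "k > 0" "y ^ k \<in> K"
    and min: "\<And>i. 0 < i \<Longrightarrow> i < k \<Longrightarrow> y ^ i \<notin> K" and \<zeta>: "\<zeta> ^ k = \<phi> (y ^ k)"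
  shows "\<exists>K' \<phi>'. partial_dchar b K' \<phi>' \<and> K \<subseteq> K' \<and> y \<in> K' \<and> (\<forall>m\<in>K. \<phi>' m = \<phi> m) \<and> \<phi>' y = \<zeta>"
proof -
  \<comment> \<open>\<open>R m (i, g)\<close> represents \<open>m\<close> as
    \<open>y ^ i * g\<close>, and \<open>v\<close> is the value that this representation prescribes.
    Representations are not unique: \<open>\<phi>'\<close> picks one, and \<open>wd\<close> shows
    that the choice is immaterial.\<close>
  define R where "R = (\<lambda>m (i,g). g \<in> K \<and> [m = y ^ i * g] (mod b))"
  define K' where "K' = {m. \<exists>s. R m s}"
  define v where "v = (\<lambda>(i, g). \<zeta> ^ i * \<phi> g)"
  define \<phi>' where "\<phi>' = (\<lambda>m. v (SOME s. R m s))"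
  \<comment> \<open>Two representations differ by a power \<open>y ^ d\<close> that lies in
    \<open>K\<close>. Minimality of \<open>k\<close> forces \<open>k\<close> to divide
    \<open>d\<close>, and then \<open>\<phi> (y ^ d) = \<zeta> ^ d\<close>.\<close>
  have wd0: "\<zeta> ^ i * \<phi> g = \<zeta> ^ j * \<phi> g'"
    if "g \<in> K" "g' \<in> K" "[y ^ i * g = y ^ j * g'] (mod b)" "i \<le> j" for i j g g'
  proof -
    define d where "d = j - i"
    have j: "j = i + d" using that d_def by simp
    have "[y ^ i * g = y ^ i * (y ^ d * g')] (mod b)"
      using that j by (simp add: power_add mult_ac)
    then have c: "[g = y ^ d * g'] (mod b)"
      using y cong_mult_lcancel_nat by (metis coprime_commute coprime_power_right_iff)
    then have 1: "y ^ d * g' \<in> K" and 2: "\<phi> (y ^ d * g') = \<phi> g"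
      using partial_dchar_cong[OF K \<open>g \<in> K\<close>] by blast+
    have yd: "y ^ d \<in> K"
      using partial_dchar_cancel[OF K that(2) 1 \<open>b > 0\<close>] .
    have eq: "y ^ d = y ^ (d mod k) * (y ^ k) ^ (d div k)"
      by (simp flip: power_mult power_add)
    have "y ^ (d mod k) \<in> K"
      using partial_dchar_cancel[OF K _ _ \<open>b > 0\<close>] partial_dchar_power[OF K \<open>y ^ k \<in> K\<close>] yd eq by metis
    then have "d mod k = 0"
      using min[of "d mod k"] \<open>k > 0\<close> by (metis gr0I mod_less_divisor)
    then obtain e where e: "d = k * e" by blast
    have "\<phi> (y ^ d) = \<zeta> ^ d"
      using partial_dchar_power[OF K \<open>y ^ k \<in> K\<close>, of e] \<zeta>
      unfolding e power_mult by simp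
    moreover have "\<phi> (y ^ d * g') = \<phi> (y ^ d) * \<phi> g'"
      using partial_dchar_mult[OF K yd] that by blast
    ultimately show ?thesis
      using 2 j by (simp add: power_add mult_ac)
  qed
  have wd: "v s = v t" if "R m s" "R m t" for m s t
  proof -
    obtain i g j g' where st: "s = (i, g)" "t = (j, g')" by (metis surj_pair)
    have "[y ^ i * g = y ^ j * g'] (mod b)" "g \<in> K" "g' \<in> K"
      using that st by (auto simp: R_def intro: cong_trans cong_sym)
    then show ?thesis
      using wd0[of g g' i j] wd0[of g' g j i] st by (cases "i \<le> j") (auto simp: v_def cong_sym)
  qed
  have val: "m \<in> K' \<and> \<phi>' m = v s" if "R m s" for m s
    using that someI[of "R m" s] wd unfolding K'_def \<phi>'_def by blast
  have K'_R: "\<exists>i g. R m (i, g)" if "m \<in> K'" for m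
    using that unfolding K'_def by auto
  have K1: "R m (0, m)" if "m \<in> K" for m using that by (simp add: R_def)
  have Ry: "R y (1, 1)" using partial_dchar_1[OF K] by (simp add: R_def)
  have Rmult: "R (m * n) (i + j, g * h)" if "R m (i, g)" "R n (j, h)" for m n i j g h
  proof -
    have "[m * n = (y ^ i * g) * (y ^ j * h)] (mod b)"
      using that by (intro cong_mult) (auto simp: R_def)
    then show ?thesis using that partial_dchar_mult(1)[OF K, of g h]
      by (simp add: R_def power_add mult_ac)
  qed
  have "partial_dchar b K' \<phi>'"
    unfolding partial_dchar_def
  proof (intro conjI ballI allI impI)
    show "1 \<in> K'" "\<phi>' 1 = 1"
      using val[OF K1[of 1]] partial_dchar_1[OF K] by (auto simp: v_def)
    show "coprime m b" if m: "m \<in> K'" for m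
    proof -
      obtain i g where "g \<in> K" "[m = y ^ i * g] (mod b)"
        using m by (auto simp: K'_def R_def)
      moreover have "coprime (y ^ i * g) b"
        using y partial_dchar_coprime[OF K \<open>g \<in> K\<close>] by simp
      ultimately show ?thesis by (simp add: cong_coprime_left)
    qed
    show "m * n \<in> K'" "\<phi>' (m * n) = \<phi>' m * \<phi>' n" if mn: "m \<in> K'" "n \<in> K'" for m n
    proof -
      obtain i g j h where *: "R m (i, g)" "R n (j, h)"
        using mn K'_R by metis
      then have "g \<in> K" "h \<in> K" by (auto simp: R_def)
      then have "\<phi> (g * h) = \<phi> g * \<phi> h" by (rule partial_dchar_mult[OF K])
      with val[OF *(1)] val[OF *(2)] val[OF Rmult[OF *]]
      show "m * n \<in> K'" "\<phi>' (m * n) = \<phi>' m * \<phi>' n"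
        by (auto simp: v_def power_add)
    qed
    show "n \<in> K'" "\<phi>' n = \<phi>' m" if mn: "m \<in> K'" "[m = n] (mod b)" for m n
    proof -
      obtain i g where *: "R m (i, g)"
        using mn K'_R by metis
      then have "R n (i, g)"
        using that by (auto simp: R_def intro: cong_trans cong_sym)
      with val * show "n \<in> K'" "\<phi>' n = \<phi>' m" by auto
    qed
  qed
  moreover have "\<forall>m\<in>K. m \<in> K' \<and> \<phi>' m = \<phi> m"
    using val[OF K1] by (auto simp: v_def)
  moreover have "y \<in> K'" "\<phi>' y = \<zeta>"
    using val[OF Ry] partial_dchar_1[OF K] by (auto simp: v_def)
  ultimately show ?thesis by blast
qed

lemma least_power_in:
  assumes "partial_dchar b K \<phi>" "coprime y b" "b > 0"
  obtains k where "k > 0" "y ^ k \<in> K" "\<And>i. 0 < i \<Longrightarrow> i < k \<Longrightarrow> y ^ i \<notin> K"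
proof -
  have "[1 = y ^ totient b] (mod b)"
    using euler_theorem[OF assms(2)] by (simp add: cong_sym)
  then have "y ^ totient b \<in> K"
    using partial_dchar_cong(1)[OF assms(1) partial_dchar_1(1)[OF assms(1)]] by blast
  then have ex: "0 < totient b \<and> y ^ totient b \<in> K"
    using assms by simp
  show ?thesis
    using that exists_least_iff[of "\<lambda>k. 0 < k \<and> y ^ k \<in> K"] ex by metis
qed

text \<open>Induction on the number of residues below \<open>b\<close> outside \<open>K\<close>. As
  long as some unit is missing, it is adjoined with an arbitrary complex root as its value.\<close>

lemma partial_dchar_extend_full:
  assumes "partial_dchar b K \<phi>" "b > 0"
  shows "\<exists>\<psi>\<in>dchars b. \<forall>m\<in>K. \<psi> m = \<phi> m"
  using assms(1)
proof (induction "card ({..<b} - K)" arbitrary: K \<phi> rule: less_induct)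
  case less
  show ?case
  proof (cases "\<forall>y. coprime y b \<longrightarrow> y \<in> K")
    case True
    then have *: "y \<in> K \<longleftrightarrow> coprime y b" for y
      using partial_dchar_coprime[OF less.prems] by blast
    define \<psi> where "\<psi> = (\<lambda>n. if coprime n b then \<phi> n else 0)"
    have "\<psi> \<in> dchars b"
      unfolding dchars_def
    proof (intro CollectI conjI allI impI)
      show "\<psi> (m * n) = \<psi> m * \<psi> n" for m n
        using partial_dchar_mult(2)[OF less.prems, of m n] * by (simp add: \<psi>_def)
      show "\<psi> m = \<psi> n" if "[m = n] (mod b)" for m n
        using partial_dchar_cong(2)[OF less.prems _ that] cong_coprime_left[OF that] *
        by (simp add: \<psi>_def)
      show "\<psi> n = 0 \<longleftrightarrow> \<not> coprime n b" for n
        using partial_dchar_nonzero[OF less.prems _ \<open>b > 0\<close>] * by (simp add: \<psi>_def)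
    qed
    moreover have "\<forall>m\<in>K. \<psi> m = \<phi> m" using * by (simp add: \<psi>_def)
    ultimately show ?thesis by blast
  next
    case False
    then obtain y where y: "coprime y b" "y \<notin> K" by blast
    obtain k where k: "k > 0" "y ^ k \<in> K" "\<And>i. 0 < i \<Longrightarrow> i < k \<Longrightarrow> y ^ i \<notin> K"
      using least_power_in[OF less.prems y(1) \<open>b > 0\<close>] by metis
    obtain \<zeta> where "\<zeta> ^ k = \<phi> (y ^ k)"
      using exists_complex_root[of k] k by metis
    from partial_dchar_extend[OF less.prems y(1) \<open>b > 0\<close> k this]
    obtain K' \<phi>' where K': "partial_dchar b K' \<phi>'" "K \<subseteq> K'" "y \<in> K'" "\<forall>m\<in>K. \<phi>' m = \<phi> m"
      by auto
    have "y mod b \<in> K'"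
      using partial_dchar_cong(1)[OF K'(1,3)] by simp
    moreover have "y mod b \<notin> K"
      using partial_dchar_cong(1)[OF less.prems, of "y mod b" y] y(2) by auto
    ultimately have "card ({..<b} - K') < card ({..<b} - K)"
      using K'(2) \<open>b > 0\<close> by (intro psubset_card_mono) auto
    from less.hyps[OF this K'(1)] show ?thesis
      using K'(2,4) by (metis subsetD)
  qed
qed

text \<open>The trivial character on the class of 1 is extended to \<open>n\<close> with a primitive
  root of unity as value, of the same order \<open>k\<close> as \<open>n\<close> modulo
  \<open>b\<close>, and then to all units.\<close>

lemma dchar_separation:
  assumes "coprime n b" "\<not> [n = 1] (mod b)" "b > 0"
  obtains \<phi> where "\<phi> \<in> dchars b" "\<phi> n \<noteq> 1"
proof -
  define K where "K = {m. [m = 1] (mod b)}"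
  have K: "partial_dchar b K (\<lambda>_. 1)"
    unfolding partial_dchar_def K_def
    using cong_mult[of _ 1 b _ 1] cong_coprime_left[of _ 1 b]
    by (auto intro: cong_trans cong_sym)
  obtain k where k: "k > 0" "n ^ k \<in> K" "\<And>i. 0 < i \<Longrightarrow> i < k \<Longrightarrow> n ^ i \<notin> K"
    using least_power_in[OF K assms(1,3)] by metis
  have "k \<noteq> 1" using k(2) assms(2) by (auto simp: K_def)
  with k have k2: "k \<ge> 2" by linarith
  define \<zeta> where "\<zeta> = cis (2 * pi / real k)"
  have "\<zeta> ^ k = 1"
    using k(1) by (simp add: \<zeta>_def Complex.DeMoivre)
  have "\<zeta> \<noteq> 1"
  proof
    assume "\<zeta> = 1"
    then have "cos (2 * pi / real k) = 1"
      by (simp add: \<zeta>_def complex_eq_iff)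
    moreover have "cos (2 * pi / real k) < cos 0"
      using k2 by (intro cos_monotone_0_pi) (auto simp: field_simps)
    ultimately show False by simp
  qed
  from partial_dchar_extend[OF K assms(1,3) k \<open>\<zeta> ^ k = 1\<close>]
  obtain K' \<phi>' where K': "partial_dchar b K' \<phi>'" "n \<in> K'" "\<phi>' n = \<zeta>" by auto
  from partial_dchar_extend_full[OF K'(1) assms(3)] K'(2,3) \<open>\<zeta> \<noteq> 1\<close> that
  show ?thesis by metis
qed

section \<open>Orthogonality relations and character sums\<close>

lemma sum_dchars:
  assumes "b > 0"
  shows "(\<Sum>\<phi>\<in>dchars b. \<phi> n) = (if [n = 1] (mod b) then of_nat (card (dchars b)) else 0)"
proof (cases "[n = 1] (mod b)")
  case True
  then have "\<phi> n = 1" if "\<phi> \<in> dchars b" for \<phi>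
    using dchar_cong[OF that True] dchar_1[OF that] by simp
  then have "(\<Sum>\<phi>\<in>dchars b. \<phi> n) = (\<Sum>\<phi>\<in>dchars b. 1)"
    by (intro sum.cong) auto
  with True show ?thesis by simp
next
  case False
  show ?thesis
  proof (cases "coprime n b")
    case True
    obtain \<psi> where \<psi>: "\<psi> \<in> dchars b" "\<psi> n \<noteq> 1"
      using dchar_separation[OF True False assms] .
    \<comment> \<open>\<open>\<psi> * cnj \<psi>\<close> is 1 on units only, but
      \<open>\<phi>\<close> vanishes elsewhere. Hence multiplication by \<open>\<psi>\<close>
      permutes the characters, and the sum equals \<open>\<psi> n\<close> times itself.\<close>
    have canc: "\<phi> m * (\<psi> m * cnj (\<psi> m)) = \<phi> m" if "\<phi> \<in> dchars b" for \<phi> m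
      using dchar_times_cnj[OF \<psi>(1) assms, of m] dchar_eq_0_iff[OF that, of m]
      by (cases "coprime m b") auto
    have "(\<Sum>\<phi>\<in>dchars b. \<phi> n) = (\<Sum>\<phi>\<in>dchars b. \<psi> n * \<phi> n)"
    proof (rule sum.reindex_bij_witness[of _ "\<lambda>\<phi> m. \<psi> m * \<phi> m" "\<lambda>\<phi> m. cnj (\<psi> m) * \<phi> m"])
      fix \<phi> assume \<phi>: "\<phi> \<in> dchars b"
      have *: "\<psi> m * (cnj (\<psi> m) * \<phi> m) = \<phi> m" "cnj (\<psi> m) * (\<psi> m * \<phi> m) = \<phi> m" for m
        using canc[OF \<phi>, of m] by (simp_all only: mult_ac)
      show "(\<lambda>m. \<psi> m * (cnj (\<psi> m) * \<phi> m)) = \<phi>" "(\<lambda>m. cnj (\<psi> m) * (\<psi> m * \<phi> m)) = \<phi>"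
        "\<psi> n * (cnj (\<psi> n) * \<phi> n) = \<phi> n"
        by (simp_all only: *)
      show "(\<lambda>m. cnj (\<psi> m) * \<phi> m) \<in> dchars b" "(\<lambda>m. \<psi> m * \<phi> m) \<in> dchars b"
        using dchar_times_in[OF dchar_cnj_in[OF \<psi>(1)] \<phi>] dchar_times_in[OF \<psi>(1) \<phi>] .
    qed
    also have "\<dots> = \<psi> n * (\<Sum>\<phi>\<in>dchars b. \<phi> n)"
      by (simp add: sum_distrib_left)
    finally have "(1 - \<psi> n) * (\<Sum>\<phi>\<in>dchars b. \<phi> n) = 0"
      by (simp add: algebra_simps)
    with \<psi> False show ?thesis by simp
  next
    case False
    then have "(\<Sum>\<phi>\<in>dchars b. \<phi> n) = 0"
      by (intro sum.neutral) (simp add: dchar_eq_0_iff)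
    then show ?thesis
      using \<open>\<not> [n = 1] (mod b)\<close> by simp
  qed
qed

text \<open>On units the conjugate is the inverse, so \<open>cnj (\<phi> h)\<close> is the value at
  an inverse \<open>h'\<close> of \<open>h\<close>, and the previous relation applies to
  \<open>h' * n\<close>.\<close>

lemma sum_dchars_cnj:
  assumes "b > 0" "coprime h b"
  shows "(\<Sum>\<phi>\<in>dchars b. cnj (\<phi> h) * \<phi> n) =
    (if [n = h] (mod b) then of_nat (card (dchars b)) else 0)"
proof -
  obtain h' where "[h * h' = Suc 0] (mod b)"
    using cong_solve_coprime_nat[OF assms(2)] by blast
  then have h': "[h' * h = 1] (mod b)" by (simp add: mult.commute)
  have "cnj (\<phi> h) * \<phi> n = \<phi> (h' * n)" if "\<phi> \<in> dchars b" for \<phi>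
  proof -
    have "\<phi> h' * \<phi> h = 1"
      using dchar_cong[OF that h'] dchar_mult[OF that] dchar_1[OF that] by simp
    then have "\<phi> h' * (\<phi> h * cnj (\<phi> h)) = cnj (\<phi> h)"
      by (simp flip: mult.assoc)
    then have "\<phi> h' = cnj (\<phi> h)"
      using dchar_times_cnj[OF that assms] by simp
    then show ?thesis by (simp add: dchar_mult[OF that])
  qed
  moreover have "[h' * n = 1] (mod b) \<longleftrightarrow> [n = h] (mod b)"
  proof
    assume "[h' * n = 1] (mod b)"
    then have "[h * (h' * n) = h * 1] (mod b)" by (rule cong_scalar_left)
    moreover have "[(h' * h) * n = 1 * n] (mod b)" using h' by (rule cong_scalar_right)
    then have "[n = h * (h' * n)] (mod b)" by (simp add: mult_ac cong_sym_eq)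
    ultimately show "[n = h] (mod b)"
      using cong_trans by fastforce
  next
    assume "[n = h] (mod b)"
    then have "[h' * n = h' * h] (mod b)" by (rule cong_scalar_left)
    then show "[h' * n = 1] (mod b)" using h' by (rule cong_trans)
  qed
  ultimately show ?thesis
    using sum_dchars[OF assms(1), of "h' * n"] by simp
qed

text \<open>Multiplication by a unit \<open>y\<close> with \<open>\<phi> y \<noteq> 1\<close>
  permutes the residues and multiplies the sum by \<open>\<phi> y\<close>.\<close>

lemma sum_dchar_period:
  assumes "\<phi> \<in> dchars b" "\<phi> \<noteq> principal_dchar b" "b > 0"
  shows "(\<Sum>n\<in>{..<b}. \<phi> n) = 0"
proof -
  obtain y where y: "\<phi> y \<noteq> principal_dchar b y" using assms(2) by auto
  then have cop: "coprime y b" and "\<phi> y \<noteq> 1"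
    using dchar_eq_0_iff[OF assms(1), of y] by (auto simp: principal_dchar_def split: if_splits)
  have per: "\<phi> (m mod b) = \<phi> m" for m
    using dchar_cong[OF assms(1), of "m mod b" m] by simp
  have inj: "inj_on (\<lambda>n. y * n mod b) {..<b}"
  proof (rule inj_onI)
    fix m n assume *: "m \<in> {..<b}" "n \<in> {..<b}" "y * m mod b = y * n mod b"
    then have "[y * m = y * n] (mod b)" by (simp add: Cong.cong_def)
    then have "[m = n] (mod b)"
      using cong_mult_lcancel_nat[OF cop, of m n] by simp
    then show "m = n" using * by (simp add: Cong.cong_def)
  qed
  moreover have "(\<lambda>n. y * n mod b) ` {..<b} \<subseteq> {..<b}" using assms(3) by auto
  ultimately have "bij_betw (\<lambda>n. y * n mod b) {..<b} {..<b}"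
    using endo_inj_surj[OF finite_lessThan] by (metis bij_betw_def)
  from sum.reindex_bij_betw[OF this, of \<phi>]
  have "(\<Sum>n\<in>{..<b}. \<phi> n) = \<phi> y * (\<Sum>n\<in>{..<b}. \<phi> n)"
    by (simp add: per dchar_mult[OF assms(1)] sum_distrib_left)
  then have "(1 - \<phi> y) * (\<Sum>n\<in>{..<b}. \<phi> n) = 0" by (simp add: algebra_simps)
  with \<open>\<phi> y \<noteq> 1\<close> show ?thesis by simp
qed

text \<open>Complete periods cancel; what remains is fewer than \<open>b\<close> terms of modulus at
  most 1.\<close>

lemma norm_sum_dchar_le:
  assumes "\<phi> \<in> dchars b" "\<phi> \<noteq> principal_dchar b" "b > 0"
  shows "norm (\<Sum>n<N. \<phi> n) \<le> real b"
proof (induction N rule: less_induct)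
  case (less N)
  show ?case
  proof (cases "N < b")
    case True
    have "norm (\<Sum>n<N. \<phi> n) \<le> (\<Sum>n<N. 1)"
      by (intro sum_norm_le norm_dchar_le[OF assms(1,3)])
    with True show ?thesis by simp
  next
    case False
    have "(\<Sum>n<N. \<phi> n) = (\<Sum>n<b. \<phi> n) + (\<Sum>n\<in>{b..<N}. \<phi> n)"
      using False by (subst sum.union_disjoint[symmetric]) (auto intro!: sum.cong)
    also have "(\<Sum>n\<in>{b..<N}. \<phi> n) = (\<Sum>n<N - b. \<phi> n)"
      by (rule sum.reindex_bij_witness[of _ "\<lambda>n. n + b" "\<lambda>n. n - b"])
         (use False in \<open>auto intro!: dchar_cong[OF assms(1)] simp: Cong.cong_def le_mod_geq\<close>)
    finally show ?thesis
      using sum_dchar_period[OF assms] less.IH[of "N - b"] False assms(3) by simp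
  qed
qed

section \<open>Bounded partial sums and divisor sums\<close>

text \<open>Abel summation: the differences of decreasing weights telescope, so the first weight
  controls the sum. Monotonicity is asked only from \<open>m\<close> on because
  \<open>ln n * n powr - s\<close> rises at first.\<close>

lemma norm_sum_decreasing_le:
  fixes c :: "nat \<Rightarrow> 'a::real_normed_vector" and a :: "nat \<Rightarrow> real"
  assumes B: "\<And>N. norm (\<Sum>n<N. c n) \<le> B"
    and dec: "\<And>n. m \<le> n \<Longrightarrow> a (Suc n) \<le> a n" and pos: "\<And>n. m \<le> n \<Longrightarrow> 0 \<le> a n"
  shows "norm (\<Sum>n\<in>{m..<N}. a n *\<^sub>R c n) \<le> 2 * B * a m"
proof (cases "m \<le> N")
  case True
  define S where "S = (\<lambda>N. \<Sum>n<N. c n)"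
  have parts: "(\<Sum>n\<in>{m..<N}. a n *\<^sub>R c n) =
    a N *\<^sub>R S N - a m *\<^sub>R S m + (\<Sum>n\<in>{m..<N}. (a n - a (Suc n)) *\<^sub>R S (Suc n))"
    using True
  proof (induction N rule: dec_induct)
    case (step N)
    then show ?case by (simp add: S_def algebra_simps)
  qed simp
  have le: "norm (t *\<^sub>R S k) \<le> t * B" if "t \<ge> 0" for t k
    using mult_left_mono[OF B[of k] that] that by (simp add: S_def)
  have tele: "(\<Sum>n\<in>{m..<N}. (a n - a (Suc n)) * B) = (a m - a N) * B"
    unfolding sum_distrib_right[symmetric] using sum_Suc_diff'[of m N "\<lambda>n. - a n"] True by simp
  have "norm (\<Sum>n\<in>{m..<N}. a n *\<^sub>R c n) \<le> a N * B + a m * B + (\<Sum>n\<in>{m..<N}. (a n - a (Suc n)) * B)"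
    unfolding parts using True pos dec
    by (intro order.trans[OF norm_triangle_ineq] order.trans[OF norm_triangle_ineq4] add_mono
        order.trans[OF norm_sum] sum_mono le) auto
  also have "\<dots> = 2 * B * a m"
    unfolding tele by (simp add: algebra_simps)
  finally show ?thesis .
next
  case False
  have "0 \<le> B" using B[of 0] by simp
  with False pos[of m] show ?thesis by simp
qed

text \<open>Bounding a tail by its first weight yields the later estimates that are uniform in
  \<open>s\<close>. Weights decreasing to 0 are nonnegative from \<open>m\<close> on.\<close>

lemma
  fixes c :: "nat \<Rightarrow> 'a::banach" and a :: "nat \<Rightarrow> real"
  assumes B: "\<And>N. norm (\<Sum>n<N. c n) \<le> B"
    and dec: "\<And>n. m \<le> n \<Longrightarrow> a (Suc n) \<le> a n" and lim: "a \<longlonglongrightarrow> 0"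
  shows summable_decreasing_bounded: "summable (\<lambda>n. a n *\<^sub>R c n)"
    and norm_suminf_decreasing_le: "norm (\<Sum>n. a (n + m) *\<^sub>R c (n + m)) \<le> 2 * B * a m"
proof -
  have pos: "0 \<le> a n" if "m \<le> n" for n
  proof -
    have "a k \<le> a n" if "n \<le> k" for k
      using that by (induction k rule: dec_induct) (use dec \<open>m \<le> n\<close> in \<open>auto intro: order.trans\<close>)
    then show ?thesis
      using lim by (intro LIMSEQ_le_const2[OF lim]) auto
  qed
  have B0: "0 \<le> B" using B[of 0] by simp
  have le: "norm (\<Sum>n\<in>{k..<N}. a n *\<^sub>R c n) \<le> 2 * B * a k" if "m \<le> k" for k N
    using that by (intro norm_sum_decreasing_le B dec pos) auto
  show sm: "summable (\<lambda>n. a n *\<^sub>R c n)"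
    unfolding summable_Cauchy
  proof (intro allI impI)
    fix e :: real assume "e > 0"
    have "(\<lambda>n. 2 * B * a n) \<longlonglongrightarrow> 0" using tendsto_mult_left[OF lim, of "2 * B"] by simp
    then obtain M where M: "2 * B * a n < e" if "n \<ge> M" for n
      using order_tendstoD(2)[of _ 0 sequentially e] \<open>e > 0\<close> unfolding eventually_sequentially by blast
    show "\<exists>N. \<forall>k\<ge>N. \<forall>n. norm (\<Sum>i = k..<n. a i *\<^sub>R c i) < e"
      by (rule exI[of _ "max M m"]) (use le M in \<open>auto intro: le_less_trans\<close>)
  qed
  then have "(\<lambda>N. \<Sum>n<N. a (n + m) *\<^sub>R c (n + m)) \<longlonglongrightarrow> (\<Sum>n. a (n + m) *\<^sub>R c (n + m))"
    by (intro summable_LIMSEQ summable_ignore_initial_segment)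
  moreover have "norm (\<Sum>n<N. a (n + m) *\<^sub>R c (n + m)) \<le> 2 * B * a m" for N
    using le[of m "N + m"] sum.shift_bounds_nat_ivl[of "\<lambda>n. a n *\<^sub>R c n" 0 m N]
    by (simp add: atLeast0LessThan)
  ultimately show "norm (\<Sum>n. a (n + m) *\<^sub>R c (n + m)) \<le> 2 * B * a m"
    by (intro Lim_norm_ubound[OF sequentially_bot]) auto
qed

text \<open>Pairs \<open>(d, k)\<close> correspond to pairs \<open>(n, d)\<close> with
  \<open>d dvd n\<close> via \<open>n = d * k\<close>. The index 0 is left out because it has
  infinitely many divisors.\<close>

lemma has_sum_divisors_regroup:
  fixes h :: "nat \<times> nat \<Rightarrow> 'a :: {topological_comm_monoid_add,t3_space}"
  assumes "(h has_sum S) ({0<..} \<times> {0<..})"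
  shows "((\<lambda>n. \<Sum>d | d dvd n. h (d, n div d)) has_sum S) {0<..}"
proof -
  have "((\<lambda>(n, d). h (d, n div d)) has_sum S) (SIGMA n:{0<..}. {d. d dvd n}) \<longleftrightarrow>
      (h has_sum S) ({0<..} \<times> {0<..})"
    by (rule has_sum_reindex_bij_witness[of _ "\<lambda>(d, k). (d * k, d)" "\<lambda>(n, d). (d, n div d)"])
       (auto simp: div_greater_zero_iff dvd_imp_le dvd_pos_nat)
  then have "((\<lambda>(n, d). h (d, n div d)) has_sum S) (SIGMA n:{0<..}. {d. d dvd n})"
    using assms by simp
  then show ?thesis
    by (rule has_sum_SigmaD) (auto intro: has_sum_finite)
qed

lemma sums_divisor_convolution:
  fixes f g :: "nat \<Rightarrow> complex"
  assumes f: "summable (\<lambda>n. norm (f n))" "f 0 = 0" and g: "summable (\<lambda>n. norm (g n))" "g 0 = 0"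
  shows "(\<lambda>n. \<Sum>d | d dvd n. f d * g (n div d)) sums (suminf f * suminf g)"
proof -
  have hs: "(f has_sum suminf f) {0<..}" "(\<lambda>n. norm (f n)) summable_on {0<..}"
    if "summable (\<lambda>n. norm (f n))" "f 0 = 0" for f :: "nat \<Rightarrow> complex"
  proof -
    have "(f has_sum suminf f) UNIV"
      using norm_summable_imp_has_sum[OF that(1)] summable_sums[OF summable_norm_cancel[OF that(1)]] by blast
    also have "?this \<longleftrightarrow> (f has_sum suminf f) {0<..}"
      by (intro has_sum_cong_neutral) (use that in auto)
    finally show "(f has_sum suminf f) {0<..}" .
    show "(\<lambda>n. norm (f n)) summable_on {0<..}"
      using norm_summable_imp_summable_on[of "\<lambda>n. norm (f n)"] that
      by (auto intro: summable_on_subset_banach)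
  qed
  have "(\<lambda>x. norm ((\<lambda>(d,k). f d * g k) x)) summable_on ({0<..} \<times> {0<..})"
    unfolding Infinite_Sum.abs_summable_on_Sigma_iff
    using hs(2)[OF f] hs(2)[OF g]
    by (auto simp: norm_mult abs_mult infsum_cmult_right' intro: summable_on_cmult_right summable_on_cmult_left)
  then have "(\<lambda>(d,k). f d * g k) summable_on ({0<..} \<times> {0<..})"
    by (rule abs_summable_summable)
  then have "((\<lambda>(d,k). f d * g k) has_sum (suminf f * suminf g)) ({0<..} \<times> {0<..})"
    using has_sum_cmult_right[OF hs(1)[OF g]] has_sum_cmult_left[OF hs(1)[OF f]]
    by (intro has_sum_SigmaI) auto
  from has_sum_divisors_regroup[OF this]
  have "((\<lambda>n. \<Sum>d | d dvd n. f d * g (n div d)) has_sum (suminf f * suminf g)) {0<..}"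
    by simp
  \<comment> \<open>The term at 0 ranges over all naturals, and a sum over an infinite set is 0 by
    convention.\<close>
  also have "?this \<longleftrightarrow> ((\<lambda>n. \<Sum>d | d dvd n. f d * g (n div d)) has_sum (suminf f * suminf g)) UNIV"
    by (intro has_sum_cong_neutral) auto
  finally show ?thesis by (rule has_sum_imp_sums)
qed

lemma divisors_prime_power_mult:
  assumes "prime p" "\<not> p dvd m" "m > (0::nat)"
  shows "bij_betw (\<lambda>(i, d). p ^ i * d) ({..k} \<times> {d. d dvd m}) {d. d dvd p ^ k * m}"
proof (rule bij_betw_byWitness[where f' = "\<lambda>d. (multiplicity p d, d div p ^ multiplicity p d)"])
  have mult: "multiplicity p (p ^ i * d) = i" if "d dvd m" for i d
    using assms that dvd_trans[of p d m] prime_gt_0_nat[OF assms(1)]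
    by (intro multiplicity_eqI) (auto simp: mult.commute[of p])
  show "\<forall>a\<in>{..k} \<times> {d. d dvd m}. (multiplicity p (case a of (i, d) \<Rightarrow> p ^ i * d),
       (case a of (i, d) \<Rightarrow> p ^ i * d) div p ^ multiplicity p (case a of (i, d) \<Rightarrow> p ^ i * d)) = a"
    using mult prime_gt_0_nat[OF assms(1)] by auto
  show "\<forall>a'\<in>{d. d dvd p ^ k * m}. (case (multiplicity p a', a' div p ^ multiplicity p a') of (i, d) \<Rightarrow> p ^ i * d) = a'"
    by (simp add: multiplicity_dvd)
  show "(\<lambda>(i, d). p ^ i * d) ` ({..k} \<times> {d. d dvd m}) \<subseteq> {d. d dvd p ^ k * m}"
    by (auto intro!: mult_dvd_mono le_imp_power_dvd)
  show "(\<lambda>d. (multiplicity p d, d div p ^ multiplicity p d)) ` {d. d dvd p ^ k * m} \<subseteq> {..k} \<times> {d. d dvd m}"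
  proof (rule image_subsetI)
    fix d assume "d \<in> {d. d dvd p ^ k * m}"
    then have d: "d dvd p ^ k * m" by simp
    have nz: "p ^ k * m \<noteq> 0" using assms by auto
    then have d0: "d \<noteq> 0" using d by (metis dvd_0_left)
    have "multiplicity p d \<le> multiplicity p (p ^ k * m)"
      using d nz by (intro dvd_imp_multiplicity_le)
    then have "multiplicity p d \<in> {..k}" using mult[of m k] by simp
    have "\<not> p dvd d div p ^ multiplicity p d"
      using multiplicity_decompose[of d p] d0 prime_gt_1_nat[OF assms(1)] by auto
    then have "coprime (p ^ k) (d div p ^ multiplicity p d)"
      using assms(1) by (simp add: prime_imp_coprime)
    moreover have "d div p ^ multiplicity p d dvd p ^ k * m"
      using d by (metis dvd_div_mult_self dvd_mult_left dvd_trans multiplicity_dvd dvd_triv_left)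
    ultimately have "d div p ^ multiplicity p d dvd m"
      by (metis coprime_commute coprime_dvd_mult_right_iff)
    with \<open>multiplicity p d \<in> {..k}\<close>
    show "(multiplicity p d, d div p ^ multiplicity p d) \<in> {..k} \<times> {d. d dvd m}" by simp
  qed
qed

lemma sum_divisors_prime_power_mult:
  fixes g :: "nat \<Rightarrow> 'a::comm_semiring_1"
  assumes "prime p" "\<not> p dvd m" "m > 0" and g: "g 1 = 1" "\<And>m n. g (m * n) = g m * g n"
  shows "(\<Sum>d | d dvd p ^ k * m. g d) = (\<Sum>i\<le>k. g p ^ i) * (\<Sum>d | d dvd m. g d)"
proof -
  have pow: "g (p ^ i) = g p ^ i" for i using g by (induction i) auto
  have "(\<Sum>d | d dvd p ^ k * m. g d) = (\<Sum>(i, d)\<in>{..k} \<times> {d. d dvd m}. g (p ^ i * d))"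
    using sum.reindex_bij_betw[OF divisors_prime_power_mult[OF assms(1-3), of k], of g]
    by (simp add: case_prod_unfold)
  also have "\<dots> = (\<Sum>i\<le>k. \<Sum>d | d dvd m. g p ^ i * g d)"
    by (subst sum.cartesian_product) (simp add: g(2) pow)
  finally show ?thesis by (simp add: sum_product)
qed

lemma prime_power_split:
  assumes "n > (1::nat)"
  obtains p k m where "prime p" "\<not> p dvd m" "m > 0" "m < n" "n = p ^ k * m"
proof -
  obtain p where p: "prime p" "p dvd n" using assms prime_factor_nat[of n] by auto
  define k where "k = multiplicity p n"
  have n: "n = p ^ k * (n div p ^ k)" by (simp add: k_def multiplicity_dvd)
  have "k > 0" using p assms by (simp add: k_def prime_multiplicity_gt_zero_iff)
  have "\<not> p dvd n div p ^ k"
    unfolding k_def using multiplicity_decompose[of n p] assms prime_gt_1_nat[OF p(1)] by auto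
  moreover have "n div p ^ k > 0" using n assms by (metis gr0I mult_0_right not_less0)
  moreover have "n div p ^ k < n"
    using one_less_power[OF prime_gt_1_nat[OF p(1)] \<open>k > 0\<close>] assms by (intro div_less_dividend) auto
  ultimately show ?thesis using that p n by blast
qed

text \<open>The divisor sum is a product of factors \<open>1 + g p + ... + g p ^ k\<close>. Such a
  factor is \<open>k + 1\<close>, 1, or (for \<open>g p = -1\<close>) 0 or 1 according to the parity
  of \<open>k\<close>; in a square all exponents are even.\<close>

lemma
  fixes g :: "nat \<Rightarrow> real"
  assumes g: "g 1 = 1" "\<And>m n. g (m * n) = g m * g n" and val: "\<And>n. g n \<in> {-1, 0, 1}"
  shows sum_divisors_nonneg: "n > 0 \<Longrightarrow> 0 \<le> (\<Sum>d | d dvd n. g d)"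
    and sum_divisors_square_ge_1: "n > 0 \<Longrightarrow> 1 \<le> (\<Sum>d | d dvd n ^ 2. g d)"
proof -
  have geo: "0 \<le> (\<Sum>i\<le>k. x ^ i)" "even k \<longrightarrow> 1 \<le> (\<Sum>i\<le>k. x ^ i)" if "x \<in> {-1, 0, 1}" for x :: real and k
  proof -
    have "x = 1 \<or> x = 0 \<or> x = -1" using that by auto
    moreover have "(\<Sum>i\<le>k. (-1::real) ^ i) = (if even k then 1 else 0)"
      by (induction k) auto
    moreover have "(\<Sum>i\<le>k. (0::real) ^ i) = 1" by (induction k) auto
    ultimately show "0 \<le> (\<Sum>i\<le>k. x ^ i)" "even k \<longrightarrow> 1 \<le> (\<Sum>i\<le>k. x ^ i)" by auto
  qed
  show "0 \<le> (\<Sum>d | d dvd n. g d)" if "n > 0" using that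
  proof (induction n rule: less_induct)
    case (less n)
    show ?case
    proof (cases "n = 1")
      case False
      with less.prems obtain p k m where "prime p" "\<not> p dvd m" "m > 0" "m < n" "n = p ^ k * m"
        using prime_power_split[of n] by (metis One_nat_def nat_neq_iff less_one)
      then show ?thesis
        using sum_divisors_prime_power_mult[of p m g k] g geo(1)[OF val] less.IH by simp
    qed (use g in simp)
  qed
  show "1 \<le> (\<Sum>d | d dvd n ^ 2. g d)" if "n > 0" using that
  proof (induction n rule: less_induct)
    case (less n)
    show ?case
    proof (cases "n = 1")
      case False
      with less.prems obtain p k m where *: "prime p" "\<not> p dvd m" "m > 0" "m < n" "n = p ^ k * m"
        using prime_power_split[of n] by (metis One_nat_def nat_neq_iff less_one)
      then have "n ^ 2 = p ^ (2 * k) * m ^ 2" "\<not> p dvd m ^ 2"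
        by (auto simp: power_mult_distrib power_mult power2_eq_square prime_dvd_mult_iff power_add mult_2)
      moreover have "1 * 1 \<le> (\<Sum>i\<le>2 * k. g p ^ i) * (\<Sum>d | d dvd m ^ 2. g d)"
        using geo(2)[OF val, of "2 * k" p] less.IH[OF *(4,3)] by (intro mult_mono) auto
      ultimately show ?thesis
        using sum_divisors_prime_power_mult[of p "m ^ 2" g "2 * k"] g * by simp
    qed (use g in simp)
  qed
qed

section \<open>Real characters\<close>

text \<open>AM-GM for the terms with exponents \<open>i\<close> and \<open>n - 1 - i\<close>, whose
  geometric mean is always \<open>y ^ (n - 1)\<close>.\<close>

lemma geometric_ge_middle:
  fixes y :: real assumes "0 \<le> y"
  shows "real n * y ^ (n - 1) \<le> (\<Sum>i<n. (y ^ 2) ^ i)"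
proof -
  have "2 * y ^ (n - 1) \<le> (y ^ 2) ^ i + (y ^ 2) ^ (n - Suc i)" if "i < n" for i
  proof -
    have "y ^ (n - 1) = y ^ i * y ^ (n - Suc i)" using that by (simp flip: power_add)
    then show ?thesis
      using sum_squares_bound[of "y ^ i" "y ^ (n - Suc i)"]
      by (simp add: power_mult[symmetric] mult_ac)
  qed
  then have "(\<Sum>i<n. 2 * y ^ (n - 1)) \<le> (\<Sum>i<n. (y ^ 2) ^ i + (y ^ 2) ^ (n - Suc i))"
    by (intro sum_mono) auto
  also have "\<dots> = 2 * (\<Sum>i<n. (y ^ 2) ^ i)"
    using sum.nat_diff_reindex[of "\<lambda>i. (y ^ 2) ^ i" n] by (simp add: sum.distrib)
  finally show ?thesis by simp
qed

text \<open>With \<open>1 - x ^ n = (1 - x) * G n\<close> the claim becomes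
  \<open>n * (n + 1) * x ^ n \<le> G n * G (n + 1)\<close>, a product of two AM-GM bounds. Passing
  to \<open>y = sqrt x\<close> keeps the middle exponents integral.\<close>

lemma lambert_coeff_decreasing:
  fixes x :: real and a :: "nat \<Rightarrow> real"
  assumes x: "0 < x" "x < 1" and "n > 0"
    and a: "\<And>n. a n = 1 / (real n * (1 - x)) - x ^ n / (1 - x ^ n)"
  shows "a (Suc n) \<le> a n"
proof -
  define y where "y = sqrt x"
  have y: "0 < y" "y < 1" "x = y ^ 2" using x by (auto simp: y_def)
  define G where "G = (\<lambda>n. \<Sum>i<n. x ^ i)"
  have G: "1 - x ^ n = (1 - x) * G n" for n
    using x by (simp add: G_def sum_gp_strict)
  have Gpos: "G n > 0" if "n > 0" for n
  proof -
    have "0 < (1 - x) * G n"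
      using power_strict_decreasing[of 0 n x] x that by (simp flip: G)
    then show ?thesis using x by (simp add: zero_less_mult_iff)
  qed
  have GSuc: "G (Suc n) = 1 + x * G n"
  proof -
    have "G (Suc n) = G n + x ^ n" by (simp add: G_def)
    with G[of n] show ?thesis by (simp add: algebra_simps)
  qed
  have "real n * y ^ n \<le> real n * y ^ (n - 1)"
    using y by (intro mult_left_mono power_decreasing) auto
  also have "\<dots> \<le> G n" using geometric_ge_middle[of y n] y by (simp add: G_def)
  finally have "(real n * y ^ n) * (real (Suc n) * y ^ n) \<le> G n * G (Suc n)"
    using geometric_ge_middle[of y "Suc n"] y Gpos[OF \<open>n > 0\<close>]
    by (intro mult_mono) (auto simp: G_def)
  then have "real n * real (Suc n) * x ^ n \<le> G n * G (Suc n)"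
    using y by (simp add: power_mult[symmetric] mult_ac power2_eq_square power_mult_distrib)
  moreover have "c / P \<le> 1 / Q" if "Q * c \<le> P" "P > 0" "Q > 0" for c P Q :: real
    using that by (simp add: field_simps)
  ultimately have main: "x ^ n / (G n * G (Suc n)) \<le> 1 / (real n * real (Suc n))"
    using Gpos[of n] Gpos[of "Suc n"] \<open>n > 0\<close> by (simp del: of_nat_Suc)
  have "x ^ n / G n - x ^ Suc n / G (Suc n) = x ^ n / (G n * G (Suc n))"
    using Gpos[of n] Gpos[of "Suc n"] \<open>n > 0\<close> by (simp add: field_simps GSuc)
  moreover have "1 / real n - 1 / real (Suc n) = 1 / (real n * real (Suc n))"
    using \<open>n > 0\<close> by (simp add: field_simps)
  ultimately have "1 / real (Suc n) - x ^ Suc n / G (Suc n) \<le> 1 / real n - x ^ n / G n"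
    using main by linarith
  then have "(1 / real (Suc n) - x ^ Suc n / G (Suc n)) / (1 - x) \<le> (1 / real n - x ^ n / G n) / (1 - x)"
    using x by (intro divide_right_mono) auto
  then show ?thesis
    unfolding a G by (simp add: diff_divide_distrib mult.commute)
qed

text \<open>Both series sum \<open>g d * x ^ (d * k)\<close> over pairs, once by \<open>d\<close>
  and once by \<open>n = d * k\<close>. Absolute convergence comes from the majorant
  \<open>x ^ d / (1 - x)\<close> for the inner sums.\<close>

lemma lambert_has_sum:
  fixes g :: "nat \<Rightarrow> real" and x :: real
  assumes x: "0 < x" "x < 1" and bnd: "\<And>n. \<bar>g n\<bar> \<le> 1"
  obtains S where "((\<lambda>d. g d * (x ^ d / (1 - x ^ d))) has_sum S) {0<..}"
    and "((\<lambda>n. x ^ n * (\<Sum>d | d dvd n. g d)) has_sum S) {0<..}"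
proof -
  have geo: "((\<lambda>k. z ^ k) has_sum (z / (1 - z))) {0<..}" if "0 < z" "z < 1" for z :: real
  proof -
    have "(\<lambda>k. z ^ Suc k) sums (z * (1 / (1 - z)))"
      unfolding power_Suc using that by (intro sums_mult geometric_sums) auto
    then have "((\<lambda>k. z ^ Suc k) has_sum (z / (1 - z))) UNIV"
      using that by (intro sums_nonneg_imp_has_sum) auto
    also have "?this \<longleftrightarrow> ?thesis"
      by (rule has_sum_reindex_bij_witness[of _ "\<lambda>k. k - 1" Suc]) auto
    finally show ?thesis .
  qed
  have xd: "0 < x ^ d" "x ^ d < 1" if "d > 0" for d
    using x that by (auto simp: power_less_one_iff)
  have inner: "((\<lambda>k. c * x ^ (d * k)) has_sum (c * (x ^ d / (1 - x ^ d)))) {0<..}" if "d > 0" for d c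
    using has_sum_cmult_right[OF geo[OF xd[OF that]], of c] by (simp add: power_mult)
  have "(\<lambda>p. norm ((\<lambda>(d, k). g d * x ^ (d * k)) p)) summable_on ({0<..} \<times> {0<..})"
    unfolding Infinite_Sum.abs_summable_on_Sigma_iff
  proof (intro conjI ballI)
    fix d :: nat assume "d \<in> {0<..}"
    then show "(\<lambda>k. norm ((\<lambda>(d, k). g d * x ^ (d * k)) (d, k))) summable_on {0<..}"
      using has_sum_imp_summable[OF inner[of d "\<bar>g d\<bar>"]] x by (simp add: abs_mult)
  next
    have "(\<lambda>d. x ^ d / (1 - x)) summable_on {0<..}"
      using has_sum_imp_summable[OF has_sum_cmult_left[OF geo[OF x], of "1 / (1 - x)"]] by simp
    moreover have le: "norm (\<Sum>\<^sub>\<infinity>k\<in>{0<..}. norm (g d * x ^ (d * k))) \<le> x ^ d / (1 - x)" if d: "d \<in> {0<..}" for d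
    proof -
      have that: "d > 0" using d by simp
      have "(\<Sum>\<^sub>\<infinity>k\<in>{0<..}. norm (g d * x ^ (d * k))) = \<bar>g d\<bar> * (x ^ d / (1 - x ^ d))"
        using infsumI[OF inner[OF that, of "\<bar>g d\<bar>"]] x by (simp add: abs_mult)
      moreover have "x ^ d \<le> x" using that x power_decreasing[of 1 d x] by simp
      then have "x ^ d / (1 - x ^ d) \<le> x ^ d / (1 - x)"
        using x xd[OF that] by (intro divide_left_mono) auto
      ultimately show ?thesis
        using bnd[of d] xd[OF that] x mult_mono[of "\<bar>g d\<bar>" 1 "x ^ d / (1 - x ^ d)" "x ^ d / (1 - x)"]
        by (simp add: abs_mult)
    qed
    ultimately show "(\<lambda>d. norm (\<Sum>\<^sub>\<infinity>k\<in>{0<..}. norm ((\<lambda>(d, k). g d * x ^ (d * k)) (d, k)))) summable_on {0<..}"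
      unfolding case_prod_conv by (rule summable_on_comparison_test) simp_all
  qed
  then have "(\<lambda>(d, k). g d * x ^ (d * k)) summable_on ({0<..} \<times> {0<..})"
    by (rule abs_summable_summable)
  then obtain S where S: "((\<lambda>(d, k). g d * x ^ (d * k)) has_sum S) ({0<..} \<times> {0<..})"
    by (auto simp: summable_on_def)
  have "((\<lambda>d. g d * (x ^ d / (1 - x ^ d))) has_sum S) {0<..}"
    by (rule has_sum_SigmaD[OF S]) (use inner in auto)
  moreover have "((\<lambda>n. x ^ n * (\<Sum>d | d dvd n. g d)) has_sum S) {0<..}"
    using has_sum_divisors_regroup[OF S]
    by (rule has_sum_cong[THEN iffD1, rotated]) (auto simp: sum_distrib_left intro!: sum.cong)
  ultimately show ?thesis by (rule that)
qed

text \<open>Monsky's argument: if the series vanished, then subtracting it (divided by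
  \<open>1 - x\<close>) from the Lambert series of \<open>g\<close> would bound the latter as \<open>x \<longrightarrow> 1\<close>, although its
  coefficients at squares are at least \<open>1\<close>.\<close>

lemma real_character_series_nonzero:
  fixes g :: "nat \<Rightarrow> real"
  assumes g: "g 1 = 1" "\<And>m n. g (m * n) = g m * g n" and val: "\<And>n. g n \<in> {-1, 0, 1}"
    and B: "\<And>N. \<bar>\<Sum>n<N. g n\<bar> \<le> B"
  shows "\<not> (\<lambda>n. g n / real n) sums 0"
proof
  assume zero: "(\<lambda>n. g n / real n) sums 0"
  have bnd: "\<bar>g n\<bar> \<le> 1" for n using val[of n] by auto
  have B0: "0 \<le> B" using B[of 0] by simp
  \<comment> \<open>The Lambert sum \<open>S\<close> is squeezed: each of the \<open>K\<close>
    squares up to \<open>K ^ 2\<close> contributes at least \<open>x ^ (K ^ 2)\<close> and no term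
    is negative, while Abel summation bounds \<open>S\<close> independently of
    \<open>x\<close>.\<close>
  have upper: "real K * x ^ (K ^ 2) \<le> 2 * B" if x: "0 < x" "x < 1" for K x
  proof -
    obtain S where S: "((\<lambda>d. g d * (x ^ d / (1 - x ^ d))) has_sum S) {0<..}"
      "((\<lambda>n. x ^ n * (\<Sum>d | d dvd n. g d)) has_sum S) {0<..}"
      using lambert_has_sum[where g = g, OF x bnd] by blast
    have "real K * x ^ (K ^ 2) = (\<Sum>m\<in>{1..K}. x ^ (K ^ 2))" by simp
    also have "\<dots> \<le> (\<Sum>m\<in>{1..K}. x ^ (m ^ 2) * (\<Sum>d | d dvd m ^ 2. g d))"
    proof (rule sum_mono)
      fix m assume m: "m \<in> {1..K}"
      have "x ^ (K ^ 2) * 1 \<le> x ^ (m ^ 2) * (\<Sum>d | d dvd m ^ 2. g d)"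
        using m x sum_divisors_square_ge_1[OF g val, of m]
        by (intro mult_mono power_decreasing power_mono) auto
      then show "x ^ (K ^ 2) \<le> x ^ (m ^ 2) * (\<Sum>d | d dvd m ^ 2. g d)" by simp
    qed
    also have "\<dots> = (\<Sum>n\<in>(\<lambda>m. m ^ 2) ` {1..K}. x ^ n * (\<Sum>d | d dvd n. g d))"
      by (subst sum.reindex) (auto simp: inj_on_def)
    also have "\<dots> \<le> S"
      by (rule finite_sum_le_has_sum[OF S(2)]) (use sum_divisors_nonneg[OF g val] x in auto)
    also have "S \<le> 2 * B"
    proof -
      define a where "a = (\<lambda>n. 1 / (real n * (1 - x)) - x ^ n / (1 - x ^ n))"
      have lim: "a \<longlonglongrightarrow> 0"
      proof -
        have "(\<lambda>n. 1 / (1 - x) * (1 / real n)) \<longlonglongrightarrow> 1 / (1 - x) * 0"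
          by (intro tendsto_intros lim_1_over_n)
        moreover have "(\<lambda>n. x ^ n / (1 - x ^ n)) \<longlonglongrightarrow> 0 / (1 - 0)"
          using x by (intro tendsto_intros LIMSEQ_realpow_zero) auto
        ultimately show ?thesis
          using tendsto_diff[of _ _ sequentially] unfolding a_def by (force simp: mult.commute)
      qed
      have dec: "a (Suc n) \<le> a n" if "1 \<le> n" for n
        using that by (intro lambert_coeff_decreasing[OF x]) (auto simp: a_def)
      have "((\<lambda>n. g (Suc n) * (x ^ Suc n / (1 - x ^ Suc n))) has_sum S) UNIV
            \<longleftrightarrow> ((\<lambda>d. g d * (x ^ d / (1 - x ^ d))) has_sum S) {0<..}"
        by (rule has_sum_reindex_bij_witness[of _ "\<lambda>k. k - 1" Suc]) auto
      with S(1) have "(\<lambda>n. g (Suc n) * (x ^ Suc n / (1 - x ^ Suc n))) sums S"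
        by (auto intro: has_sum_imp_sums)
      moreover have "(\<lambda>n. 1 / (1 - x) * (g (Suc n) / real (Suc n))) sums (1 / (1 - x) * 0)"
        using zero sums_Suc_iff[of "\<lambda>n. g n / real n" 0] by (intro sums_mult) simp
      ultimately have "(\<lambda>n. 1 / (1 - x) * (g (Suc n) / real (Suc n)) -
          g (Suc n) * (x ^ Suc n / (1 - x ^ Suc n))) sums (1 / (1 - x) * 0 - S)"
        by (rule sums_diff[rotated])
      moreover have eq: "1 / (1 - x) * (g n / real n) - g n * (x ^ n / (1 - x ^ n)) = a n *\<^sub>R g n" for n
        by (simp add: a_def algebra_simps)
      ultimately have "(\<lambda>n. a (n + 1) *\<^sub>R g (n + 1)) sums (- S)"
        unfolding eq by simp
      then have "- S = (\<Sum>n. a (n + 1) *\<^sub>R g (n + 1))" by (rule sums_unique)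
      also have "norm \<dots> \<le> 2 * B * a 1"
        using B dec lim by (intro norm_suminf_decreasing_le) auto
      \<comment> \<open>Here \<open>1 / (1 - x) - x / (1 - x) = 1\<close>: the two poles at
        \<open>x = 1\<close> cancel, which makes the bound uniform in \<open>x\<close>.\<close>
      also have "a 1 = 1" using x by (simp add: a_def field_simps)
      finally show ?thesis by simp
    qed
    finally show ?thesis .
  qed
  \<comment> \<open>\<open>K > 4 * B\<close> makes \<open>K / 2\<close> exceed \<open>2 * B\<close>.
    For \<open>x = 1 - 1 / (2 * K ^ 2)\<close>, Bernoulli's inequality keeps
    \<open>x ^ (K ^ 2)\<close> at 1/2 or above.\<close>
  define K where "K = nat \<lceil>4 * B\<rceil> + 1"
  have K: "real K > 4 * B" unfolding K_def by linarith
  have K1: "K \<ge> 1" by (simp add: K_def)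
  define Q where "Q = real (K ^ 2)"
  have Q: "Q \<ge> 1" using K1 by (simp add: Q_def)
  define x where "x = 1 + (- 1 / (2 * Q))"
  have x: "0 < x" "x < 1" using Q by (auto simp: x_def field_simps)
  have "1 + real (K ^ 2) * (- 1 / (2 * Q)) \<le> x ^ (K ^ 2)"
    unfolding x_def using x by (intro Bernoulli_inequality) (simp add: x_def)
  then have "1 / 2 \<le> x ^ (K ^ 2)" using Q unfolding Q_def[symmetric] by simp
  then have "real K * (1 / 2) \<le> real K * x ^ (K ^ 2)" by (intro mult_left_mono) auto
  with upper[OF x, of K] K show False by linarith
qed

lemma real_dchar_series_nonzero:
  assumes \<phi>: "\<phi> \<in> dchars b" "\<phi> \<noteq> principal_dchar b" "b > 0" and real: "\<And>n. \<phi> n \<in> \<real>"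
  shows "\<not> (\<lambda>n. \<phi> n / of_nat n) sums 0"
proof
  assume zero: "(\<lambda>n. \<phi> n / of_nat n) sums 0"
  define g where "g = (\<lambda>n. Re (\<phi> n))"
  have \<phi>g: "\<phi> n = of_real (g n)" for n using real[of n] by (auto simp: g_def elim: Reals_cases)
  have "g n \<in> {-1, 0, 1}" for n
  proof -
    have "\<bar>g n\<bar> = (if coprime n b then 1 else 0)"
      using norm_dchar[OF \<phi>(1,3), of n] by (simp only: \<phi>g norm_of_real)
    then show ?thesis by (auto split: if_splits)
  qed
  moreover have "g 1 = 1" using dchar_1[OF \<phi>(1)] by (simp add: g_def)
  moreover have "g (m * n) = g m * g n" for m n
    using arg_cong[OF dchar_mult[OF \<phi>(1), of m n], of Re] by (simp add: \<phi>g)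
  moreover have "\<bar>\<Sum>n<N. g n\<bar> \<le> real b" for N
    using norm_sum_dchar_le[OF \<phi>, of N] unfolding \<phi>g of_real_sum[symmetric] norm_of_real .
  ultimately have "\<not> (\<lambda>n. g n / real n) sums 0" by (intro real_character_series_nonzero[of g "real b"])
  moreover have "(\<lambda>n. g n / real n) sums 0"
    using sums_Re[OF zero] by (simp add: g_def Re_divide_of_nat)
  ultimately show False by blast
qed

section \<open>Dirichlet series of characters\<close>

text \<open>The term at \<open>n = 0\<close> vanishes, because
  \<open>0 powr - s = 0\<close>.\<close>

definition dser :: "(nat \<Rightarrow> real) \<Rightarrow> (nat \<Rightarrow> complex) \<Rightarrow> real \<Rightarrow> complex"
  where "dser a \<phi> s = (\<Sum>n. (a n * real n powr - s) *\<^sub>R \<phi> n)"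

text \<open>\<open>D_ser\<close> and \<open>F_ser\<close> are minus the derivative and minus the logarithmic derivative of \<open>L_ser\<close>.\<close>

abbreviation "L_ser \<equiv> dser (\<lambda>_. 1)"
abbreviation "D_ser \<equiv> dser (\<lambda>n. ln (real n))"
abbreviation "F_ser \<equiv> dser mangoldt"

lemma ln_nat_nonneg: "0 \<le> ln (real n)"
  by (cases "n = 0") auto

text \<open>The weight \<open>1 + ln n\<close> dominates the coefficients of all three series, so
  one majorant serves them all.\<close>

lemma summable_ln_powr:
  assumes "s > (1::real)"
  shows "summable (\<lambda>n. (1 + ln (real n)) * real n powr - s)"
proof -
  \<comment> \<open>Half of the excess \<open>s - 1\<close> absorbs the logarithm; the other half
    keeps the exponent below -1.\<close>
  define e where "e = (s - 1) / 2"
  have e: "e > 0" "e - s < -1" using assms by (auto simp: e_def field_simps)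
  have bound: "(1 + ln (real n)) * real n powr - s \<le> (1 + 1 / e) * real n powr (e - s)" for n
  proof (cases "n = 0")
    case False
    then have n: "1 \<le> real n" by simp
    have "1 \<le> real n powr e" using n e by (simp add: ge_one_powr_ge_zero)
    then have "1 + ln (real n) \<le> (1 + 1 / e) * real n powr e"
      using ln_powr_bound[OF n e(1)] by (simp add: algebra_simps)
    then have "(1 + ln (real n)) * real n powr - s \<le> (1 + 1 / e) * real n powr e * real n powr - s"
      by (intro mult_right_mono) auto
    then show ?thesis by (simp add: mult.assoc powr_diff powr_minus_divide)
  qed simp
  have "summable (\<lambda>n. (1 + 1 / e) * real n powr (e - s))"
    using e by (intro summable_mult) (simp add: summable_real_powr_iff)
  then show ?thesis
    by (rule summable_comparison_test'[of _ 0]) (use bound in \<open>auto simp: ln_nat_nonneg\<close>)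
qed

lemma norm_dser_term_le:
  assumes "\<And>n. norm (\<phi> n :: complex) \<le> 1" "\<And>n. \<bar>a n\<bar> \<le> 1 + ln (real n)" "t \<le> s"
  shows "norm ((a n * real n powr - s) *\<^sub>R \<phi> n) \<le> (1 + ln (real n)) * real n powr - t"
proof (cases "n = 0")
  case False
  have "norm ((a n * real n powr - s) *\<^sub>R \<phi> n) = \<bar>a n\<bar> * real n powr - s * norm (\<phi> n)"
    by (simp add: abs_mult)
  also have "\<dots> \<le> (1 + ln (real n)) * real n powr - t * 1"
    using assms False by (intro mult_mono powr_mono) (auto simp: ln_nat_nonneg)
  finally show ?thesis by simp
qed simp

lemma summable_dser:
  assumes "\<And>n. norm (\<phi> n :: complex) \<le> 1" "\<And>n. \<bar>a n\<bar> \<le> 1 + ln (real n)" "s > 1"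
  shows "summable (\<lambda>n. norm ((a n * real n powr - s) *\<^sub>R \<phi> n))"
  using norm_dser_term_le[OF assms(1,2) order.refl]
  by (intro summable_comparison_test'[OF summable_ln_powr[OF assms(3)], of 0]) auto

lemma dser_coeff_bounds:
  "\<bar>1::real\<bar> \<le> 1 + ln (real n)" "\<bar>ln (real n)\<bar> \<le> 1 + ln (real n)" "\<bar>mangoldt n :: real\<bar> \<le> 1 + ln (real n)"
  using ln_nat_nonneg[of n] mangoldt_le[of n] by (cases "n = 0"; simp)+

text \<open>The divisor sum of \<open>mangoldt\<close> is \<open>ln\<close>, and the completely
  multiplicative factor \<open>\<phi> n * n powr - s\<close> comes out of the convolution.\<close>

lemma L_ser_mult_F_ser:
  assumes norm: "\<And>n. norm (\<phi> n :: complex) \<le> 1" and mult: "\<And>m n. \<phi> (m * n) = \<phi> m * \<phi> n" and "s > 1"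
  shows "L_ser \<phi> s * F_ser \<phi> s = D_ser \<phi> s"
proof -
  let ?f = "\<lambda>n. (mangoldt n * real n powr - s) *\<^sub>R \<phi> n" and ?g = "\<lambda>n. (1 * real n powr - s) *\<^sub>R \<phi> n"
  have "(\<lambda>n. \<Sum>d | d dvd n. ?f d * ?g (n div d)) sums (suminf ?f * suminf ?g)"
    using summable_dser[OF norm dser_coeff_bounds(3) \<open>s > 1\<close>] summable_dser[OF norm dser_coeff_bounds(1) \<open>s > 1\<close>]
    by (intro sums_divisor_convolution) auto
  moreover have "(\<Sum>d | d dvd n. ?f d * ?g (n div d)) = (ln (real n) * real n powr - s) *\<^sub>R \<phi> n" for n
  proof (cases "n = 0")
    case False
    have "(\<Sum>d | d dvd n. ?f d * ?g (n div d)) = (\<Sum>d | d dvd n. mangoldt d *\<^sub>R ((real n powr - s) *\<^sub>R \<phi> n))"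
    proof (rule sum.cong)
      fix d assume "d \<in> {d. d dvd n}"
      then have n: "n = d * (n div d)" by simp
      have "real n powr - s = real d powr - s * real (n div d) powr - s"
        by (subst n) (simp only: of_nat_mult powr_mult)
      moreover have "\<phi> n = \<phi> d * \<phi> (n div d)" by (subst n) (rule mult)
      ultimately show "?f d * ?g (n div d) = mangoldt d *\<^sub>R ((real n powr - s) *\<^sub>R \<phi> n)"
        by (simp add: scaleR_conv_of_real mult_ac)
    qed simp
    also have "\<dots> = (\<Sum>d | d dvd n. mangoldt d :: real) *\<^sub>R ((real n powr - s) *\<^sub>R \<phi> n)"
      by (rule scaleR_left.sum[symmetric])
    finally show ?thesis using mangoldt_sum[of n, where ?'a = real] False by simp
  qed simp
  ultimately show ?thesis
    by (simp add: dser_def sums_iff mult.commute)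
qed

lemma L_ser_has_vector_derivative:
  assumes norm: "\<And>n. norm (\<phi> n :: complex) \<le> 1" and "s > 1"
  shows "(L_ser \<phi> has_vector_derivative - D_ser \<phi> s) (at s)"
proof -
  \<comment> \<open>The Weierstrass majorant requires one exponent above 1 for a whole neighbourhood
    of \<open>s\<close>.\<close>
  define t where "t = (1 + s) / 2"
  have t: "1 < t" "t < s" using assms by (auto simp: t_def)
  define f where "f = (\<lambda>n x. (1 * real n powr - x) *\<^sub>R \<phi> n)"
  define f' where "f' = (\<lambda>n x. (ln (real n) * real n powr - x) *\<^sub>R \<phi> n)"
  have sm: "summable (\<lambda>n. f n x)" "summable (\<lambda>n. f' n x)" if "x > 1" for x
    using summable_dser[OF norm dser_coeff_bounds(1) that] summable_dser[OF norm dser_coeff_bounds(2) that]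
    by (auto simp: f_def f'_def intro: summable_norm_cancel)
  have ul: "uniform_limit {t<..} (\<lambda>n x. \<Sum>i<n. f' i x) (\<lambda>x. \<Sum>i. f' i x) sequentially"
    unfolding f'_def
    by (rule Weierstrass_m_test[OF norm_dser_term_le[OF norm dser_coeff_bounds(2)] summable_ln_powr[OF t(1)]]) auto
  have "\<exists>g. \<forall>x\<in>{t<..}. (\<lambda>n. f n x) sums g x \<and>
      (g has_derivative (\<lambda>h. h *\<^sub>R - (\<Sum>n. f' n x))) (at x within {t<..})"
  proof (rule has_derivative_series[where f' = "\<lambda>n x h. h *\<^sub>R - f' n x" and x = s and l = "\<Sum>n. f n s"])
    show "(f n has_derivative (\<lambda>h. h *\<^sub>R - f' n x)) (at x within {t<..})" if "x \<in> {t<..}" for n x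
    proof (cases "n = 0")
      case False
      have "((\<lambda>x. real n powr - x) has_real_derivative - (ln (real n) * real n powr - x)) (at x within {t<..})"
        using False by (auto intro!: derivative_eq_intros simp: powr_def)
      from has_vector_derivative_scaleR[OF this has_vector_derivative_const[of "\<phi> n"]]
      show ?thesis
        unfolding has_vector_derivative_def[symmetric] by (simp add: f_def f'_def)
    qed (simp add: f_def f'_def)
    show "\<forall>\<^sub>F n in sequentially. \<forall>x\<in>{t<..}. \<forall>h. norm ((\<Sum>i<n. h *\<^sub>R - f' i x) - h *\<^sub>R - (\<Sum>n. f' n x)) \<le> e * norm h"
      if "e > 0" for e
      using uniform_limitD[OF ul that]
    proof eventually_elim
      case (elim n)
      show ?case
      proof (intro ballI allI)
        fix x h assume "x \<in> {t<..}"
        then have *: "norm ((\<Sum>i<n. f' i x) - (\<Sum>i. f' i x)) \<le> e"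
          using elim by (auto simp: dist_norm intro: less_imp_le)
        have "(\<Sum>i<n. h *\<^sub>R - f' i x) - h *\<^sub>R - (\<Sum>n. f' n x) = - (h *\<^sub>R ((\<Sum>i<n. f' i x) - (\<Sum>i. f' i x)))"
          by (simp add: scaleR_sum_right sum_negf scaleR_diff_right)
        then show "norm ((\<Sum>i<n. h *\<^sub>R - f' i x) - h *\<^sub>R - (\<Sum>n. f' n x)) \<le> e * norm h"
          using mult_right_mono[OF *, of "\<bar>h\<bar>"] by (simp add: mult.commute)
      qed
    qed
    show "(\<lambda>n. f n s) sums (\<Sum>n. f n s)" using sm(1)[OF assms(2)] by (rule summable_sums)
  qed (use t in auto)
  then obtain g where g: "\<And>x. x > t \<Longrightarrow> (\<lambda>n. f n x) sums g x"
    "\<And>x. x > t \<Longrightarrow> (g has_derivative (\<lambda>h. h *\<^sub>R - (\<Sum>n. f' n x))) (at x within {t<..})"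
    by auto
  have "(g has_vector_derivative - D_ser \<phi> s) (at s within {t<..})"
    using g(2)[OF t(2)] by (simp add: has_vector_derivative_def dser_def f'_def)
  then have "(g has_vector_derivative - D_ser \<phi> s) (at s)"
    using t by (simp add: at_within_open[of s "{t<..}"])
  then show ?thesis
    by (rule has_vector_derivative_transform_within_open[of _ _ _ "{t<..}"])
       (use t g(1) in \<open>auto simp: dser_def f_def sums_iff\<close>)
qed

text \<open>The derivative has the sign of \<open>1 - s * ln x\<close>, which is not positive once
  \<open>x\<close> is at least e; hence the start at 3.\<close>

lemma ln_mult_powr_decreasing:
  assumes "3 \<le> n" "1 \<le> s"
  shows "ln (real (Suc n)) * real (Suc n) powr - s \<le> ln (real n) * real n powr - s"
proof (rule DERIV_nonpos_imp_nonincreasing[of "real n" "real (Suc n)" "\<lambda>x. ln x * x powr - s"])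
  fix x assume x: "real n \<le> x" "x \<le> real (Suc n)"
  then have x3: "3 \<le> x" using assms by simp
  have "exp 1 \<le> x" using exp_le x3 by (rule order.trans)
  then have "1 \<le> ln x" using x3 by (subst ln_ge_iff) auto
  then have "1 * 1 \<le> s * ln x" using assms by (intro mult_mono) auto
  moreover have "((\<lambda>x. ln x * x powr - s) has_real_derivative x powr (- s - 1) * (1 - s * ln x)) (at x)"
    using x3 by (auto intro!: derivative_eq_intros simp: field_simps powr_diff powr_minus)
  ultimately show "\<exists>y. ((\<lambda>x. ln x * x powr - s) has_real_derivative y) (at x) \<and> y \<le> 0"
    by (intro exI conjI) (auto simp: mult_nonneg_nonpos)
qed simp

text \<open>Abel summation replaces absolute convergence, which would give a bound that blows up as
  \<open>s\<close> tends to 1.\<close>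

lemma D_ser_bounded:
  assumes \<phi>: "\<phi> \<in> dchars b" "\<phi> \<noteq> principal_dchar b" "b > 0"
  obtains C where "C \<ge> 0" "\<And>s. 1 < s \<Longrightarrow> norm (D_ser \<phi> s) \<le> C"
proof
  \<comment> \<open>The summand 1 covers \<open>n < 3\<close>, where only \<open>n = 2\<close>
    contributes, and the last factor 2 bounds \<open>ln 3\<close>.\<close>
  show "0 \<le> 1 + 2 * real b * 2" by simp
  fix s :: real assume s: "1 < s"
  define a where "a = (\<lambda>n. ln (real n) * real n powr - s)"
  have lim: "a \<longlonglongrightarrow> 0"
    unfolding a_def using s by real_asymp
  have sm: "summable (\<lambda>n. a n *\<^sub>R \<phi> n)"
    using summable_norm_cancel[OF summable_dser[OF norm_dchar_le[OF \<phi>(1,3)] dser_coeff_bounds(2) s]]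
    by (simp add: a_def)
  have tail: "norm (\<Sum>n. a (n + 3) *\<^sub>R \<phi> (n + 3)) \<le> 2 * real b * a 3"
    using norm_sum_dchar_le[OF \<phi>] ln_mult_powr_decreasing s lim
    by (intro norm_suminf_decreasing_le) (auto simp: a_def)
  have "3 powr - s \<le> (3::real) powr 0" using s by (intro powr_mono) auto
  then have "a 3 \<le> 2 * 1"
    unfolding a_def using ln_le_minus_one[of 3] by (intro mult_mono) auto
  then have "2 * real b * a 3 \<le> 2 * real b * 2" by (intro mult_left_mono) auto
  moreover have "norm (\<Sum>n<3. a n *\<^sub>R \<phi> n) \<le> 1"
  proof -
    have "2 powr - s \<le> (2::real) powr 0" using s by (intro powr_mono) auto
    then have "ln 2 * 2 powr - s * norm (\<phi> 2) \<le> 1 * 1 * 1"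
      using ln_le_minus_one[of 2] norm_dchar_le[OF \<phi>(1,3)] by (intro mult_mono) auto
    then show ?thesis by (simp add: a_def eval_nat_numeral)
  qed
  moreover have "D_ser \<phi> s = (\<Sum>n. a (n + 3) *\<^sub>R \<phi> (n + 3)) + (\<Sum>n<3. a n *\<^sub>R \<phi> n)"
    using suminf_split_initial_segment[OF sm, of 3] by (simp add: dser_def a_def)
  ultimately show "norm (D_ser \<phi> s) \<le> 1 + 2 * real b * 2"
    using tail norm_triangle_ineq[of "\<Sum>n. a (n + 3) *\<^sub>R \<phi> (n + 3)" "\<Sum>n<3. a n *\<^sub>R \<phi> n"] by simp
qed

text \<open>The tail from \<open>N\<close> on is at most \<open>2 * b / N\<close> for every
  \<open>s \<ge> 1\<close>. This includes \<open>s = 1\<close>, where convergence is not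
  absolute.\<close>

lemma L_ser_uniform_limit:
  assumes \<phi>: "\<phi> \<in> dchars b" "\<phi> \<noteq> principal_dchar b" "b > 0"
  shows "uniform_limit {1..} (\<lambda>N s. \<Sum>n<N. (1 * real n powr - s) *\<^sub>R \<phi> n) (L_ser \<phi>) sequentially"
    and "1 \<le> s \<Longrightarrow> summable (\<lambda>n. (1 * real n powr - s) *\<^sub>R \<phi> n)"
proof -
  define a where "a = (\<lambda>s n. 1 * real n powr - s)"
  have lim: "a s \<longlonglongrightarrow> 0" if "s \<ge> 1" for s
    unfolding a_def using that by real_asymp
  have dec: "a s (Suc n) \<le> a s n" if "s \<ge> 1" "1 \<le> n" for s n
    unfolding a_def using that by (simp add: powr_mono2')
  have sm: "summable (\<lambda>n. a s n *\<^sub>R \<phi> n)" if "s \<ge> 1" for s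
    using norm_sum_dchar_le[OF \<phi>] dec[OF that] lim[OF that] by (rule summable_decreasing_bounded)
  then show "1 \<le> s \<Longrightarrow> summable (\<lambda>n. (1 * real n powr - s) *\<^sub>R \<phi> n)" by (simp add: a_def)
  have tail: "norm (\<Sum>n. a s (n + N) *\<^sub>R \<phi> (n + N)) \<le> 2 * real b * (1 / real N)"
    if "s \<ge> 1" "N \<ge> 1" for s N
  proof -
    have "norm (\<Sum>n. a s (n + N) *\<^sub>R \<phi> (n + N)) \<le> 2 * real b * a s N"
      using norm_sum_dchar_le[OF \<phi>] dec[OF that(1)] lim[OF that(1)] that
      by (intro norm_suminf_decreasing_le) auto
    also have "real N powr - s \<le> real N powr - 1" using that by (intro powr_mono) auto
    then have "a s N \<le> 1 / real N" using that by (simp add: a_def powr_minus divide_inverse)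
    then have "2 * real b * a s N \<le> 2 * real b * (1 / real N)" by (intro mult_left_mono) auto
    finally show ?thesis .
  qed
  have tail0: "(\<lambda>N. 2 * real b * (1 / real N)) \<longlonglongrightarrow> 0" by real_asymp
  show "uniform_limit {1..} (\<lambda>N s. \<Sum>n<N. (1 * real n powr - s) *\<^sub>R \<phi> n) (L_ser \<phi>) sequentially"
  proof (rule uniform_limitI)
    fix e :: real assume "e > 0"
    from order_tendstoD(2)[OF tail0 this] eventually_ge_at_top[of 1]
    show "\<forall>\<^sub>F N in sequentially. \<forall>s\<in>{1..}. dist (\<Sum>n<N. (1 * real n powr - s) *\<^sub>R \<phi> n) (L_ser \<phi> s) < e"
    proof eventually_elim
      case (elim N)
      show ?case
      proof
        fix s :: real assume s: "s \<in> {1..}"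
        have "L_ser \<phi> s = (\<Sum>n. a s (n + N) *\<^sub>R \<phi> (n + N)) + (\<Sum>n<N. a s n *\<^sub>R \<phi> n)"
          using suminf_split_initial_segment[OF sm, of s N] s by (simp add: dser_def a_def)
        then have "dist (\<Sum>n<N. (1 * real n powr - s) *\<^sub>R \<phi> n) (L_ser \<phi> s) = norm (\<Sum>n. a s (n + N) *\<^sub>R \<phi> (n + N))"
          by (simp add: dist_norm a_def)
        also have "\<dots> \<le> 2 * real b * (1 / real N)" using s elim by (intro tail) auto
        also have "\<dots> < e" using elim by simp
        finally show "dist (\<Sum>n<N. (1 * real n powr - s) *\<^sub>R \<phi> n) (L_ser \<phi> s) < e" .
      qed
    qed
  qed
qed

lemma L_ser_continuous_on:
  assumes \<phi>: "\<phi> \<in> dchars b" "\<phi> \<noteq> principal_dchar b" "b > 0"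
  shows "continuous_on {1..} (L_ser \<phi>)"
proof (rule uniform_limit_theorem[OF _ L_ser_uniform_limit(1)[OF \<phi>]])
  have "continuous_on {1..} (\<lambda>s. (1 * real n powr - s) *\<^sub>R \<phi> n)" for n
    by (cases "n = 0") (auto intro!: continuous_intros)
  then show "\<forall>\<^sub>F N in sequentially. continuous_on {1..} (\<lambda>s. \<Sum>n<N. (1 * real n powr - s) *\<^sub>R \<phi> n)"
    by (intro always_eventually allI continuous_on_sum)
qed simp

text \<open>Turns a zero at 1 into a factor of size O(s - 1). The derivative is at hand only for
  \<open>s > 1\<close>, so continuity at the endpoint completes the mean value argument.\<close>

lemma L_ser_lipschitz_at_1:
  assumes \<phi>: "\<phi> \<in> dchars b" "\<phi> \<noteq> principal_dchar b" "b > 0"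
  obtains C where "C \<ge> 0" "\<And>s. 1 < s \<Longrightarrow> norm (L_ser \<phi> s - L_ser \<phi> 1) \<le> C * (s - 1)"
proof -
  obtain C where C: "C \<ge> 0" "\<And>s. 1 < s \<Longrightarrow> norm (D_ser \<phi> s) \<le> C"
    using D_ser_bounded[OF \<phi>] by metis
  have "norm (L_ser \<phi> s - L_ser \<phi> 1) \<le> C * s - C * 1" if "1 < s" for s
  proof (rule differentiable_bound_general[OF that, where \<phi> = "\<lambda>x. C * x" and \<phi>' = "\<lambda>_. C"])
    show "continuous_on {1..s} (L_ser \<phi>)"
      using L_ser_continuous_on[OF \<phi>] by (rule continuous_on_subset) auto
    show "(L_ser \<phi> has_vector_derivative - D_ser \<phi> x) (at x)" if "1 < x" "x < s" for x
      using that by (intro L_ser_has_vector_derivative norm_dchar_le[OF \<phi>(1,3)])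
    show "((\<lambda>x. C * x) has_vector_derivative C) (at x)" for x
      by (auto intro!: derivative_eq_intros)
  qed (use C in \<open>auto intro!: continuous_intros\<close>)
  then show ?thesis
    using C(1) that by (auto simp: right_diff_distrib)
qed

section \<open>Nonvanishing at 1\<close>

text \<open>Comparison with the integral of \<open>x powr - s\<close>: by the mean value theorem
  each term from 2 on is at most a difference of \<open>n powr (1 - s) / (s - 1)\<close>, and these
  telescope.\<close>

lemma sum_powr_le:
  assumes "s > (1::real)"
  shows "(\<Sum>n<N. real n powr - s) \<le> 1 + 1 / (s - 1)"
proof -
  have step: "real (Suc n) powr - s \<le> (real n powr (1 - s) - real (Suc n) powr (1 - s)) / (s - 1)"
    if n: "n \<ge> 1" for n
  proof -
    have "\<exists>z. real n < z \<and> z < real (Suc n) \<and>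
      real (Suc n) powr (1 - s) - real n powr (1 - s) = (real (Suc n) - real n) * ((1 - s) * z powr (1 - s - 1))"
      using n by (intro MVT2 has_real_derivative_powr) auto
    then obtain z where z: "real n < z" "z < real (Suc n)"
      "real (Suc n) powr (1 - s) - real n powr (1 - s) = (1 - s) * z powr - s"
      by auto
    have "real (Suc n) powr - s \<le> z powr - s"
      using z(1,2) n assms by (intro powr_mono2') auto
    also have "\<dots> = (real n powr (1 - s) - real (Suc n) powr (1 - s)) / (s - 1)"
      using z(3) assms by (simp add: field_simps)
    finally show ?thesis .
  qed
  have "(\<Sum>n<Suc (Suc M). real n powr - s) \<le> 1 + (1 - real (Suc M) powr (1 - s)) / (s - 1)" for M
  proof (induction M)
    case (Suc M)
    have "(\<Sum>n<Suc (Suc (Suc M)). real n powr - s) \<le>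
        1 + (1 - real (Suc M) powr (1 - s)) / (s - 1)
          + (real (Suc M) powr (1 - s) - real (Suc (Suc M)) powr (1 - s)) / (s - 1)"
      using Suc.IH step[of "Suc M"] by (simp del: of_nat_Suc)
    also have "\<dots> = 1 + (1 - real (Suc (Suc M)) powr (1 - s)) / (s - 1)"
      by (simp add: diff_divide_distrib)
    finally show ?case .
  qed simp
  moreover have "(\<Sum>n<N. real n powr - s) \<le> (\<Sum>n<Suc (Suc N). real n powr - s)"
    by (intro sum_mono2) auto
  moreover have "1 + (1 - real (Suc N) powr (1 - s)) / (s - 1) \<le> 1 + 1 / (s - 1)"
    using assms by (intro add_mono divide_right_mono) auto
  ultimately show ?thesis by (meson order.trans)
qed

lemma
  assumes "s > (1::real)"
  shows summable_powr_nat: "summable (\<lambda>n. real n powr - s)"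
    and suminf_powr_nat_le: "(\<Sum>n. real n powr - s) \<le> 1 + 1 / (s - 1)"
proof -
  show "summable (\<lambda>n. real n powr - s)" using assms by (simp add: summable_real_powr_iff)
  then show "(\<Sum>n. real n powr - s) \<le> 1 + 1 / (s - 1)"
    using sum_powr_le[OF assms] by (rule suminf_le_const)
qed

lemma norm_L_ser_le:
  assumes "\<And>n. norm (\<phi> n :: complex) \<le> 1" "s > 1"
  shows "norm (L_ser \<phi> s) \<le> 1 + 1 / (s - 1)"
proof -
  have sm: "summable (\<lambda>n. norm ((1 * real n powr - s) *\<^sub>R \<phi> n))"
    using assms dser_coeff_bounds(1) by (intro summable_dser)
  have "norm (L_ser \<phi> s) \<le> (\<Sum>n. norm ((1 * real n powr - s) *\<^sub>R \<phi> n))"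
    unfolding dser_def using sm by (rule summable_norm)
  also have "\<dots> \<le> (\<Sum>n. real n powr - s)"
    using assms sm by (intro suminf_le summable_powr_nat) (auto simp: mult_left_le)
  also have "\<dots> \<le> 1 + 1 / (s - 1)" using assms(2) by (rule suminf_powr_nat_le)
  finally show ?thesis .
qed

text \<open>At 3 the terms from \<open>n = 2\<close> on have total modulus at most 1/2, too little
  to cancel the term 1 at \<open>n = 1\<close>.\<close>

lemma L_ser_3_nonzero:
  assumes "\<phi> \<in> dchars b" "b > 0"
  shows "L_ser \<phi> 3 \<noteq> 0"
proof
  assume zero: "L_ser \<phi> 3 = 0"
  let ?f = "\<lambda>n. (1 * real n powr - 3) *\<^sub>R \<phi> n"
  have sm: "summable (\<lambda>n. norm (?f n))"
    using norm_dchar_le[OF assms] dser_coeff_bounds(1) by (intro summable_dser) auto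
  have sp: "summable (\<lambda>n. real n powr - 3)" by (rule summable_powr_nat) simp
  have "L_ser \<phi> 3 = (\<Sum>n. ?f (n + 2)) + 1"
    using suminf_split_initial_segment[OF summable_norm_cancel[OF sm], of 2]
    by (simp add: dser_def eval_nat_numeral dchar_1[OF assms(1)])
  then have "(\<Sum>n. ?f (n + 2)) = - 1" using zero by (simp only: eq_neg_iff_add_eq_0)
  then have "1 = norm (\<Sum>n. ?f (n + 2))" by (simp only: norm_minus_cancel norm_one)
  also have "\<dots> \<le> (\<Sum>n. norm (?f (n + 2)))"
    by (intro summable_norm summable_ignore_initial_segment sm)
  also have "\<dots> \<le> (\<Sum>n. real (n + 2) powr - 3)"
    using norm_dchar_le[OF assms] summable_ignore_initial_segment[OF sm, of 2]
      summable_ignore_initial_segment[OF sp, of 2]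
    by (intro suminf_le) (auto simp: mult_left_le)
  also have "\<dots> = (\<Sum>n. real n powr - 3) - 1"
    using suminf_split_initial_segment[OF sp, of 2] by (simp add: eval_nat_numeral)
  also have "\<dots> \<le> 1 / 2" using suminf_powr_nat_le[of 3] by simp
  finally show False by simp
qed

text \<open>Orthogonality isolates the class of \<open>h\<close>, leaving a real series with
  nonnegative terms.\<close>

lemma F_ser_sum:
  assumes "s > 1" "b > 0" "coprime h b"
  shows "(\<Sum>\<phi>\<in>dchars b. cnj (\<phi> h) * F_ser \<phi> s) =
    of_real (real (card (dchars b)) * (\<Sum>n. if [n = h] (mod b) then mangoldt n * real n powr - s else 0))"
    and "summable (\<lambda>n. if [n = h] (mod b) then mangoldt n * real n powr - s else 0)"
proof -
  let ?t = "\<lambda>n. if [n = h] (mod b) then mangoldt n * real n powr - s else (0::real)"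
  have sm0: "summable (\<lambda>n. norm ((mangoldt n * real n powr - s) *\<^sub>R (\<phi> n :: complex)))"
    if "\<And>n. norm (\<phi> n) \<le> 1" for \<phi>
    using that assms(1) dser_coeff_bounds(3) by (intro summable_dser)
  show sm: "summable ?t"
    using sm0[of "\<lambda>_. 1"] by (rule summable_comparison_test'[of _ 0]) (auto simp: abs_mult mangoldt_nonneg)
  have "(\<lambda>n. (mangoldt n * real n powr - s) *\<^sub>R \<phi> n) sums F_ser \<phi> s" if "\<phi> \<in> dchars b" for \<phi>
    unfolding dser_def
    by (rule summable_sums[OF summable_norm_cancel[OF sm0[OF norm_dchar_le[OF that assms(2)]]]])
  then have "(\<lambda>n. \<Sum>\<phi>\<in>dchars b. cnj (\<phi> h) * ((mangoldt n * real n powr - s) *\<^sub>R \<phi> n))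
      sums (\<Sum>\<phi>\<in>dchars b. cnj (\<phi> h) * F_ser \<phi> s)"
    by (intro sums_sum sums_mult)
  moreover have "(\<Sum>\<phi>\<in>dchars b. cnj (\<phi> h) * ((mangoldt n * real n powr - s) *\<^sub>R \<phi> n)) =
      of_real (real (card (dchars b)) * ?t n)" for n
  proof -
    have "(\<Sum>\<phi>\<in>dchars b. cnj (\<phi> h) * ((mangoldt n * real n powr - s) *\<^sub>R \<phi> n)) =
        (mangoldt n * real n powr - s) *\<^sub>R (\<Sum>\<phi>\<in>dchars b. cnj (\<phi> h) * \<phi> n)"
      by (simp add: scaleR_sum_right)
    then show ?thesis
      unfolding sum_dchars_cnj[OF assms(2,3)] by (simp add: scaleR_conv_of_real)
  qed
  ultimately have "(\<lambda>n. of_real (real (card (dchars b)) * ?t n) :: complex)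
      sums (\<Sum>\<phi>\<in>dchars b. cnj (\<phi> h) * F_ser \<phi> s)" by simp
  moreover have "(\<lambda>n. of_real (real (card (dchars b)) * ?t n) :: complex)
      sums of_real (real (card (dchars b)) * suminf ?t)"
    using sm by (intro sums_of_real sums_mult summable_sums)
  ultimately show "(\<Sum>\<phi>\<in>dchars b. cnj (\<phi> h) * F_ser \<phi> s) =
      of_real (real (card (dchars b)) * suminf ?t)"
    by (rule sums_unique2)
qed

text \<open>The logarithmic derivative of the product of all L-series is minus a Dirichlet series with
  nonnegative coefficients, so the product does not increase in modulus.\<close>

lemma norm_prod_L_ser_antimono:
  assumes "b > 0" "1 < s" "s \<le> t"
  shows "norm (\<Prod>\<phi>\<in>dchars b. L_ser \<phi> t) \<le> norm (\<Prod>\<phi>\<in>dchars b. L_ser \<phi> s)"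
proof -
  define P where "P = (\<lambda>s. \<Prod>\<phi>\<in>dchars b. L_ser \<phi> s)"
  have "\<exists>y. ((\<lambda>x. P x \<bullet> P x) has_real_derivative y) (at x) \<and> y \<le> 0" if x: "s \<le> x" "x \<le> t" for x
  proof -
    have x1: "x > 1" using x assms by simp
    define G where "G = real (card (dchars b)) * (\<Sum>n. if [n = 1] (mod b) then mangoldt n * real n powr - x else 0)"
    have "(\<Sum>\<phi>\<in>dchars b. F_ser \<phi> x) = (\<Sum>\<phi>\<in>dchars b. cnj (\<phi> 1) * F_ser \<phi> x)"
      by (intro sum.cong) (auto simp: dchar_1)
    also have "\<dots> = of_real G"
      unfolding G_def using F_ser_sum(1)[OF x1 assms(1), of 1] by simp
    finally have G: "(\<Sum>\<phi>\<in>dchars b. F_ser \<phi> x) = of_real G" .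
    have "G \<ge> 0"
      unfolding G_def using F_ser_sum(2)[OF x1 assms(1), of 1]
      by (intro mult_nonneg_nonneg suminf_nonneg) (auto simp: mangoldt_nonneg)
    have "(P has_derivative (\<lambda>h. \<Sum>\<phi>\<in>dchars b. (h *\<^sub>R - D_ser \<phi> x) * (\<Prod>\<psi>\<in>dchars b - {\<phi>}. L_ser \<psi> x))) (at x)"
      unfolding P_def
      using L_ser_has_vector_derivative[OF norm_dchar_le[OF _ assms(1)] x1]
      by (intro has_derivative_prod) (auto simp: has_vector_derivative_def)
    moreover have "(\<Sum>\<phi>\<in>dchars b. (h *\<^sub>R - D_ser \<phi> x) * (\<Prod>\<psi>\<in>dchars b - {\<phi>}. L_ser \<psi> x)) = h *\<^sub>R (- G *\<^sub>R P x)" for h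
    proof -
      \<comment> \<open>Substituting \<open>D = L * F\<close> for each factor, rather than dividing
        by \<open>L\<close>, yields the derivative \<open>- G * P\<close> even where some L-series
        vanishes.\<close>
      have "D_ser \<phi> x * (\<Prod>\<psi>\<in>dchars b - {\<phi>}. L_ser \<psi> x) = F_ser \<phi> x * P x" if "\<phi> \<in> dchars b" for \<phi>
        using L_ser_mult_F_ser[OF norm_dchar_le[OF that assms(1)] dchar_mult[OF that] x1]
          prod.remove[OF finite_dchars[OF assms(1)] that, of "\<lambda>\<psi>. L_ser \<psi> x"]
        by (simp add: P_def mult_ac flip: \<open>L_ser \<phi> x * F_ser \<phi> x = D_ser \<phi> x\<close>)
      then have "(\<Sum>\<phi>\<in>dchars b. D_ser \<phi> x * (\<Prod>\<psi>\<in>dchars b - {\<phi>}. L_ser \<psi> x)) = of_real G * P x"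
        by (simp add: sum_distrib_right flip: G)
      then show ?thesis
        by (simp add: sum_negf scaleR_conv_of_real mult.assoc flip: sum_distrib_left)
    qed
    ultimately have "(P has_vector_derivative (- G *\<^sub>R P x)) (at x)"
      by (simp add: has_vector_derivative_def)
    from bounded_bilinear.has_vector_derivative[OF bounded_bilinear_inner this this]
    have "((\<lambda>x. P x \<bullet> P x) has_real_derivative (- 2 * G * (P x \<bullet> P x))) (at x)"
      by (simp add: has_real_derivative_iff_has_vector_derivative mult.assoc)
    moreover have "- 2 * G * (P x \<bullet> P x) \<le> 0" using \<open>G \<ge> 0\<close> by simp
    ultimately show ?thesis by blast
  qed
  from DERIV_nonpos_imp_nonincreasing[OF assms(3) this]
  have "norm (P t) ^ 2 \<le> norm (P s) ^ 2" by (simp add: power2_norm_eq_inner)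
  then show ?thesis unfolding P_def by (rule power2_le_imp_le) simp
qed

lemma L_ser_cnj:
  assumes "summable (\<lambda>n. (1 * real n powr - s) *\<^sub>R \<phi> n)"
  shows "L_ser (\<lambda>n. cnj (\<phi> n)) s = cnj (L_ser \<phi> s)"
proof -
  have "(\<lambda>n. cnj ((1 * real n powr - s) *\<^sub>R \<phi> n)) sums cnj (L_ser \<phi> s)"
    unfolding dser_def using assms by (simp only: sums_cnj summable_sums)
  then show ?thesis by (simp add: dser_def sums_iff)
qed

theorem L_ser_1_nonzero:
  assumes \<phi>: "\<phi> \<in> dchars b" "\<phi> \<noteq> principal_dchar b" "b > 0"
  shows "L_ser \<phi> 1 \<noteq> 0"
proof
  assume zero: "L_ser \<phi> 1 = 0"
  have "summable (\<lambda>n. (1 * real n powr - 1) *\<^sub>R \<phi> n)"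
    by (rule L_ser_uniform_limit(2)[OF \<phi>]) simp
  then have sums0: "(\<lambda>n. \<phi> n / of_nat n) sums 0"
    using zero by (simp add: dser_def sums_iff powr_minus scaleR_conv_of_real divide_inverse mult.commute)
  define \<psi> where "\<psi> = (\<lambda>n. cnj (\<phi> n))"
  have \<psi>: "\<psi> \<in> dchars b" unfolding \<psi>_def using \<phi>(1) by (rule dchar_cnj_in)
  have "\<psi> \<noteq> principal_dchar b"
  proof
    assume "\<psi> = principal_dchar b"
    then have "cnj (\<phi> n) = principal_dchar b n" for n by (metis \<psi>_def)
    then have "\<phi> n = principal_dchar b n" for n
      by (metis complex_cnj_cnj complex_cnj_one complex_cnj_zero principal_dchar_def)
    with \<phi>(2) show False by blast
  qed
  note \<psi> = \<psi> this \<phi>(3)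
  have "\<psi> \<noteq> \<phi>"
  proof
    assume "\<psi> = \<phi>"
    then have "cnj (\<phi> n) = \<phi> n" for n by (metis \<psi>_def)
    then have "\<phi> n \<in> \<real>" for n by (simp add: Reals_cnj_iff)
    with real_dchar_series_nonzero[OF \<phi>] sums0 show False by blast
  qed
  have zero': "L_ser \<psi> 1 = 0"
    unfolding \<psi>_def using L_ser_cnj[OF L_ser_uniform_limit(2)[OF \<phi>], of 1] zero by simp
  have "\<exists>C\<ge>0. \<forall>s>1. norm (L_ser \<theta> s - L_ser \<theta> 1) \<le> C * (s - 1)"
    if "\<theta> \<in> dchars b" "\<theta> \<noteq> principal_dchar b" for \<theta>
    using L_ser_lipschitz_at_1[OF that \<phi>(3)] by metis
  then obtain C where C: "\<And>\<theta> s. \<theta> \<in> dchars b \<Longrightarrow> \<theta> \<noteq> principal_dchar b \<Longrightarrow> s > 1 \<Longrightarrow>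
      C \<theta> \<ge> 0 \<and> norm (L_ser \<theta> s - L_ser \<theta> 1) \<le> C \<theta> * (s - 1)"
    by metis
  define R where "R = dchars b - {principal_dchar b} - {\<phi>} - {\<psi>}"
  have finR: "finite (dchars b)" using \<phi>(3) by (rule finite_dchars)
  have split: "(\<Prod>\<theta>\<in>dchars b. f \<theta>) = f (principal_dchar b) * (f \<phi> * (f \<psi> * (\<Prod>\<theta>\<in>R. f \<theta>)))"
    for f :: "(nat \<Rightarrow> complex) \<Rightarrow> real"
    unfolding R_def using finR \<phi> \<psi> \<open>\<psi> \<noteq> \<phi>\<close> principal_dchar_in[of b]
    by (simp add: prod.remove[of "dchars b" "principal_dchar b"] prod.remove[of "dchars b - {principal_dchar b}" \<phi>]
        prod.remove[of "dchars b - {principal_dchar b} - {\<phi>}" \<psi>])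
  \<comment> \<open>For \<open>1 < s \<le> 2\<close> the principal factor is at most
    \<open>2 / (s - 1)\<close>, the two vanishing factors at most \<open>C \<phi> * (s - 1)\<close>
    and \<open>C \<psi> * (s - 1)\<close>, and every other one at most its modulus at 1 plus
    \<open>C \<theta>\<close>. One factor \<open>s - 1\<close> survives.\<close>
  define K where "K = 2 * (C \<phi> * (C \<psi> * (\<Prod>\<theta>\<in>R. norm (L_ser \<theta> 1) + C \<theta>)))"
  \<comment> \<open>A fixed positive lower bound for the product on all of (1, 2], by monotonicity
    from 3 downwards.\<close>
  define c where "c = norm (\<Prod>\<phi>\<in>dchars b. L_ser \<phi> 3)"
  have "c > 0" unfolding c_def using L_ser_3_nonzero[OF _ \<phi>(3)] finR by (simp add: prod_zero_iff)
  have le: "c \<le> K * (s - 1)" if s: "1 < s" "s \<le> 2" for s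
  proof -
    have "c \<le> norm (\<Prod>\<theta>\<in>dchars b. L_ser \<theta> s)"
      unfolding c_def using s by (intro norm_prod_L_ser_antimono[OF \<phi>(3)]) auto
    also have "\<dots> = norm (L_ser (principal_dchar b) s) * (norm (L_ser \<phi> s) * (norm (L_ser \<psi> s) * (\<Prod>\<theta>\<in>R. norm (L_ser \<theta> s))))"
      unfolding prod_norm[symmetric] by (rule split)
    also have "\<dots> \<le> (2 / (s - 1)) * ((C \<phi> * (s - 1)) * ((C \<psi> * (s - 1)) * (\<Prod>\<theta>\<in>R. norm (L_ser \<theta> 1) + C \<theta>)))"
    proof (intro mult_mono)
      have "norm (L_ser (principal_dchar b) s) \<le> 1 + 1 / (s - 1)"
        using norm_L_ser_le[OF norm_dchar_le[OF principal_dchar_in \<phi>(3)] s(1)] .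
      also have "\<dots> = s / (s - 1)" using s by (simp add: field_simps)
      also have "\<dots> \<le> 2 / (s - 1)" using s by (intro divide_right_mono) auto
      finally show "norm (L_ser (principal_dchar b) s) \<le> 2 / (s - 1)" .
      show "norm (L_ser \<phi> s) \<le> C \<phi> * (s - 1)" "norm (L_ser \<psi> s) \<le> C \<psi> * (s - 1)"
        using C[OF \<phi>(1,2) s(1)] C[OF \<psi>(1,2) s(1)] zero zero' by simp_all
      show "(\<Prod>\<theta>\<in>R. norm (L_ser \<theta> s)) \<le> (\<Prod>\<theta>\<in>R. norm (L_ser \<theta> 1) + C \<theta>)"
      proof (rule prod_mono)
        fix \<theta> assume "\<theta> \<in> R"
        then have \<theta>: "C \<theta> \<ge> 0" "norm (L_ser \<theta> s - L_ser \<theta> 1) \<le> C \<theta> * (s - 1)"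
          using C[of \<theta> s] s by (auto simp: R_def)
        have "C \<theta> * (s - 1) \<le> C \<theta> * 1" using \<theta>(1) s by (intro mult_left_mono) auto
        then have "norm (L_ser \<theta> s) \<le> norm (L_ser \<theta> 1) + C \<theta>"
          using \<theta>(2) norm_triangle_sub[of "L_ser \<theta> s" "L_ser \<theta> 1"] by linarith
        then show "0 \<le> norm (L_ser \<theta> s) \<and> norm (L_ser \<theta> s) \<le> norm (L_ser \<theta> 1) + C \<theta>" by simp
      qed
    qed (use s C[OF \<phi>(1,2) s(1)] C[OF \<psi>(1,2) s(1)] in \<open>auto intro!: prod_nonneg mult_nonneg_nonneg\<close>)
    also have "\<dots> = K * (s - 1)" using s by (simp add: K_def field_simps)
    finally show ?thesis .
  qed
  have "((\<lambda>s. K * (s - 1)) \<longlongrightarrow> K * (1 - 1)) (at_right 1)"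
    by (intro tendsto_intros)
  moreover have "eventually (\<lambda>s. c \<le> K * (s - 1)) (at_right 1)"
    by (rule eventually_mono[OF eventually_at_right_real[of 1 2]]) (use le in auto)
  ultimately have "c \<le> K * (1 - 1)" by (intro tendsto_lowerbound) auto
  with \<open>c > 0\<close> show False by simp
qed

section \<open>Primes in residue classes\<close>

text \<open>\<open>F\<close> is \<open>D / L\<close> with bounded numerator, and nonvanishing at 1
  with continuity keeps \<open>L\<close> away from 0 nearby.\<close>

lemma F_ser_bounded:
  assumes \<phi>: "\<phi> \<in> dchars b" "\<phi> \<noteq> principal_dchar b" "b > 0"
  obtains K where "eventually (\<lambda>s. norm (F_ser \<phi> s) \<le> K) (at_right 1)"
proof -
  define c where "c = norm (L_ser \<phi> 1) / 2"
  have c: "c > 0" using L_ser_1_nonzero[OF \<phi>] by (simp add: c_def)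
  obtain C where C: "C \<ge> 0" "\<And>s. 1 < s \<Longrightarrow> norm (D_ser \<phi> s) \<le> C"
    using D_ser_bounded[OF \<phi>] by metis
  have "continuous (at 1 within {1..}) (L_ser \<phi>)"
    using L_ser_continuous_on[OF \<phi>] by (simp add: continuous_on_eq_continuous_within)
  then have "(L_ser \<phi> \<longlongrightarrow> L_ser \<phi> 1) (at_right 1)"
    unfolding continuous_within by (rule tendsto_within_subset) auto
  then have "((\<lambda>s. norm (L_ser \<phi> s)) \<longlongrightarrow> norm (L_ser \<phi> 1)) (at_right 1)"
    by (rule tendsto_norm)
  moreover have "c < norm (L_ser \<phi> 1)" using c by (simp add: c_def)
  ultimately have "eventually (\<lambda>s. c < norm (L_ser \<phi> s)) (at_right 1)"
    by (rule order_tendstoD(1))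
  moreover have "eventually (\<lambda>s::real. 1 < s) (at_right 1)"
    by (simp add: eventually_at_right_less)
  ultimately have "eventually (\<lambda>s. norm (F_ser \<phi> s) \<le> C / c) (at_right 1)"
  proof eventually_elim
    case (elim s)
    have "norm (L_ser \<phi> s) * norm (F_ser \<phi> s) \<le> C"
      using C(2)[OF elim(2)] L_ser_mult_F_ser[OF norm_dchar_le[OF \<phi>(1,3)] dchar_mult[OF \<phi>(1)] elim(2)]
      by (metis norm_mult)
    moreover have "c * norm (F_ser \<phi> s) \<le> norm (L_ser \<phi> s) * norm (F_ser \<phi> s)"
      using elim by (intro mult_right_mono) auto
    ultimately show ?case using c by (simp add: field_simps)
  qed
  then show ?thesis by (rule that)
qed

text \<open>The progression \<open>k * b + 1\<close> consists of units and already dominates a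
  multiple of the harmonic series.\<close>

lemma principal_sum_unbounded:
  assumes "b > 0"
  obtains N where "T \<le> (\<Sum>n<N. if coprime n b then 1 / real n else 0)"
proof (rule ccontr)
  define f where "f = (\<lambda>n. if coprime n b then 1 / real n else 0)"
  assume "\<not> thesis"
  with that have less: "(\<Sum>n<N. f n) \<le> T" for N
    unfolding f_def by (meson linear)
  have fpos: "0 \<le> f n" for n by (simp add: f_def)
  have le: "1 / real b * (1 / real (Suc k)) \<le> f (k * b + 1)" for k
  proof -
    have "real (k * b + 1) \<le> real b * real (Suc k)" using assms by (simp add: algebra_simps)
    then have "1 / (real b * real (Suc k)) \<le> 1 / real (k * b + 1)"
      using assms by (intro divide_left_mono) (auto simp del: of_nat_Suc)
    moreover have "coprime (k * b + 1) b"
      using cong_coprime_left[OF cong_add[OF cong_mult_self_right[of k b] cong_refl[of 1 b]]] by simp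
    ultimately show ?thesis by (simp add: f_def del: of_nat_Suc)
  qed
  have "(\<Sum>k\<le>K. 1 / real b * (1 / real (Suc k))) \<le> T" for K
  proof -
    have "(\<Sum>k\<le>K. 1 / real b * (1 / real (Suc k))) \<le> (\<Sum>k\<le>K. f (k * b + 1))"
      by (intro sum_mono le)
    also have "\<dots> = (\<Sum>n\<in>(\<lambda>k. k * b + 1) ` {..K}. f n)"
      using assms by (subst sum.reindex) (auto simp: inj_on_def)
    also have "\<dots> \<le> (\<Sum>n<K * b + 2. f n)"
      using fpos by (intro sum_mono2) (auto intro: less_le_trans le_imp_less_Suc simp: add_le_mono1)
    also have "\<dots> \<le> T" by (rule less)
    finally show ?thesis .
  qed
  then have "summable (\<lambda>k. 1 / real b * (1 / real (Suc k)))"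
    by (intro bounded_imp_summable) auto
  then have "summable (\<lambda>k. 1 / real (Suc k))"
    using assms by (subst (asm) summable_cmult_iff) auto
  then have "summable (\<lambda>k. inverse (real k))"
    by (subst summable_Suc_iff[symmetric]) (simp add: inverse_eq_divide)
  with not_summable_harmonic[where ?'a = real] show False by simp
qed

text \<open>Since \<open>F = D / L\<close>, it suffices that \<open>D\<close> exceeds
  \<open>\<bar>K\<bar> * L\<close>. From \<open>M\<close> on, \<open>ln n\<close> is at least
  \<open>\<bar>K\<bar> + 1\<close>; the terms below \<open>M\<close> cost at most
  \<open>(\<bar>K\<bar> + 1) * M\<close>, which is less than \<open>L\<close> for \<open>s\<close>
  close to 1.\<close>

lemma F_ser_principal_at_top:
  assumes "b > 0"
  shows "eventually (\<lambda>s. K \<le> Re (F_ser (principal_dchar b) s)) (at_right 1)"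
proof -
  define r where "r = (\<lambda>n. if coprime n b then 1 else (0::real))"
  have r: "principal_dchar b n = of_real (r n)" "0 \<le> r n" "r n \<le> 1" for n
    by (auto simp: principal_dchar_def r_def)
  define M where "M = nat \<lceil>exp (\<bar>K\<bar> + 1)\<rceil> + 1"
  have M: "\<bar>K\<bar> + 1 \<le> ln (real n)" if "n \<ge> M" for n
  proof -
    have "exp (\<bar>K\<bar> + 1) \<le> real n" using that unfolding M_def by linarith
    moreover have "0 < real n" using that by (simp add: M_def)
    ultimately show ?thesis by (simp add: ln_ge_iff)
  qed
  define T where "T = (\<bar>K\<bar> + 1) * real M + 1"
  obtain N where N: "T \<le> (\<Sum>n<N. if coprime n b then 1 / real n else 0)"
    using principal_sum_unbounded[OF assms] by metis
  define S where "S = (\<lambda>a s. \<Sum>n. a n * real n powr - s * r n)"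
  have sm: "summable (\<lambda>n. a n * real n powr - s * r n)" and S: "dser a (principal_dchar b) s = of_real (S a s)"
    if "s > 1" "\<And>n. \<bar>a n\<bar> \<le> 1 + ln (real n)" for a s
  proof -
    have eq: "(a n * real n powr - s) *\<^sub>R principal_dchar b n = of_real (a n * real n powr - s * r n)" for n
      by (simp add: r scaleR_conv_of_real)
    have "summable (\<lambda>n. norm ((a n * real n powr - s) *\<^sub>R principal_dchar b n))"
      using norm_dchar_le[OF principal_dchar_in assms] that(2,1) by (rule summable_dser)
    then have "summable (\<lambda>n. \<bar>a n * real n powr - s * r n\<bar>)"
      unfolding eq norm_of_real .
    then show sm: "summable (\<lambda>n. a n * real n powr - s * r n)" by (rule summable_rabs_cancel)
    show "dser a (principal_dchar b) s = of_real (S a s)"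
      unfolding dser_def eq S_def using sm by (rule suminf_of_real[symmetric])
  qed
  have "((\<lambda>s. \<Sum>n<N. 1 * real n powr - s * r n) \<longlongrightarrow> (\<Sum>n<N. 1 * real n powr - 1 * r n)) (at_right 1)"
  proof (intro tendsto_sum)
    show "((\<lambda>s. 1 * real n powr - s * r n) \<longlongrightarrow> 1 * real n powr - 1 * r n) (at_right 1)" for n
    proof (cases "n = 0")
      case False
      then show ?thesis by (intro tendsto_intros) auto
    qed simp
  qed
  moreover have "(\<Sum>n<N. 1 * real n powr - 1 * r n) = (\<Sum>n<N. if coprime n b then 1 / real n else 0)"
    by (intro sum.cong) (auto simp: r_def powr_minus divide_inverse)
  ultimately have "eventually (\<lambda>s. T - 1 < (\<Sum>n<N. 1 * real n powr - s * r n)) (at_right 1)"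
    using N by (intro order_tendstoD(1)) auto
  moreover have "eventually (\<lambda>s::real. 1 < s) (at_right 1)"
    by (simp add: eventually_at_right_less)
  ultimately show ?thesis
  proof eventually_elim
    case (elim s)
    have "(\<Sum>n<N. 1 * real n powr - s * r n) \<le> S (\<lambda>_. 1) s"
      unfolding S_def using sm[OF elim(2) dser_coeff_bounds(1)] r by (intro sum_le_suminf) auto
    with elim have L: "(\<bar>K\<bar> + 1) * real M < S (\<lambda>_. 1) s" by (simp add: T_def)
    then have Lpos: "S (\<lambda>_. 1) s > 0" by (intro le_less_trans[OF _ L]) auto
    have "(\<bar>K\<bar> + 1) * S (\<lambda>_. 1) s - S (\<lambda>n. ln (real n)) s
        = (\<Sum>n. (\<bar>K\<bar> + 1) * (1 * real n powr - s * r n) - ln (real n) * real n powr - s * r n)"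
      unfolding S_def using sm[OF elim(2) dser_coeff_bounds(1)] sm[OF elim(2) dser_coeff_bounds(2)]
      by (subst suminf_mult[symmetric]) (auto intro!: suminf_diff summable_mult)
    also have "\<dots> \<le> (\<Sum>n. if n < M then \<bar>K\<bar> + 1 else 0)"
    proof (rule suminf_le)
      show "(\<bar>K\<bar> + 1) * (1 * real n powr - s * r n) - ln (real n) * real n powr - s * r n
          \<le> (if n < M then \<bar>K\<bar> + 1 else 0)" for n
      proof (cases "n < M")
        case True
        have "real n powr - s \<le> 1"
        proof (cases "n = 0")
          case False
          then have "real n powr - s \<le> real n powr 0" using elim by (intro powr_mono) auto
          with False show ?thesis by simp
        qed simp
        then have "real n powr - s * r n \<le> 1 * 1" using r by (intro mult_mono) auto
        then have "(\<bar>K\<bar> + 1) * (1 * real n powr - s * r n) \<le> (\<bar>K\<bar> + 1) * 1"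
          by (intro mult_left_mono) auto
        moreover have "0 \<le> ln (real n) * real n powr - s * r n"
          using r by (simp add: ln_nat_nonneg)
        ultimately show ?thesis using True by simp
      next
        case False
        then have "(\<bar>K\<bar> + 1) * (real n powr - s * r n) \<le> ln (real n) * (real n powr - s * r n)"
          using M[of n] r by (intro mult_right_mono) auto
        with False show ?thesis by (simp add: mult.assoc)
      qed
      show "summable (\<lambda>n. (\<bar>K\<bar> + 1) * (1 * real n powr - s * r n) - ln (real n) * real n powr - s * r n)"
        using sm[OF elim(2) dser_coeff_bounds(1)] sm[OF elim(2) dser_coeff_bounds(2)]
        by (intro summable_diff summable_mult)
      show "summable (\<lambda>n. if n < M then \<bar>K\<bar> + 1 else 0)"
        by (rule summable_finite[of "{..<M}"]) auto
    qed
    also have "\<dots> = (\<Sum>n<M. \<bar>K\<bar> + 1)"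
      by (subst suminf_finite[of "{..<M}"]) auto
    also have "\<dots> = (\<bar>K\<bar> + 1) * real M" by simp
    also have "\<dots> < S (\<lambda>_. 1) s" by (rule L)
    finally have D: "\<bar>K\<bar> * S (\<lambda>_. 1) s < S (\<lambda>n. ln (real n)) s"
      by (simp add: algebra_simps)
    have "L_ser (principal_dchar b) s * F_ser (principal_dchar b) s = D_ser (principal_dchar b) s"
      using norm_dchar_le[OF principal_dchar_in assms] dchar_mult[OF principal_dchar_in] elim(2)
      by (rule L_ser_mult_F_ser)
    then have "(of_real (S (\<lambda>_. 1) s * S mangoldt s) :: complex) = of_real (S (\<lambda>n. ln (real n)) s)"
      using S[OF elim(2) dser_coeff_bounds(1)] S[OF elim(2) dser_coeff_bounds(2)] S[OF elim(2) dser_coeff_bounds(3)]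
      by simp
    then have "S (\<lambda>_. 1) s * S mangoldt s = S (\<lambda>n. ln (real n)) s"
      unfolding of_real_eq_iff .
    then have "\<bar>K\<bar> * S (\<lambda>_. 1) s < S mangoldt s * S (\<lambda>_. 1) s" using D by (simp add: mult.commute)
    then have "\<bar>K\<bar> < S mangoldt s" using Lpos by simp
    then show ?case using S[OF elim(2) dser_coeff_bounds(3)] by simp
  qed
qed

text \<open>Only the powers \<open>q ^ (k + 2)\<close> of primes contribute; the geometric series
  over \<open>k\<close> leaves at most \<open>2 * ln q / q ^ 2\<close> for each prime
  \<open>q\<close>.\<close>

lemma sum_mangoldt_nonprime_bounded:
  obtains C where "\<And>N. (\<Sum>n | n < N \<and> \<not> prime n. mangoldt n / real n) \<le> C"
proof
  fix N :: nat
  define A where "A = {n. n < N \<and> \<not> prime n \<and> primepow n}"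
  define Q where "Q = {q. prime q \<and> q < N}"
  have fin: "finite A" "finite Q" by (auto simp: A_def Q_def)
  have sub: "A \<subseteq> (\<lambda>(q, k). q ^ (k + 2)) ` (Q \<times> {..<N})"
  proof
    fix n assume n: "n \<in> A"
    then obtain q k where qk: "prime q" "k > 0" "n = q ^ k" by (auto simp: A_def primepow_def)
    have "k \<noteq> 1" using n qk by (auto simp: A_def)
    then obtain j where j: "k = j + 2" using qk(2) by (metis One_nat_def add_2_eq_Suc' gr0_implies_Suc not0_implies_Suc)
    have "q \<le> n" using qk(2) self_le_power[of q k] prime_gt_0_nat[OF qk(1)] unfolding qk(3) by simp
    moreover have "k < n" unfolding qk(3) using prime_gt_1_nat[OF qk(1)] by (intro power_gt_expt) simp
    moreover have "n < N" using n by (simp add: A_def)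
    ultimately have "(q, j) \<in> Q \<times> {..<N}" using qk(1) j by (simp add: Q_def)
    moreover have "n = (\<lambda>(q, k). q ^ (k + 2)) (q, j)" by (simp add: qk(3) j)
    ultimately show "n \<in> (\<lambda>(q, k). q ^ (k + 2)) ` (Q \<times> {..<N})" by (rule rev_image_eqI)
  qed
  have "(\<Sum>n | n < N \<and> \<not> prime n. mangoldt n / real n) = (\<Sum>n\<in>A. mangoldt n / real n)"
    by (intro sum.mono_neutral_right) (auto simp: A_def mangoldt_def)
  also have "\<dots> \<le> (\<Sum>n\<in>(\<lambda>(q, k). q ^ (k + 2)) ` (Q \<times> {..<N}). mangoldt n / real n)"
    using fin sub by (intro sum_mono2) (auto simp: mangoldt_nonneg)
  also have "\<dots> \<le> (\<Sum>(q, k)\<in>Q \<times> {..<N}. mangoldt (q ^ (k + 2)) / real (q ^ (k + 2)))"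
    using fin sum_image_le[of "Q \<times> {..<N}" "\<lambda>n. mangoldt n / real n" "\<lambda>(q, k). q ^ (k + 2)"]
    by (simp add: mangoldt_nonneg case_prod_unfold o_def)
  also have "\<dots> = (\<Sum>q\<in>Q. \<Sum>k<N. ln (real q) / real q ^ 2 * (1 / real q) ^ k)"
  proof (subst sum.cartesian_product[symmetric], intro sum.cong refl)
    fix q k assume "q \<in> Q"
    then have q: "prime q" "0 < real q" by (auto simp: Q_def prime_gt_0_nat)
    have "mangoldt (q ^ (k + 2)) = ln (real q)" using mangoldt_primepow'[OF q(1), of "k + 2", where ?'a = real] by simp
    then show "mangoldt (q ^ (k + 2)) / real (q ^ (k + 2)) = ln (real q) / real q ^ 2 * (1 / real q) ^ k"
      using q(2) by (simp add: power_add power_one_over field_simps power2_eq_square)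
  qed
  also have "\<dots> \<le> (\<Sum>q\<in>Q. 2 * (ln (real q) * real q powr - 2))"
  proof (rule sum_mono)
    fix q assume "q \<in> Q"
    then have q: "2 \<le> real q" by (auto simp: Q_def dest: prime_ge_2_nat)
    have "(\<Sum>k<N. (1 / real q) ^ k) \<le> (\<Sum>k. (1 / real q) ^ k)"
      using q by (intro sum_le_suminf summable_geometric) auto
    also have "\<dots> = 1 / (1 - 1 / real q)" using q by (intro suminf_geometric) auto
    also have "\<dots> \<le> 2" using q by (simp add: field_simps)
    finally have "ln (real q) / real q ^ 2 * (\<Sum>k<N. (1 / real q) ^ k) \<le> ln (real q) / real q ^ 2 * 2"
      using q by (intro mult_left_mono) auto
    then show "(\<Sum>k<N. ln (real q) / real q ^ 2 * (1 / real q) ^ k) \<le> 2 * (ln (real q) * real q powr - 2)"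
      using q by (simp add: sum_distrib_left powr_minus divide_inverse mult_ac)
  qed
  also have "\<dots> \<le> (\<Sum>q\<in>Q. 2 * ((1 + ln (real q)) * real q powr - 2))"
    by (intro sum_mono mult_left_mono mult_right_mono) auto
  also have "\<dots> \<le> (\<Sum>q. 2 * ((1 + ln (real q)) * real q powr - 2))"
    using fin by (intro sum_le_suminf summable_mult summable_ln_powr) (auto simp: ln_nat_nonneg)
  finally show "(\<Sum>n | n < N \<and> \<not> prime n. mangoldt n / real n) \<le> (\<Sum>q. 2 * ((1 + ln (real q)) * real q powr - 2))" .
qed

text \<open>In a class without primes the \<open>mangoldt\<close> series would stay bounded as
  \<open>s\<close> tends to 1. By orthogonality it is a combination of the
  \<open>F_ser \<phi>\<close>, of which only the principal one is unbounded.\<close>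

theorem Dirichlet_prime_cong:
  assumes "b > 0" "coprime h b"
  obtains q :: nat where "prime q" "[q = h] (mod b)"
proof (rule ccontr)
  assume "\<not> thesis"
  with that have none: "\<not> prime n" if "[n = h] (mod b)" for n using that by blast
  obtain C where C: "\<And>N. (\<Sum>n | n < N \<and> \<not> prime n. mangoldt n / real n) \<le> C"
    using sum_mangoldt_nonprime_bounded by metis
  let ?t = "\<lambda>s n. if [n = h] (mod b) then mangoldt n * real n powr - s else (0::real)"
  have upper: "suminf (?t s) \<le> C" if s: "s > 1" for s
  proof (rule suminf_le_const[OF F_ser_sum(2)[OF s assms]])
    fix N
    have "sum (?t s) {..<N} \<le> (\<Sum>n<N. if \<not> prime n then mangoldt n / real n else 0)"
    proof (rule sum_mono)
      fix n
      have "mangoldt n * real n powr - s \<le> mangoldt n / real n"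
      proof (cases "n = 0")
        case False
        then have "real n powr - s \<le> real n powr - 1" using s by (intro powr_mono) auto
        then have "mangoldt n * real n powr - s \<le> mangoldt n * (1 / real n)"
          using False by (intro mult_left_mono) (auto simp: powr_minus divide_inverse mangoldt_nonneg)
        then show ?thesis by simp
      qed simp
      then show "?t s n \<le> (if \<not> prime n then mangoldt n / real n else 0)"
        using none[of n] by (auto simp: mangoldt_nonneg)
    qed
    also have "\<dots> = (\<Sum>n | n < N \<and> \<not> prime n. mangoldt n / real n)"
      by (subst sum.inter_filter[symmetric]) (auto intro!: sum.cong)
    also have "\<dots> \<le> C" by (rule C)
    finally show "sum (?t s) {..<N} \<le> C" .
  qed
  define X where "X = dchars b - {principal_dchar b}"
  have finX: "finite (dchars b)" using assms(1) by (rule finite_dchars)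
  have "\<exists>K. eventually (\<lambda>s. norm (F_ser \<phi> s) \<le> K) (at_right 1)" if "\<phi> \<in> X" for \<phi>
    using F_ser_bounded[of \<phi> b] that assms(1) unfolding X_def by blast
  then obtain K where K: "\<And>\<phi>. \<phi> \<in> X \<Longrightarrow> eventually (\<lambda>s. norm (F_ser \<phi> s) \<le> K \<phi>) (at_right 1)"
    by metis
  have "eventually (\<lambda>s. \<forall>\<phi>\<in>X. norm (F_ser \<phi> s) \<le> K \<phi>) (at_right 1)"
    using K finX by (intro eventually_ball_finite) (auto simp: X_def)
  \<comment> \<open>One more than the class sum and all nonprincipal characters together can account
    for.\<close>
  moreover define B where "B = real (card (dchars b)) * C + (\<Sum>\<phi>\<in>X. K \<phi>) + 1"
  note F_ser_principal_at_top[OF assms(1), of B]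
  moreover have "eventually (\<lambda>s::real. 1 < s) (at_right 1)"
    by (simp add: eventually_at_right_less)
  ultimately have "eventually (\<lambda>s::real. False) (at_right 1)"
  proof eventually_elim
    case (elim s)
    define Z where "Z = (\<Sum>\<phi>\<in>X. cnj (\<phi> h) * F_ser \<phi> s)"
    have "norm Z \<le> (\<Sum>\<phi>\<in>X. K \<phi>)"
      unfolding Z_def
    proof (rule sum_norm_le)
      fix \<phi> assume "\<phi> \<in> X"
      then show "norm (cnj (\<phi> h) * F_ser \<phi> s) \<le> K \<phi>"
        using elim norm_dchar[of \<phi> b h] assms by (simp add: X_def norm_mult)
    qed
    then have Z: "- (\<Sum>\<phi>\<in>X. K \<phi>) \<le> Re Z" using abs_Re_le_cmod[of Z] by linarith
    have "(\<Sum>\<phi>\<in>dchars b. cnj (\<phi> h) * F_ser \<phi> s) = F_ser (principal_dchar b) s + Z"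
      unfolding Z_def X_def using finX principal_dchar_in[of b] assms(2)
      by (subst sum.remove[of _ "principal_dchar b"]) (auto simp: principal_dchar_def)
    then have "Re (F_ser (principal_dchar b) s) + Re Z = real (card (dchars b)) * suminf (?t s)"
      unfolding F_ser_sum(1)[OF elim(3) assms] by (metis Re_complex_of_real plus_complex.simps(1))
    moreover have "real (card (dchars b)) * suminf (?t s) \<le> real (card (dchars b)) * C"
      using upper[OF elim(3)] by (intro mult_left_mono) auto
    ultimately show ?case using Z elim(2) by (simp add: B_def)
  qed
  then show False by (simp add: trivial_limit_at_right_real eventually_False)
qed

section \<open>Chains of factorizations\<close>

text \<open>Its paths are the N-chains; in this form they can be concatenated, reversed and used for
  rule induction.\<close>

definition fact_step :: "nat set \<Rightarrow> nat \<Rightarrow> nat \<Rightarrow> (nat multiset \<times> nat multiset) set"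
  where "fact_step M x N = {(z, z'). z \<in> factorizations M x \<and> z' \<in> factorizations M x \<and> fact_dist z z' \<le> N}"

lemma fact_dist_commute: "fact_dist z z' = fact_dist z' z"
  by (simp add: fact_dist_def max.commute)

lemma fact_dist_add_right [simp]: "fact_dist (u + w) (v + w) = fact_dist u v"
  by (simp add: fact_dist_def)

lemma fact_dist_le: "fact_dist u v \<le> max (size u) (size v)"
  unfolding fact_dist_def by (intro max.mono size_mset_mono) auto

lemma fact_step_sym: "(z, z') \<in> (fact_step M x N)\<^sup>* \<Longrightarrow> (z', z) \<in> (fact_step M x N)\<^sup>*"
proof -
  have "sym (fact_step M x N)"
    by (auto simp: sym_def fact_step_def fact_dist_commute)
  then show "(z, z') \<in> (fact_step M x N)\<^sup>* \<Longrightarrow> (z', z) \<in> (fact_step M x N)\<^sup>*"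
    using sym_rtrancl by (metis symD)
qed

text \<open>The closure is reflexive on all multisets, also on those that are not factorizations of
  \<open>x\<close>, hence the separate assumption on \<open>z'\<close>.\<close>

lemma is_chain_if_rtrancl:
  assumes "(z, z') \<in> (fact_step M x N)\<^sup>*" "z' \<in> factorizations M x"
  shows "\<exists>zs. is_chain M x N z z' zs"
  using assms(1)
proof (induction rule: converse_rtrancl_induct)
  case base
  have "is_chain M x N z' z' [z']" using assms(2) by (simp add: is_chain_def)
  then show ?case by blast
next
  case (step y z)
  then obtain zs where zs: "is_chain M x N z z' zs" by blast
  have "is_chain M x N y z' (y # zs)"
    unfolding is_chain_def
  proof (intro conjI allI impI)
    fix i assume i: "Suc i < length (y # zs)"
    show "fact_dist ((y # zs) ! i) ((y # zs) ! Suc i) \<le> N"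
      using step.hyps(1) zs i by (cases i) (auto simp: is_chain_def fact_step_def hd_conv_nth)
  qed (use step.hyps(1) zs in \<open>auto simp: is_chain_def fact_step_def\<close>)
  then show ?case by blast
qed

lemma rtrancl_if_is_chain: "is_chain M x N z z' zs \<Longrightarrow> (z, z') \<in> (fact_step M x N)\<^sup>*"
proof (induction zs arbitrary: z)
  case (Cons y zs)
  then have y: "y = z" "z \<in> factorizations M x" by (auto simp: is_chain_def)
  show ?case
  proof (cases zs)
    case Nil
    then show ?thesis using Cons.prems by (auto simp: is_chain_def)
  next
    case (Cons v vs)
    have "is_chain M x N v z' zs"
      using Cons.prems Cons unfolding is_chain_def by auto
    then have "(v, z') \<in> (fact_step M x N)\<^sup>*" by (rule Cons.IH)
    moreover have "(z, v) \<in> fact_step M x N"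
      using Cons.prems Cons y by (auto simp: is_chain_def fact_step_def)
    ultimately show ?thesis by (rule converse_rtrancl_into_rtrancl[rotated])
  qed
qed (simp add: is_chain_def)

lemma catenary_degree_leI:
  assumes "\<And>x z z'. x \<in> M \<Longrightarrow> z \<in> factorizations M x \<Longrightarrow> z' \<in> factorizations M x \<Longrightarrow>
    (z, z') \<in> (fact_step M x N)\<^sup>*"
  shows "catenary_degree M \<le> enat N"
  unfolding catenary_degree_def catenary_degree_elem_def
  by (intro SUP_least Inf_lower) (use assms is_chain_if_rtrancl in blast)

text \<open>A chain from \<open>z\<close> to \<open>z'\<close> has to leave \<open>Q\<close> at some
  step, and every such step has length at least \<open>K\<close>.\<close>

lemma catenary_degree_geI:
  assumes x: "x \<in> M" and z: "z \<in> factorizations M x" "z' \<in> factorizations M x" and Q: "Q z" "\<not> Q z'"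
    and gap: "\<And>u v. u \<in> factorizations M x \<Longrightarrow> v \<in> factorizations M x \<Longrightarrow> Q u \<Longrightarrow> \<not> Q v \<Longrightarrow> K \<le> fact_dist u v"
  shows "enat K \<le> catenary_degree M"
proof -
  have "K \<le> N" if "(z, z') \<in> (fact_step M x N)\<^sup>*" for N
  proof (rule ccontr)
    assume "\<not> K \<le> N"
    have "Q z'"
      using that
    proof (induction rule: rtrancl_induct)
      case (step u v)
      with gap[of u v] \<open>\<not> K \<le> N\<close> show ?case by (auto simp: fact_step_def)
    qed (rule Q)
    with Q show False by simp
  qed
  then have "enat K \<le> catenary_degree_elem M x"
    unfolding catenary_degree_elem_def using z rtrancl_if_is_chain
    by (intro Inf_greatest) (force simp del: enat_ord_simps simp: enat_ord_simps(1))
  then show ?thesis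
    unfolding catenary_degree_def using x by (rule SUP_upper2[rotated])
qed

section \<open>The monoid through valuations at p and residues modulo b\<close>

locale local_acm =
  fixes p \<alpha> \<beta> b :: nat and M :: "nat set"
  assumes p: "prime p" and \<alpha>: "\<alpha> \<ge> 1" and b: "b > 0" and pb: "coprime p b"
    and mem_M: "\<And>x. x \<in> M \<longleftrightarrow> x = 1 \<or> x > 0 \<and> p ^ \<alpha> dvd x \<and> [x = 1] (mod b)"
    and \<beta>: "\<beta> > 0" "p ^ \<beta> \<in> M" and \<beta>_min: "\<And>n. n > 0 \<Longrightarrow> p ^ n \<in> M \<Longrightarrow> \<beta> \<le> n"
begin

abbreviation nu :: "nat \<Rightarrow> nat" where "nu \<equiv> multiplicity p"

abbreviation Z :: "nat \<Rightarrow> nat multiset set" where "Z \<equiv> factorizations M"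

lemma p_pos: "p > 0" and p_gt_1: "p > 1" and p_elem: "prime_elem p"
  using p prime_gt_0_nat prime_gt_1_nat by auto

lemma power_dvd_iff: "x > 0 \<Longrightarrow> p ^ k dvd x \<longleftrightarrow> k \<le> nu x"
  using p_gt_1 by (intro power_dvd_iff_le_multiplicity) auto

lemma nu_mult: "x > 0 \<Longrightarrow> y > 0 \<Longrightarrow> nu (x * y) = nu x + nu y"
  using p_elem by (intro prime_elem_multiplicity_mult_distrib) auto

lemma nu_power: "nu (p ^ k) = k"
  using p_elem by simp

text \<open>As \<alpha> is positive, the valuation condition by itself excludes 1.\<close>

lemma mem_iff: "x \<in> M - {1} \<longleftrightarrow> x > 0 \<and> \<alpha> \<le> nu x \<and> [x = 1] (mod b)"
proof (cases "x = 1")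
  case True
  then show ?thesis using \<alpha> by simp
next
  case False
  then show ?thesis using mem_M[of x] power_dvd_iff[of x \<alpha>] by auto
qed

lemma mem_nz: "x \<in> M \<Longrightarrow> x > 0"
  using mem_M by auto

lemma mult_mem: "x \<in> M - {1} \<Longrightarrow> y \<in> M - {1} \<Longrightarrow> x * y \<in> M - {1}"
  using cong_mult[of x 1 b y 1] unfolding mem_iff by (simp add: nu_mult)

lemma p\<beta>_mem: "p ^ \<beta> \<in> M - {1}"
  using \<beta> p_gt_1 by simp

lemma \<alpha>_le_\<beta>: "\<alpha> \<le> \<beta>" and p\<beta>_cong: "[p ^ \<beta> = 1] (mod b)"
  using p\<beta>_mem unfolding mem_iff nu_power by auto

lemma p_power_cong_ge: 
  assumes "\<alpha> \<le> n" "[p ^ n = 1] (mod b)"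
  shows "\<beta> \<le> n"
proof (rule \<beta>_min)
  show "p ^ n \<in> M" using mem_iff[of "p ^ n"] assms p_pos nu_power by auto
qed (use assms \<alpha> in simp)

lemma cong_cancel_left:
  assumes "[x = 1] (mod b)" "[x * y = 1] (mod b)"
  shows "[y = 1] (mod b)"
proof -
  have "[y * x = y * 1] (mod b)" using assms(1) by (rule cong_scalar_left)
  then have "[y = x * y] (mod b)" by (simp add: cong_sym_eq mult.commute)
  then show ?thesis using assms(2) by (rule cong_trans)
qed

lemma divide_p\<beta>:
  assumes "x \<in> M" "\<alpha> + \<beta> \<le> nu x"
  obtains y where "x = p ^ \<beta> * y" "y \<in> M - {1}" "nu y = nu x - \<beta>" "y < x"
proof -
  have x: "x \<in> M - {1}" using assms \<alpha> by (cases "x = 1") auto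
  note xp = x[unfolded mem_iff]
  have "p ^ \<beta> dvd x" using assms xp power_dvd_iff[of x \<beta>] by auto
  then obtain y where y: "x = p ^ \<beta> * y" by blast
  have ypos: "y > 0" using xp y by (auto intro: Nat.gr0I)
  have nu: "nu x = \<beta> + nu y" using y ypos p_pos by (simp add: nu_mult nu_power)
  have "y \<in> M - {1}"
    unfolding mem_iff using ypos nu assms xp y cong_cancel_left[OF p\<beta>_cong] by simp
  moreover have "1 < p ^ \<beta>" using p_gt_1 \<beta>(1) by (rule one_less_power)
  then have "y < x" using ypos y by simp
  ultimately show ?thesis by (intro that[OF y]) (use nu in simp_all)
qed

lemma atom_mem: "x \<in> atoms_of M \<Longrightarrow> x \<in> M - {1}"
  by (auto simp: atoms_of_def)

lemma atom_not_mult: "x \<in> atoms_of M \<Longrightarrow> y \<in> M - {1} \<Longrightarrow> z \<in> M - {1} \<Longrightarrow> x \<noteq> y * z"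
  by (auto simp: atoms_of_def)

lemma atom_props:
  assumes "x \<in> atoms_of M"
  shows "x > 0" "\<alpha> \<le> nu x" "[x = 1] (mod b)"
  using atom_mem[OF assms] unfolding mem_iff by auto

lemma atom_nu_less:
  assumes "x \<in> atoms_of M"
  shows "nu x < \<alpha> + \<beta>"
proof (rule ccontr)
  assume "\<not> nu x < \<alpha> + \<beta>"
  then obtain y where "x = p ^ \<beta> * y" "y \<in> M - {1}"
    using divide_p\<beta>[of x] atom_mem[OF assms] by auto
  then show False using atom_not_mult[OF assms p\<beta>_mem] by blast
qed

lemma atomI:
  assumes "x \<in> M - {1}" "nu x < 2 * \<alpha>"
  shows "x \<in> atoms_of M"
proof -
  have "x \<noteq> y * z" if "y \<in> M - {1}" "z \<in> M - {1}" for y z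
    using that assms nu_mult[of y z] unfolding mem_iff by auto
  then show ?thesis using assms(1) by (auto simp: atoms_of_def)
qed

text \<open>A factor of \<open>p ^ \<beta>\<close> in \<open>M - {1}\<close> is a power of
  \<open>p\<close>, so minimality of \<beta> leaves no factor \<open>p\<close> for the complementary
  one.\<close>

lemma p\<beta>_atom: "p ^ \<beta> \<in> atoms_of M"
proof -
  have "p ^ \<beta> \<noteq> y * z" if yz: "y \<in> M - {1}" "z \<in> M - {1}" for y z
  proof
    note yz' = yz[unfolded mem_iff]
    assume eq: "p ^ \<beta> = y * z"
    then obtain i where i: "y = p ^ i"
      using divides_primepow_nat[OF p, of y \<beta>] by auto
    have "nu y + nu z = \<beta>" using nu_mult[of y z] nu_power[of \<beta>] yz' eq by simp
    moreover have "\<beta> \<le> nu y"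
      using p_power_cong_ge[of i] yz' i by (simp add: nu_power)
    ultimately show False using yz' \<alpha> by simp
  qed
  then show ?thesis using p\<beta>_mem by (auto simp: atoms_of_def)
qed

lemma ZD: "z \<in> Z x \<Longrightarrow> set_mset z \<subseteq> atoms_of M" "z \<in> Z x \<Longrightarrow> prod_mset z = x"
  by (auto simp: factorizations_def)

lemma ZI: "set_mset z \<subseteq> atoms_of M \<Longrightarrow> prod_mset z = x \<Longrightarrow> z \<in> Z x"
  by (auto simp: factorizations_def)

lemma Z_add: "z \<in> Z x \<Longrightarrow> w \<in> Z y \<Longrightarrow> z + w \<in> Z (x * y)"
  by (auto simp: factorizations_def)

lemma Z_pair: "x \<in> atoms_of M \<Longrightarrow> y \<in> atoms_of M \<Longrightarrow> {#x, y#} \<in> Z (x * y)"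
  by (simp add: factorizations_def)

lemma Z_triple:
  "x \<in> atoms_of M \<Longrightarrow> y \<in> atoms_of M \<Longrightarrow> z \<in> atoms_of M \<Longrightarrow> {#x, y, z#} \<in> Z (x * (y * z))"
  by (simp add: factorizations_def)

lemma prod_atoms_pos: "set_mset z \<subseteq> atoms_of M \<Longrightarrow> prod_mset z > 0"
  by (induction z) (auto dest: atom_props(1))

lemma prod_atoms_mem: "set_mset z \<subseteq> atoms_of M \<Longrightarrow> z \<noteq> {#} \<Longrightarrow> prod_mset z \<in> M - {1}"
proof (induction z)
  case (add x z)
  then show ?case using mult_mem[OF atom_mem, of x "prod_mset z"] atom_mem[of x] by (cases "z = {#}") auto
qed simp

lemma Z_mem: "z \<in> Z x \<Longrightarrow> z \<noteq> {#} \<Longrightarrow> x \<in> M"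
  using prod_atoms_mem[of z] ZD[of z x] by auto

lemma nu_prod_atoms: "set_mset z \<subseteq> atoms_of M \<Longrightarrow> nu (prod_mset z) = (\<Sum>x\<in>#z. nu x)"
  using p_elem by (intro prime_elem_multiplicity_prod_mset_distrib) (auto dest: atom_props(1))

lemma size_le_nu_prod: "set_mset z \<subseteq> atoms_of M \<Longrightarrow> size z * \<alpha> \<le> nu (prod_mset z)"
  unfolding nu_prod_atoms by (induction z) (auto dest: atom_props(2))

lemma size_le:
  assumes "z \<in> Z x" "nu x < Suc k * \<alpha>"
  shows "size z \<le> k"
proof -
  have "size z * \<alpha> < Suc k * \<alpha>"
    using size_le_nu_prod[OF ZD(1)[OF assms(1)]] ZD(2)[OF assms(1)] assms(2) by simp
  then show ?thesis by (simp only: mult_less_cancel2 less_Suc_eq_le)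
qed

lemma factorization_atom:
  assumes "z \<in> Z x" "x \<in> atoms_of M"
  shows "z = {#x#}"
proof -
  have "z \<noteq> {#}" using assms ZD(2)[OF assms(1)] by (auto simp: atoms_of_def)
  then obtain a w where z: "z = add_mset a w" by (meson multiset_cases)
  have a: "a \<in> atoms_of M" "set_mset w \<subseteq> atoms_of M" "x = a * prod_mset w"
    using ZD[OF assms(1)] z by auto
  have "w = {#}"
    using atom_not_mult[OF assms(2) atom_mem[OF a(1)] prod_atoms_mem[OF a(2)]] a(3) by blast
  then show ?thesis using z a(3) by simp
qed

lemma factorization_exists: "x \<in> M \<Longrightarrow> \<exists>z. z \<in> Z x"
proof (induction x rule: less_induct)
  case (less x)
  consider "x = 1" | "x \<in> atoms_of M" | "x \<noteq> 1" "x \<notin> atoms_of M" by blast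
  then show ?case
  proof cases
    case 1
    then show ?thesis by (intro exI[of _ "{#}"] ZI) auto
  next
    case 2
    then show ?thesis by (intro exI[of _ "{#x#}"] ZI) auto
  next
    case 3
    then obtain y z where yz: "y \<in> M - {1}" "z \<in> M - {1}" "x = y * z"
      using less.prems by (auto simp: atoms_of_def)
    have "y > 0" "z > 0" using yz(1,2) mem_nz by auto
    then have "y > 1" "z > 1" using yz(1,2) by auto
    then have "y < x" "z < x" using yz(3) by auto
    with less.IH yz obtain u v where "u \<in> Z y" "v \<in> Z z" by blast
    then show ?thesis using Z_add yz(3) by blast
  qed
qed

text \<open>After cancelling the common part both remainders have the same product. If one is empty
  or a single atom, then so is the other, and they coincide.\<close>

lemma distinct_factorizations_diff:
  assumes "z \<in> Z x" "z' \<in> Z x" "z \<noteq> z'"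
  shows "2 \<le> size (z - z')"
proof (rule ccontr)
  assume "\<not> 2 \<le> size (z - z')"
  define u v where "u = z - z'" and "v = z' - z"
  have atoms: "set_mset u \<subseteq> atoms_of M" "set_mset v \<subseteq> atoms_of M"
    using ZD(1)[OF assms(1)] ZD(1)[OF assms(2)] by (auto simp: u_def v_def dest: in_diffD)
  have inter: "set_mset (z \<inter># z') \<subseteq> atoms_of M" using ZD(1)[OF assms(1)] by auto
  have z: "z = u + z \<inter># z'" "z' = v + z \<inter># z'"
    unfolding u_def v_def by (auto simp: multiset_eq_iff min_def)
  have "prod_mset u * prod_mset (z \<inter># z') = x" "prod_mset v * prod_mset (z \<inter># z') = x"
    using ZD(2)[OF assms(1)] ZD(2)[OF assms(2)] z by (metis prod_mset_Un)+
  then have eq: "prod_mset v = prod_mset u"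
    using prod_atoms_pos[OF inter] by (metis mult_right_cancel not_gr_zero)
  have disj: "u \<inter># v = {#}" unfolding u_def v_def by (auto simp: multiset_eq_iff min_def)
  consider "size u = 0" | "size u = 1" using \<open>\<not> 2 \<le> size (z - z')\<close> unfolding u_def by linarith
  then show False
  proof cases
    case 1
    then have "prod_mset v = 1" using eq by simp
    then have "v = {#}" using prod_atoms_mem[OF atoms(2)] by auto
    then show False using 1 z assms(3) by (metis size_eq_0_iff_empty)
  next
    case 2
    then obtain a where a: "u = {#a#}" using size_1_singleton_mset by blast
    then have "v \<in> Z a" "a \<in> atoms_of M" using eq atoms by (auto intro: ZI)
    then have "v = {#a#}" by (rule factorization_atom)
    then show False using disj a by simp
  qed
qed

lemma fact_dist_ge_2:
  "z \<in> Z x \<Longrightarrow> z' \<in> Z x \<Longrightarrow> z \<noteq> z' \<Longrightarrow> 2 \<le> fact_dist z z'"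
  using distinct_factorizations_diff[of z x z'] by (simp add: fact_dist_def)

text \<open>Both remainders have at least 2 atoms and their sizes differ, so the larger has at least
  3.\<close>

lemma fact_dist_ge_3:
  assumes "z \<in> Z x" "z' \<in> Z x" "size z \<noteq> size z'"
  shows "3 \<le> fact_dist z z'"
proof -
  have "size z = size (z - z') + size (z \<inter># z')" "size z' = size (z' - z) + size (z \<inter># z')"
    by (metis diff_intersect_left_idem inter_mset_def size_Diff_submset subset_mset.inf_le1 subset_mset.inf_le2
        le_add_diff_inverse2 size_mset_mono inf.commute subset_mset.inf_commute)+
  then have "size (z - z') \<noteq> size (z' - z)" using assms(3) by linarith
  moreover have "2 \<le> size (z - z')" "2 \<le> size (z' - z)"
    using assms by (auto intro!: distinct_factorizations_diff)
  ultimately show ?thesis by (simp add: fact_dist_def)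
qed

lemma catenary_degree_ge_3:
  assumes "z \<in> Z x" "z' \<in> Z x" "size z \<noteq> size z'" "x \<in> M"
  shows "3 \<le> catenary_degree M"
proof -
  have "enat 3 \<le> catenary_degree M"
    by (rule catenary_degree_geI[OF assms(4,1,2), of "\<lambda>u. size u = size z"])
       (use assms(3) fact_dist_ge_3 in auto)
  then show ?thesis by (simp add: numeral_eq_enat)
qed

end

section \<open>The catenary degree\<close>

context local_acm
begin

text \<open>A sub-multiset of minimal size carrying at least \<open>\<alpha> + \<beta>\<close> factors \<open>p\<close> is traded for
  \<open>p ^ \<beta>\<close> and a factorization of the remaining cofactor, which is short.\<close>

lemma factorization_extract_p\<beta>:
  assumes z: "z \<in> Z x" and x: "\<alpha> + \<beta> \<le> nu x" "x = p ^ \<beta> * x'"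
    and m: "\<beta> \<le> m * \<alpha>" and N: "m + 1 \<le> N" "3 \<le> N \<or> \<alpha> = 1 \<and> \<beta> = 1"
  obtains w where "w \<in> Z x'" "(z, add_mset (p ^ \<beta>) w) \<in> (fact_step M x N)\<^sup>*"
proof -
  let ?P = "\<lambda>T. T \<subseteq># z \<and> \<alpha> + \<beta> \<le> (\<Sum>y\<in>#T. nu y)"
  have "?P z" using x ZD[OF z] nu_prod_atoms[of z] by simp
  then obtain T where T: "?P T" and Tmin: "\<And>S. ?P S \<Longrightarrow> size T \<le> size S"
    using ex_has_least_nat[of ?P z size] by auto
  have zT: "z = T + (z - T)" using T by simp
  have Ta: "set_mset T \<subseteq> atoms_of M" and za: "set_mset (z - T) \<subseteq> atoms_of M"
    using ZD(1)[OF z] T by (auto dest: in_diffD mset_subset_eqD)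
  have "T \<noteq> {#}" using T \<alpha> by auto
  then obtain t S where S: "T = add_mset t S" by (meson multiset_cases)
  have "\<not> ?P S" using Tmin[of S] S by auto
  then have sumS: "(\<Sum>y\<in>#S. nu y) < \<alpha> + \<beta>"
    using T S by (auto dest: mset_subset_eq_insertD)
  have Sa: "set_mset S \<subseteq> atoms_of M" and ta: "t \<in> atoms_of M" using Ta S by auto
  have "size S * \<alpha> < Suc m * \<alpha>"
    using size_le_nu_prod[OF Sa] nu_prod_atoms[OF Sa] sumS m by simp
  then have "size S < Suc m" by (simp only: mult_less_cancel2)
  then have sizeT: "size T \<le> m + 1" using S by simp
  have nuT: "nu (prod_mset T) = (\<Sum>y\<in>#T. nu y)" by (rule nu_prod_atoms[OF Ta])
  obtain y where y: "prod_mset T = p ^ \<beta> * y" "y \<in> M - {1}" "nu y = nu (prod_mset T) - \<beta>"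
    using divide_p\<beta>[of "prod_mset T"] prod_atoms_mem[OF Ta \<open>T \<noteq> {#}\<close>] T nuT by auto
  \<comment> \<open>Both the atom \<open>t\<close> and the rest \<open>S\<close> carry at most
    \<open>\<alpha> + \<beta> - 1\<close> factors \<open>p\<close>, and \<open>p ^ \<beta>\<close>
    takes away \<beta> of their sum.\<close>
  have nuy: "nu y + 2 \<le> 2 * \<alpha> + \<beta>"
  proof -
    have "(\<Sum>y\<in>#T. nu y) = nu t + (\<Sum>y\<in>#S. nu y)" using S by simp
    then show ?thesis
      using y(3) nuT sumS atom_nu_less[OF ta] T[THEN conjunct2] by linarith
  qed
  \<comment> \<open>Either \<open>y\<close> has too few factors \<open>p\<close> for more than
    \<open>m\<close> atoms, or a second \<open>p ^ \<beta>\<close> splits off and leaves an atom.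
    The latter needs 3 atoms in place of \<open>T\<close>, and cannot occur for \<alpha> = \<beta> =
    1 by \<open>nuy\<close>.\<close>
  obtain v where v: "v \<in> Z y" "size v + 1 \<le> N"
  proof (cases "nu y < \<alpha> + \<beta>")
    case True
    obtain v where "v \<in> Z y" using factorization_exists y(2) by blast
    moreover have "size v \<le> m" using size_le[OF \<open>v \<in> Z y\<close>, of m] True m by simp
    ultimately show ?thesis using that N by simp
  next
    case False
    then obtain y' where y': "y = p ^ \<beta> * y'" "y' \<in> M - {1}" "nu y' = nu y - \<beta>"
      using divide_p\<beta>[of y] y(2) by auto
    have "nu y' < 2 * \<alpha>" using y'(3) nuy False by simp
    then have "y' \<in> atoms_of M" by (rule atomI[OF y'(2)])
    then have "{#p ^ \<beta>, y'#} \<in> Z y" using p\<beta>_atom y'(1) by (intro ZI) auto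
    moreover have "3 \<le> N" using N(2) nuy False by auto
    ultimately show ?thesis using that[of "{#p ^ \<beta>, y'#}"] by simp
  qed
  define w where "w = v + (z - T)"
  have "prod_mset z = prod_mset T * prod_mset (z - T)" using zT by (metis prod_mset_Un)
  then have "x = p ^ \<beta> * (y * prod_mset (z - T))"
    using ZD(2)[OF z] y(1) by (simp add: mult_ac)
  then have x': "x' = y * prod_mset (z - T)" using x(2) p_pos by simp
  have w: "w \<in> Z x'"
    unfolding w_def x' by (rule Z_add[OF v(1) ZI[OF za refl]])
  have "add_mset (p ^ \<beta>) w \<in> Z x"
    using w p\<beta>_atom x(2) by (auto simp: factorizations_def)
  moreover have "fact_dist z (add_mset (p ^ \<beta>) w) \<le> N"
  proof -
    have "fact_dist z (add_mset (p ^ \<beta>) w) = fact_dist T (add_mset (p ^ \<beta>) v)"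
      using fact_dist_add_right[of T "z - T" "add_mset (p ^ \<beta>) v"] zT by (simp add: w_def)
    also have "\<dots> \<le> max (size T) (size (add_mset (p ^ \<beta>) v))" by (rule fact_dist_le)
    finally show ?thesis using sizeT v(2) N(1) by simp
  qed
  ultimately have "(z, add_mset (p ^ \<beta>) w) \<in> fact_step M x N" using z by (simp add: fact_step_def)
  then show ?thesis using that[OF w] by blast
qed

lemma fact_steps_add_p\<beta>:
  assumes "(w, w') \<in> (fact_step M x N)\<^sup>*"
  shows "(add_mset (p ^ \<beta>) w, add_mset (p ^ \<beta>) w') \<in> (fact_step M (p ^ \<beta> * x) N)\<^sup>*"
  using assms
proof (induction rule: rtrancl_induct)
  case (step u v)
  have "(add_mset (p ^ \<beta>) u, add_mset (p ^ \<beta>) v) \<in> fact_step M (p ^ \<beta> * x) N"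
    using step.hyps(2) p\<beta>_atom by (auto simp: fact_step_def factorizations_def fact_dist_def)
  with step.IH show ?case by (rule rtrancl_into_rtrancl)
qed simp

lemma fact_steps_connected:
  assumes m: "\<beta> \<le> m * \<alpha>" and N: "m + 1 \<le> N" "3 \<le> N \<or> \<alpha> = 1 \<and> \<beta> = 1"
  shows "x \<in> M \<Longrightarrow> z \<in> Z x \<Longrightarrow> z' \<in> Z x \<Longrightarrow> (z, z') \<in> (fact_step M x N)\<^sup>*"
proof (induction x arbitrary: z z' rule: less_induct)
  case (less x)
  show ?case
  proof (cases "nu x < \<alpha> + \<beta>")
    case True
    \<comment> \<open>Here every factorization has at most \<open>m\<close> atoms, so any two are
      one step apart.\<close>
    then have "nu x < Suc m * \<alpha>" using m by simp
    then have "size z \<le> m" "size z' \<le> m" using less.prems by (auto intro: size_le)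
    then have "fact_dist z z' \<le> N" using fact_dist_le[of z z'] N by linarith
    then show ?thesis using less.prems by (auto simp: fact_step_def)
  next
    case False
    then obtain y where y: "x = p ^ \<beta> * y" "y \<in> M - {1}" "y < x"
      using divide_p\<beta>[OF less.prems(1)] by auto
    have nux: "\<alpha> + \<beta> \<le> nu x" using False by simp
    obtain w where w: "w \<in> Z y" "(z, add_mset (p ^ \<beta>) w) \<in> (fact_step M x N)\<^sup>*"
      using factorization_extract_p\<beta>[OF less.prems(2) nux y(1) m N] .
    obtain w' where w': "w' \<in> Z y" "(z', add_mset (p ^ \<beta>) w') \<in> (fact_step M x N)\<^sup>*"
      using factorization_extract_p\<beta>[OF less.prems(3) nux y(1) m N] .
    have "(w, w') \<in> (fact_step M y N)\<^sup>*"
      using less.IH[of y w w'] y w(1) w'(1) by simp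
    then have "(add_mset (p ^ \<beta>) w, add_mset (p ^ \<beta>) w') \<in> (fact_step M x N)\<^sup>*"
      unfolding y(1) by (rule fact_steps_add_p\<beta>)
    with w(2) fact_step_sym[OF w'(2)] show ?thesis by (meson rtrancl_trans)
  qed
qed

lemma catenary_degree_le:
  assumes "\<beta> \<le> m * \<alpha>" "m + 1 \<le> N" "3 \<le> N \<or> \<alpha> = 1 \<and> \<beta> = 1"
  shows "catenary_degree M \<le> enat N"
  using fact_steps_connected[OF assms] by (rule catenary_degree_leI)

section \<open>Lower bounds for the catenary degree\<close>

lemma cofactor_exists:
  obtains u where "u > 0" "\<not> p dvd u" "[p ^ k * u = 1] (mod b)"
proof -
  have "coprime (p ^ k) b" using pb by simp
  then obtain u0 where u0: "[p ^ k * u0 = 1] (mod b)"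
    using cong_solve_coprime_nat[of "p ^ k" b] by auto
  \<comment> \<open>The residue 1 modulo \<open>p\<close> keeps \<open>p\<close> out of
    \<open>u\<close>, so that \<open>p ^ k * u\<close> has valuation exactly
    \<open>k\<close>.\<close>
  obtain u where u: "[u = u0] (mod b)" "[u = 1] (mod p)"
    using binary_chinese_remainder_nat[of b p u0 1] pb by (auto simp: coprime_commute)
  have "\<not> p dvd u"
    using cong_dvd_iff[OF u(2)] p_gt_1 by auto
  moreover have "[p ^ k * u = 1] (mod b)"
    using cong_trans[OF cong_scalar_left[OF u(1)] u0] .
  ultimately show ?thesis using that[of u] by (cases "u = 0") auto
qed

lemma nu_power_times: "u > 0 \<Longrightarrow> \<not> p dvd u \<Longrightarrow> nu (p ^ k * u) = k"
  using p_pos by (simp add: nu_mult nu_power not_dvd_imp_multiplicity_0)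

lemma power_times_atom:
  assumes "u > 0" "\<not> p dvd u" "[p ^ k * u = 1] (mod b)" "\<alpha> \<le> k" "k < 2 * \<alpha>"
  shows "p ^ k * u \<in> atoms_of M"
proof (rule atomI)
  show "p ^ k * u \<in> M - {1}"
    unfolding mem_iff using assms nu_power_times[OF assms(1,2)] p_pos by simp
qed (use assms nu_power_times[OF assms(1,2)] in simp)

lemma catenary_degree_ge_2:
  assumes "\<alpha> = 1" "\<beta> = 1"
  shows "2 \<le> catenary_degree M"
proof -
  \<comment> \<open>A number other than 1 with residue 1 modulo both \<open>b\<close> and
    \<open>p\<close>; then \<open>(p * u) * (p * u) = p * (p * u ^ 2)\<close> are two
    factorizations.\<close>
  define u where "u = 1 + b * p"
  have pc: "[p = 1] (mod b)" using p\<beta>_cong assms by simp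
  have uc: "[u ^ k = 1] (mod b)" for k
    using cong_pow[of u 1 b k] cong_add[OF cong_refl[of 1 b] cong_mult_self_left[of b p]] by (simp add: u_def)
  have atom: "p * u ^ k \<in> atoms_of M" for k
  proof -
    have "\<not> p dvd u" unfolding u_def using p_gt_1
      by (metis dvd_add_left_iff dvd_triv_right nat_dvd_1_iff_1 nat_neq_iff)
    then have "\<not> p dvd u ^ k" using p prime_dvd_power by blast
    then show ?thesis
      using power_times_atom[of "u ^ k" 1] assms cong_mult[OF pc uc[of k]] by (simp add: u_def)
  qed
  have "{#p * u, p * u#} \<in> Z (p * p * u ^ 2)" "{#p, p * u ^ 2#} \<in> Z (p * p * u ^ 2)"
    using atom[of 0] atom[of 1] atom[of 2] by (auto intro!: ZI simp: power2_eq_square)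
  note Z = this
  have "u \<noteq> 1" using b p_pos by (simp add: u_def)
  have ne: "{#p * u, p * u#} \<noteq> {#p, p * u ^ 2#}"
  proof
    assume "{#p * u, p * u#} = {#p, p * u ^ 2#}"
    then have "p \<in># {#p * u, p * u#}" by simp
    then show False using \<open>u \<noteq> 1\<close> p_pos by auto
  qed
  have "enat 2 \<le> catenary_degree M"
  proof (rule catenary_degree_geI[OF _ Z, of "\<lambda>z. z = {#p * u, p * u#}"])
    show "p * p * u ^ 2 \<in> M"
      using Z(1) by (rule Z_mem) simp
  qed (use ne fact_dist_ge_2 in auto)
  then show ?thesis by (simp add: numeral_eq_enat)
qed

text \<open>Two atoms against three: 3 \<alpha> is split as (2 \<alpha> - 1) + (\<alpha> + 1) and as
  \<alpha> + \<alpha> + \<alpha>. Valuations from \<alpha> up to 2 \<alpha> - 1 guarantee atoms, and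
  \<alpha> + 1 lies in that range because \<alpha> > 1.\<close>

lemma catenary_degree_ge_3_equal:
  assumes "\<alpha> = \<beta>" "\<alpha> > 1"
  shows "3 \<le> catenary_degree M"
proof -
  obtain u where u: "u > 0" "\<not> p dvd u" "[p ^ (2 * \<alpha> - 1) * u = 1] (mod b)"
    using cofactor_exists by metis
  obtain v where v: "v > 0" "\<not> p dvd v" "[p ^ (\<alpha> + 1) * v = 1] (mod b)"
    using cofactor_exists by metis
  let ?x = "p ^ (2 * \<alpha> - 1) * u" and ?y = "p ^ (\<alpha> + 1) * v"
  have xy: "?x \<in> atoms_of M" "?y \<in> atoms_of M"
    using power_times_atom[OF u] power_times_atom[OF v] assms by auto
  have prod: "?x * ?y = p ^ \<beta> * (p ^ \<beta> * (p ^ \<alpha> * (u * v)))"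
  proof -
    have "p ^ (2 * \<alpha> - 1) * p ^ (\<alpha> + 1) = p ^ \<beta> * p ^ \<beta> * p ^ \<alpha>"
      unfolding power_add[symmetric] by (rule arg_cong[of _ _ "power p"]) (use assms in simp)
    moreover have "?x * ?y = p ^ (2 * \<alpha> - 1) * p ^ (\<alpha> + 1) * (u * v)"
      by (simp only: mult_ac)
    ultimately show ?thesis by (simp only: mult_ac)
  qed
  have "[p ^ \<beta> * (p ^ \<beta> * (p ^ \<alpha> * (u * v))) = 1] (mod b)"
    using cong_mult[OF u(3) v(3)] unfolding prod by simp
  then have "[p ^ \<alpha> * (u * v) = 1] (mod b)"
    by (rule cong_cancel_left[OF p\<beta>_cong cong_cancel_left[OF p\<beta>_cong]])
  then have "p ^ \<alpha> * (u * v) \<in> atoms_of M"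
    using u v p assms by (intro power_times_atom) (auto simp: prime_dvd_mult_iff)
  then have Z: "{#?x, ?y#} \<in> Z (?x * ?y)" "{#p ^ \<beta>, p ^ \<beta>, p ^ \<alpha> * (u * v)#} \<in> Z (?x * ?y)"
    using Z_pair[OF xy] Z_triple[OF p\<beta>_atom p\<beta>_atom] unfolding prod by blast+
  show ?thesis
    by (rule catenary_degree_ge_3[OF Z]) (use mult_mem[OF atom_mem[OF xy(1)] atom_mem[OF xy(2)]] in auto)
qed

text \<open>Three atoms against two: 3 \<alpha> = \<beta> + (3 \<alpha> - \<beta>), where \<alpha> <
  \<beta> \<le> 2 \<alpha> puts 3 \<alpha> - \<beta> between \<alpha> and 2 \<alpha> - 1.\<close>

lemma catenary_degree_ge_3_less:
  assumes "\<alpha> < \<beta>" "\<beta> \<le> 2 * \<alpha>"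
  shows "3 \<le> catenary_degree M"
proof -
  obtain u where u: "u > 0" "\<not> p dvd u" "[p ^ \<alpha> * u = 1] (mod b)"
    using cofactor_exists by metis
  let ?x = "p ^ \<alpha> * u" and ?y = "p ^ (3 * \<alpha> - \<beta>) * (u * (u * u))"
  have x: "?x \<in> atoms_of M"
    using u \<alpha> by (auto intro!: power_times_atom)
  have prod: "?x * (?x * ?x) = p ^ \<beta> * ?y"
  proof -
    have "p ^ \<beta> * p ^ (3 * \<alpha> - \<beta>) = p ^ \<alpha> * p ^ \<alpha> * p ^ \<alpha>"
      unfolding power_add[symmetric] by (rule arg_cong[of _ _ "power p"]) (use assms in simp)
    then show ?thesis by (simp add: mult_ac)
  qed
  have "[p ^ \<beta> * ?y = 1] (mod b)"
    using cong_mult[OF u(3) cong_mult[OF u(3) u(3)]] unfolding prod by simp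
  then have "[?y = 1] (mod b)"
    by (rule cong_cancel_left[OF p\<beta>_cong])
  then have y: "?y \<in> atoms_of M"
    using u p assms by (intro power_times_atom) (auto simp: prime_dvd_mult_iff)
  have Z: "{#?x, ?x, ?x#} \<in> Z (p ^ \<beta> * ?y)" "{#p ^ \<beta>, ?y#} \<in> Z (p ^ \<beta> * ?y)"
    using Z_triple[OF x x x] Z_pair[OF p\<beta>_atom y] unfolding prod by blast+
  show ?thesis
    by (rule catenary_degree_ge_3[OF Z]) (use mult_mem[OF p\<beta>_mem atom_mem[OF y]] in auto)
qed

text \<open>For a prime \<open>q \<equiv> p\<^sup>-\<^sup>\<alpha>\<close> the element \<open>(p\<^sup>\<alpha> q) ^ (m + 1)\<close> has exactly two factorizations:
  \<open>m + 1\<close> copies of \<open>p\<^sup>\<alpha> q\<close>, and the one of length 2 that contains \<open>p\<^sup>\<beta>\<close>.\<close>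

lemma catenary_degree_ge_large:
  assumes \<beta>2: "2 * \<alpha> < \<beta>" and m: "\<beta> \<le> m * \<alpha>" "m * \<alpha> < \<beta> + \<alpha>"
  shows "enat (m + 1) \<le> catenary_degree M"
proof -
  \<comment> \<open>The definition of \<beta> says nothing about exponents \<open>i\<close> below
    \<alpha>. Such an \<open>i\<close> would make \<open>\<beta> - i\<close> an admissible exponent,
    still at least \<alpha> as \<beta> > 2 \<alpha>, but smaller than \<beta>.\<close>
  have no_small: "i = 0 \<or> \<beta> \<le> i" if "[p ^ i = 1] (mod b)" for i
  proof (rule ccontr)
    assume *: "\<not> (i = 0 \<or> \<beta> \<le> i)"
    then have "\<alpha> > i" using p_power_cong_ge[OF _ that] by force
    have "p ^ \<beta> = p ^ i * p ^ (\<beta> - i)" using * by (simp flip: power_add)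
    then have "[p ^ (\<beta> - i) = 1] (mod b)"
      using cong_cancel_left[OF that, of "p ^ (\<beta> - i)"] p\<beta>_cong by simp
    then have "\<beta> \<le> \<beta> - i" using \<open>\<alpha> > i\<close> \<beta>2 by (intro p_power_cong_ge) auto
    then show False using * by linarith
  qed
  obtain u where u: "u > 0" "\<not> p dvd u" "[p ^ \<alpha> * u = 1] (mod b)"
    using cofactor_exists by metis
  have "coprime (p ^ \<alpha> * u) b" using cong_coprime_left[OF u(3)] by simp
  then have "coprime u b" by simp
  then obtain q where q: "prime q" "[q = u] (mod b)"
    using Dirichlet_prime_cong[OF b] by blast
  have qc: "[p ^ \<alpha> * q = 1] (mod b)"
    using cong_trans[OF cong_scalar_left[OF q(2)] u(3)] .
  have "q \<noteq> p"
  proof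
    assume "q = p"
    then have "[p ^ (\<alpha> + 1) = 1] (mod b)" using qc by (simp add: mult.commute)
    then show False using no_small[of "\<alpha> + 1"] \<beta>2 \<alpha> by simp
  qed
  then have pq: "\<not> p dvd q" and "\<not> q dvd p" using p q primes_dvd_imp_eq by auto
  have pqk: "\<not> p dvd q ^ k" for k using pq p prime_dvd_power by blast
  have q0: "q > 0" using q prime_gt_0_nat by simp
  have q_elem: "prime_elem q" using q by simp
  have nus: "nu (p ^ i * q ^ j) = i" "multiplicity q (p ^ i * q ^ j) = j" for i j
  proof -
    show "nu (p ^ i * q ^ j) = i" using q0 pqk by (intro nu_power_times) simp_all
    have "\<not> q dvd p ^ i" using \<open>\<not> q dvd p\<close> q(1) prime_dvd_power by blast
    then show "multiplicity q (p ^ i * q ^ j) = j"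
      using multiplicity_prime_elem_times_other[OF q_elem, of "p ^ i" "q ^ j"] q_elem by simp
  qed
  let ?a = "p ^ \<alpha> * q"
  have a: "?a \<in> atoms_of M"
    using pq q0 qc \<alpha> by (intro power_times_atom) auto
  have akc: "[p ^ (k * \<alpha>) * q ^ k = 1] (mod b)" for k
    using cong_pow[OF qc, of k] by (simp add: power_mult_distrib flip: power_mult) (simp add: mult.commute)
  have ak_mem: "p ^ (k * \<alpha>) * q ^ k \<in> M - {1}" if "k > 0" for k
    unfolding mem_iff using that akc[of k] q0 p_pos pq p
    by (auto simp: nu_power_times prime_dvd_power_iff dest: prime_dvd_power)
  define x where "x = p ^ ((m + 1) * \<alpha>) * q ^ (m + 1)"
  have nux: "nu x = (m + 1) * \<alpha>" "multiplicity q x = m + 1"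
    unfolding x_def by (rule nus)+
  define z0 where "z0 = replicate_mset (m + 1) ?a"
  let ?y = "p ^ ((m + 1) * \<alpha> - \<beta>) * q ^ (m + 1)"
  have "p ^ \<beta> * p ^ ((m + 1) * \<alpha> - \<beta>) = p ^ ((m + 1) * \<alpha>)"
    unfolding power_add[symmetric] using m by simp
  then have x_eq: "x = p ^ \<beta> * ?y" by (simp add: x_def mult.assoc[symmetric])
  have "[?y = 1] (mod b)"
  proof (rule cong_cancel_left[OF p\<beta>_cong])
    show "[p ^ \<beta> * ?y = 1] (mod b)"
      using akc[of "m + 1"] unfolding x_def[symmetric] x_eq .
  qed
  \<comment> \<open>The two bounds on \<open>m\<close> say precisely that the valuation
    \<open>(m + 1) * \<alpha> - \<beta>\<close> lies between \<alpha> and 2 \<alpha> - 1.\<close>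
  then have y: "?y \<in> atoms_of M"
    using m q0 pqk[of "m + 1"] by (intro power_times_atom) simp_all
  have z0: "z0 \<in> Z x"
  proof (rule ZI)
    show "prod_mset z0 = x"
      unfolding z0_def x_def prod_mset_replicate_mset power_mult_distrib power_mult[symmetric]
      by (simp only: mult.commute)
  qed (use a in \<open>simp add: z0_def\<close>)
  have z1: "{#p ^ \<beta>, ?y#} \<in> Z x"
    using p\<beta>_atom y x_eq by (intro ZI) auto
  have uniq0: "z = z0" if z: "z \<in> Z x" and no: "p ^ \<beta> \<notin># z" for z
  proof -
    have form: "\<exists>i j. y = p ^ i * q ^ j" if "y \<in># z" for y
    proof -
      have "y dvd p ^ ((m + 1) * \<alpha>) * q ^ (m + 1)"
        using dvd_prod_mset[OF that] ZD(2)[OF z] by (simp add: x_def)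
      then obtain c d where cd: "y = c * d" "c dvd p ^ ((m + 1) * \<alpha>)" "d dvd q ^ (m + 1)"
        using division_decomp by blast
      then show ?thesis
        using divides_primepow_nat[OF p, of c] divides_primepow_nat[OF q(1), of d] by blast
    qed
    \<comment> \<open>An atom with more than \<alpha> factors \<open>p\<close> per factor
      \<open>q\<close> has a surplus of at least \<beta>. As atoms carry fewer than \<alpha> +
      \<beta> factors \<open>p\<close>, it contains no \<open>q\<close> and is the excluded
      \<open>p ^ \<beta>\<close>.\<close>
    have le: "nu y \<le> \<alpha> * multiplicity q y" if yz: "y \<in># z" for y
    proof (rule ccontr)
      assume gt: "\<not> nu y \<le> \<alpha> * multiplicity q y"
      obtain i j where y: "y = p ^ i * q ^ j" using form[OF yz] by blast
      have ya: "y \<in> atoms_of M" using yz ZD(1)[OF z] by auto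
      have ij: "j * \<alpha> < i" using gt nus by (simp add: y mult.commute)
      have "p ^ i = p ^ (j * \<alpha>) * p ^ (i - j * \<alpha>)" using ij by (simp flip: power_add)
      then have "y = (p ^ (j * \<alpha>) * q ^ j) * p ^ (i - j * \<alpha>)" by (simp add: y mult_ac)
      then have "[p ^ (i - j * \<alpha>) = 1] (mod b)"
        using cong_cancel_left[OF akc[of j], of "p ^ (i - j * \<alpha>)"] atom_props(3)[OF ya] by simp
      then have "\<beta> \<le> i - j * \<alpha>" using no_small[of "i - j * \<alpha>"] ij by simp
      moreover have "i < \<alpha> + \<beta>" using atom_nu_less[OF ya] nus by (simp add: y)
      ultimately have "j = 0" "\<beta> \<le> i" using ij by (cases j; simp)+
      have "[p ^ i = 1] (mod b)" using atom_props(3)[OF ya] \<open>j = 0\<close> by (simp add: y)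
      have "p ^ i = p ^ \<beta> * p ^ (i - \<beta>)" using \<open>\<beta> \<le> i\<close> by (simp flip: power_add)
      then have "[p ^ (i - \<beta>) = 1] (mod b)"
        using cong_cancel_left[OF p\<beta>_cong, of "p ^ (i - \<beta>)"] \<open>[p ^ i = 1] (mod b)\<close> by simp
      then have "i = \<beta>" using no_small[of "i - \<beta>"] \<open>i < \<alpha> + \<beta>\<close> \<open>\<beta> \<le> i\<close> \<beta>2 by auto
      then show False using no yz y \<open>j = 0\<close> by simp
    qed
    have "(\<Sum>y\<in>#z. \<alpha> * multiplicity q y) = \<alpha> * multiplicity q (prod_mset z)"
    proof -
      have "0 \<notin># z" using ZD(1)[OF z] by (auto dest: atom_props(1))
      then show ?thesis
        by (simp only: prime_elem_multiplicity_prod_mset_distrib[OF q_elem \<open>0 \<notin># z\<close>] sum_mset_distrib_left)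
    qed
    also have "\<dots> = (\<Sum>y\<in>#z. nu y)"
      using nu_prod_atoms[OF ZD(1)[OF z]] by (simp only: ZD(2)[OF z] nux mult.commute)
    finally have sum_eq: "(\<Sum>y\<in>#z. nu y) = (\<Sum>y\<in>#z. \<alpha> * multiplicity q y)" by simp
    \<comment> \<open>Both sides have the same total over \<open>z\<close>, so none of the
      inequalities \<open>le\<close> can be strict.\<close>
    have eq: "nu y = \<alpha> * multiplicity q y" if "y \<in># z" for y
    proof -
      obtain w where w: "z = add_mset y w" using \<open>y \<in># z\<close> by (meson mset_add)
      have "(\<Sum>y\<in>#w. nu y) \<le> (\<Sum>y\<in>#w. \<alpha> * multiplicity q y)"
        using le w by (intro sum_mset_mono) auto
      then show ?thesis using sum_eq le[OF \<open>y \<in># z\<close>] w by simp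
    qed
    \<comment> \<open>With equality, \<open>y\<close> is the \<open>j\<close>-th power of the atom
      \<open>?a\<close>, and an atom cannot be a higher power.\<close>
    have all_a: "y = ?a" if yz: "y \<in># z" for y
    proof -
      obtain i j where y: "y = p ^ i * q ^ j" using form[OF yz] by blast
      have ya: "y \<in> atoms_of M" using yz ZD(1)[OF z] by auto
      have i: "i = j * \<alpha>" using eq[OF yz] nus by (simp add: y mult.commute)
      have "j \<noteq> 0" using atom_props(2)[OF ya] \<alpha> i nus by (cases "j = 0") (auto simp: y)
      have "j = 1"
      proof (rule ccontr)
        assume "j \<noteq> 1"
        then obtain k where k: "j = Suc k" "k > 0" using \<open>j \<noteq> 0\<close> by (cases j) auto
        have "y = ?a * (p ^ (k * \<alpha>) * q ^ k)" unfolding y i k by (simp add: power_add mult_ac)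
        then show False using atom_not_mult[OF ya atom_mem[OF a] ak_mem[OF k(2)]] by blast
      qed
      then show ?thesis using y i by simp
    qed
    then have "z = replicate_mset (size z) ?a" using set_mset_subset_singletonD[of z ?a] by blast
    moreover have "size z = m + 1"
    proof -
      have "\<alpha> * (m + 1) = nu x" by (simp only: nux mult.commute)
      also have "\<dots> = (\<Sum>y\<in>#z. nu y)" using nu_prod_atoms[OF ZD(1)[OF z]] ZD(2)[OF z] by simp
      also have "\<dots> = (\<Sum>y\<in>#z. \<alpha>)"
        using all_a nus(1)[of \<alpha> 1] by (intro arg_cong[of _ _ sum_mset] image_mset_cong) simp
      also have "\<dots> = \<alpha> * size z" by simp
      finally have "m + 1 = size z" using \<alpha> by (simp only: mult_cancel1) simp
      then show ?thesis ..
    qed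
    ultimately show ?thesis by (simp add: z0_def)
  qed
  have uniq1: "z = {#p ^ \<beta>, ?y#}" if z: "z \<in> Z x" and yes: "p ^ \<beta> \<in># z" for z
  proof -
    obtain w where w: "z = add_mset (p ^ \<beta>) w" using yes by (meson mset_add)
    have "w \<in> Z ?y" using ZD[OF z] x_eq p_pos w by (intro ZI) auto
    then show ?thesis using factorization_atom[OF _ y] w by blast
  qed
  have neq: "p ^ \<beta> \<noteq> ?a" "?y \<noteq> ?a"
  proof -
    show "p ^ \<beta> \<noteq> ?a" using nus(2)[of \<beta> 0] nus(2)[of \<alpha> 1] by auto
    have "m > 0" using m(1) \<beta>(1) by (cases m) auto
    show "?y \<noteq> ?a"
    proof
      assume "?y = ?a"
      then have "multiplicity q ?y = multiplicity q ?a" by (rule arg_cong)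
      then have "m + 1 = multiplicity q ?a" unfolding nus(2) .
      with \<open>m > 0\<close> show False using nus(2)[of \<alpha> 1] by simp
    qed
  qed
  show ?thesis
  proof (rule catenary_degree_geI[OF _ z0 z1, of "\<lambda>z. p ^ \<beta> \<notin># z"])
    show "x \<in> M" using ak_mem[of "m + 1"] by (simp add: x_def)
    show "p ^ \<beta> \<notin># z0" using neq(1) by (auto simp: z0_def)
    show "m + 1 \<le> fact_dist u v" if "u \<in> Z x" "v \<in> Z x" "p ^ \<beta> \<notin># u" "\<not> p ^ \<beta> \<notin># v" for u v
    proof -
      have "u = z0" "v = {#p ^ \<beta>, ?y#}" using that uniq0 uniq1 by auto
      \<comment> \<open>The two factorizations share no atom, so all \<open>m + 1\<close> atoms of
        \<open>z0\<close> count in the distance.\<close>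
      moreover have "z0 - {#p ^ \<beta>, ?y#} = z0"
        using neq by (auto simp: z0_def multiset_eq_iff)
      ultimately show ?thesis by (simp add: fact_dist_def z0_def)
    qed
  qed simp
qed

lemma catenary_degree_eq:
  "catenary_degree M =
    (if \<alpha> = 1 \<and> \<beta> = 1 then 2
     else if \<alpha> = \<beta> then 3
     else enat (1 + nat \<lceil>real \<beta> / real \<alpha>\<rceil>))"
proof -
  consider "\<alpha> = 1" "\<beta> = 1" | "\<alpha> = \<beta>" "\<alpha> > 1" | "\<alpha> < \<beta>"
    using \<alpha>_le_\<beta> \<alpha> by linarith
  then show ?thesis
  proof cases
    case 1
    then have "catenary_degree M \<le> enat 2" by (intro catenary_degree_le[of 1]) auto
    then show ?thesis
      using catenary_degree_ge_2[OF 1] 1 by (simp add: numeral_eq_enat)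
  next
    case 2
    \<comment> \<open>Although \<open>m = 1\<close> here, the exchange step requires
      \<open>N \<ge> 3\<close> unless \<alpha> = \<beta> = 1.\<close>
    then have "catenary_degree M \<le> enat 3" by (intro catenary_degree_le[of 1]) auto
    then show ?thesis
      using catenary_degree_ge_3_equal[OF 2] 2 by (simp add: numeral_eq_enat)
  next
    case 3
    define m where "m = nat \<lceil>real \<beta> / real \<alpha>\<rceil>"
    have "real \<beta> / real \<alpha> > 0" using \<alpha> \<beta>(1) by simp
    then have m_real: "real \<beta> / real \<alpha> \<le> real m" "real m < real \<beta> / real \<alpha> + 1"
      unfolding m_def by linarith+
    then have "real \<beta> \<le> real (m * \<alpha>)" "real (m * \<alpha>) < real (\<beta> + \<alpha>)"
      using \<alpha> by (simp_all add: field_simps)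
    then have m: "\<beta> \<le> m * \<alpha>" "m * \<alpha> < \<beta> + \<alpha>"
      unfolding of_nat_le_iff of_nat_less_iff .
    have "m \<ge> 2"
    proof (rule ccontr)
      assume "\<not> m \<ge> 2"
      then have "m * \<alpha> \<le> 1 * \<alpha>" by (intro mult_le_mono1) simp
      then show False using m(1) 3 by linarith
    qed
    then have "catenary_degree M \<le> enat (1 + m)"
      using m(1) by (intro catenary_degree_le[of m]) auto
    moreover have "enat (1 + m) \<le> catenary_degree M"
    \<comment> \<open>In the first case \<open>m = 2\<close>, so the bound is 3 and different
      lengths are enough.\<close>
    proof (cases "\<beta> \<le> 2 * \<alpha>")
      case True
      then have "m * \<alpha> < 3 * \<alpha>" using m(2) by linarith
      then have "m < 3" by (simp only: mult_less_cancel2)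
      then have "m = 2" using \<open>m \<ge> 2\<close> by simp
      then have "1 + m = 3" by simp
      then show ?thesis using catenary_degree_ge_3_less[OF 3 True] by (simp only: numeral_eq_enat)
    next
      case False
      then show ?thesis using catenary_degree_ge_large[OF _ m] by simp
    qed
    ultimately have "catenary_degree M = enat (1 + m)" by (rule antisym)
    then show ?thesis using 3 by (auto simp: m_def)
  qed
qed

end

theorem theorem5p1:
  fixes p a b \<alpha> \<beta> :: nat and M :: "nat set"
  assumes "prime p"
    and "\<alpha> \<ge> 1"
    and "a > 0" and "b > 0"
    and "gcd a b = 1"
    and "M = acm_set (a * p ^ \<alpha>) (b * p ^ \<alpha>)"
    and "local_singular_acm (a * p ^ \<alpha>) (b * p ^ \<alpha>)"
    and "gcd (a * p ^ \<alpha>) (b * p ^ \<alpha>) = p ^ \<alpha>"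
    and "\<beta> > 0" and "p ^ \<beta> \<in> M"
    and "\<And>n. n > 0 \<Longrightarrow> p ^ n \<in> M \<Longrightarrow> \<beta> \<le> n"
  shows "catenary_degree M =
    (if \<alpha> = 1 \<and> \<beta> = 1 then 2
     else if \<alpha> = \<beta> then 3
     else enat (1 + nat \<lceil>real \<beta> / real \<alpha>\<rceil>))"
proof -
  let ?A = "a * p ^ \<alpha>" and ?B = "b * p ^ \<alpha>"
  have pp: "p ^ \<alpha> > 0" using prime_gt_0_nat[OF assms(1)] by simp
  have acm: "?A \<le> ?B" "[?A ^ 2 = ?A] (mod ?B)"
    using assms(7) by (auto simp: local_singular_acm_def is_acm_def)
  \<comment> \<open>Dividing the idempotency congruence by \<open>p ^ \<alpha>\<close>; since
    \<open>a\<close> is a unit modulo \<open>b\<close>, it cancels and leaves \<open>?A\<close>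
    congruent to 1.\<close>
  have "[?A * a = 1 * a] (mod b)"
  proof -
    have "[p ^ \<alpha> * (?A * a) = p ^ \<alpha> * a] (mod p ^ \<alpha> * b)"
      using acm(2) by (simp add: power2_eq_square mult_ac)
    then show ?thesis using prime_gt_0_nat[OF assms(1)] by (simp add: Cong.cong_def mult_mod_right[symmetric])
  qed
  then have Ac: "[?A = 1] (mod b)"
    by (rule cong_mult_rcancel_nat[OF gcd_eq_1_imp_coprime[OF assms(5)], THEN iffD1])
  have "coprime ?A b" using cong_coprime_left[OF Ac] by simp
  then have pb: "coprime p b" using assms(2) by simp
  have mem: "x \<in> M \<longleftrightarrow> x = 1 \<or> x > 0 \<and> p ^ \<alpha> dvd x \<and> [x = 1] (mod b)" for x
  proof
    assume "x \<in> M"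
    then consider "x = 1" | k where "x = ?A + ?B * k" unfolding assms(6) acm_set_def by auto
    then show "x = 1 \<or> x > 0 \<and> p ^ \<alpha> dvd x \<and> [x = 1] (mod b)"
    proof cases
      case 2
      have "[?A + b * (p ^ \<alpha> * k) = 1 + 0] (mod b)"
        using Ac cong_mult_self_left by (rule cong_add)
      then have "[x = 1] (mod b)" using 2 by (simp add: mult.assoc)
      then show ?thesis using 2 assms(3) pp by simp
    qed simp
  next
    assume "x = 1 \<or> x > 0 \<and> p ^ \<alpha> dvd x \<and> [x = 1] (mod b)"
    then show "x \<in> M"
    proof
      assume "x = 1"
      then show ?thesis by (simp add: assms(6) acm_set_def)
    next
      assume x: "x > 0 \<and> p ^ \<alpha> dvd x \<and> [x = 1] (mod b)"
      then obtain y where y: "x = p ^ \<alpha> * y" by blast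
      have "[p ^ \<alpha> * y = p ^ \<alpha> * a] (mod b)"
        using x Ac y by (metis cong_sym cong_trans mult.commute)
      then have ya: "[y = a] (mod b)"
        using cong_mult_lcancel_nat[of "p ^ \<alpha>" b y a] pb by simp
      \<comment> \<open>\<open>a\<close> is the smallest positive number of its class because
        \<open>a \<le> b\<close>. A smaller \<open>y\<close> in that class could only be 0, with
        \<open>a = b\<close>, but \<open>x\<close> is positive.\<close>
      have "a \<le> y"
      proof (rule ccontr)
        assume "\<not> a \<le> y"
        moreover have "a \<le> b" using acm(1) pp by auto
        ultimately have "y < b" "y < a" by auto
        then have "y = a mod b" using ya by (simp add: Cong.cong_def)
        then have "a = b \<and> y = 0" using \<open>y < a\<close> \<open>a \<le> b\<close> by (cases "a = b") auto
        then show False using x y by simp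
      qed
      then obtain k where "y = a + b * k"
        using ya by (metis cong_le_nat cong_sym mult.commute add.commute)
      then show ?thesis
        unfolding assms(6) acm_set_def using y by (auto simp: algebra_simps)
    qed
  qed
  interpret local_acm p \<alpha> \<beta> b M
    by unfold_locales (use assms pb mem in auto)
  show ?thesis by (rule catenary_degree_eq)
qed

end
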